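(* (Cauchy type theorem and formula.) Let $T(x)=(px+q)(rx+s)^{-1}$ be a Möbius transformation on $\mathcal A$, let $\Xi\subset\mathcal A$ be such that $T(\Xi)=J_a^b$, and let $y\in\Xi$ be the fixed base point. If $h\in{}_a^{\psi}\mathcal M^{\alpha,\sigma,\varphi,T}(\Xi)$, then $$\int_{\partial\Xi}{}^{\psi}\eta_x\,e^{\sum_{k=0}^2\lambda_k\circ T(x)}\,{}_aI^{1-\alpha,\sigma,\varphi}[h\circ T^{-1}](T(x),T(y))=0$$ and $$\mathbf D_a^{1-\alpha,\sigma,\varphi}\Big[\int_{\partial\Xi}e^{\sum_{k=0}^2[\lambda_k\circ T(\tau)-\lambda_k\circ T(x)]}K_\psi(\tau-x)\,{}^{\psi}\eta_\tau\,{}_aI^{1-\alpha,\sigma,\varphi}[h\circ T^{-1}](T(\tau),T(y))\Big]$$ equals $$\sum_{i=0}^2h\circ T^{-1}(T(y)_0,\dots,T(x)_i,\dots,T(y)_2)+\sum_{\substack{i,j=0\\ i\ne j}}^2{}_{a_j}D^{1-\alpha_j,\sigma_j,\varphi_j}({}_{a_i}I^{1-\alpha_i,\sigma_i,\varphi_i}h\circ T^{-1})(T(y)_0,\dots,T(x)_i,\dots,T(y)_2)$$ if $x\in\Xi$, and equals $0$ if $x\in\mathcal A\setminus\overline\Xi$.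
   Context: Quaternions and structural set. $\mathbb H$ is the skew-field of real quaternions with standard basis $\mathbf e_0=1,\mathbf e_1,\mathbf e_2,\mathbf e_3$, conjugation $q\mapsto\overline q$ and norm $|q|$. $\psi=\{\psi_0,\psi_1,\psi_2\}\subset\mathrm{span}_{\mathbb R}\{\mathbf e_0,\mathbf e_1,\mathbf e_2\}$ is a structural set, i.e. it is orthonormal: $\psi_k\overline\psi_s+\psi_s\overline\psi_k=2\delta_{k,s}$; by convention $\psi_0=1$. $\psi_3$ is a unit vector such that $\{\psi_0,\psi_1,\psi_2,\psi_3\}$ is an orthonormal basis of $\mathbb H$ and $\{\psi_1,\psi_2,\psi_3\}$ is cooriented with $\{\mathbf e_1,\mathbf e_2,\mathbf e_3\}$. $\mathcal A=\mathrm{span}_{\mathbb R}\{\psi_0,\psi_1,\psi_2\}\cong\mathbb R^3$, $x=\sum_{k=0}^2x_k\psi_k$; the $i$-th coordinate of $T(x)$ is $T(x)_i$. $\mathbb H$-valued functions are written $f=\sum_{k=0}^3f_k\psi_k$ with $f_k$ real valued. The left $\psi$-Cauchy-Riemann operator is ${}^{\psi}\overline\partial f=\sum_{k=0}^2\psi_k\,\partial f/\partial x_k$; a subscript indicates the variable of differentiation. ${}^{\psi}\eta_x=\sum_{k=0}^2(-1)^k\psi_k\,d\hat x_k$ is the quaternionic area form, where $d\hat x_k$ is $dx_0\wedge dx_1\wedge dx_2$ with $dx_k$ omitted. $K_\psi(x)=\frac{\overline x}{4\pi|x|^3}$ for $x\in\mathcal A\setminus\{0\}$, with $\overline x=x_0\psi_0-x_1\psi_1-x_2\psi_2$.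 Möbius transformations. A Möbius transformation on $\mathcal A$ is $T(x)=(px+q)(rx+s)^{-1}$ with $p,q,r,s\in\mathbb H$, where: if $r=0$, $qs^{-1}\in\mathcal A$ and $\frac{s^{-1}}{|s^{-1}|}=\psi_3\frac{\overline p}{|p|}\overline\psi_3$; if $r\ne0$, $\frac{(q-pr^{-1}s)^{-1}}{|(q-pr^{-1}s)^{-1}|}=\psi_3\frac{\overline r}{|r|}\overline\psi_3$ and $pr^{-1},\ s(q-pr^{-1}s)^{-1}\in\mathcal A$. Fractional data. $a=\sum_{k=0}^2\psi_ka_k$, $b=\sum_{k=0}^2\psi_kb_k$ with $a_k<b_k$, and $J_a^b=\{\sum_{k=0}^2\psi_kx_k: a_k<x_k<b_k\}$. $\sigma=\sum_{k=0}^2\psi_k\sigma_k$ with $0<\sigma_k<1$; $\alpha=(\alpha_0,\alpha_1,\alpha_2)\in\mathbb C^3$ with $0<\Re\alpha_k<1$; $1-\alpha=(1-\alpha_0,1-\alpha_1,1-\alpha_2)$. (For non-real $\alpha_k$, values are taken in $\mathbb C\otimes\mathbb H$, the complex unit commuting with the $\psi_k$.) A point $y\in\Xi$ is fixed and $\zeta:=T(y)\in J_a^b$. $\varphi\in C^1(\overline{J_a^b},\mathbb R)$ satisfies $\frac{\partial}{\partial\xi_i}\varphi(\zeta_0,\dots,\xi_i,\dots,\zeta_2)>0$ for all $\xi_i\in[a_i,b_i]$, $i=0,1,2$ (only the $i$-th coordinate of $\zeta$ is replaced by $\xi_i$). Put $\varphi_i(\xi_i)=\varphi(\zeta_0,\dots,\xi_i,\dots,\zeta_2)$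 and $D\varphi(\xi,\zeta)=\sum_{i=0}^2\frac{\partial}{\partial\xi_i}\varphi(\zeta_0,\dots,\xi_i,\dots,\zeta_2)$. For a one-variable function $u$, $0<\Re\beta<1$ and $\rho\in(0,1)$, $$({}_{a_i}I^{\beta,\rho,\varphi_i}u)(t)=\frac1{\rho^\beta\Gamma(\beta)}\int_{a_i}^te^{\frac{\rho-1}{\rho}(\varphi_i(t)-\varphi_i(\tau))}(\varphi_i(t)-\varphi_i(\tau))^{\beta-1}u(\tau)\varphi_i'(\tau)\,d\tau,$$ $$({}_{a_i}D^{\beta,\rho,\varphi_i}u)(t)=(1-\rho)v(t)+\rho\,\frac{v'(t)}{\varphi_i'(t)},\qquad v={}_{a_i}I^{1-\beta,\rho,\varphi_i}u.$$ For $\mathbb H$-valued $f$ on $J_a^b$ and $\beta=(\beta_0,\beta_1,\beta_2)$, $${}_aI^{\beta,\sigma,\varphi}[f](\xi,\zeta)=\sum_{i=0}^2({}_{a_i}I^{\beta_i,\sigma_i,\varphi_i}f)(\zeta_0,\dots,\xi_i,\dots,\zeta_2),$$ the $i$-th integral acting on the $i$-th variable. Define $\mathbf D_a^{1-\alpha,\sigma,\varphi}=\sum_{i=0}^2{}_{a_i}D^{1-\alpha_i,\sigma_i,\varphi_i}$, where ${}_{a_i}D^{1-\alpha_i,\sigma_i,\varphi_i}$ acts as a partial operator in the $i$-th real coordinate $\xi_i$ of $\xi=T(x)\in J_a^b$, with $\zeta=T(y)$ fixed and the other coordinates of $\xi$ held fixed; in particular for $i\ne j$, ${}_{a_j}D^{1-\alpha_j,\sigma_j,\varphi_j}$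 acts on a function of $\xi_i$ alone as on a constant with respect to $\xi_j$. For $x\in\mathcal A\setminus\overline\Xi$ (where the $\lambda_k$ and $\varphi$ are not given at $T(x)$), $\sum_k\lambda_k\circ T(x)$ stands for the value of an arbitrary real extension, and the exterior assertion is understood as the vanishing of the bracketed integral for $x\in\mathcal A\setminus\overline\Xi$. Standing assumption: there are $\lambda_0,\lambda_1,\lambda_2\in C^1(\overline{J_a^b},\mathbb R)$ with ${}^{\psi}\overline\partial_\xi\left[\sum_{k=0}^2\lambda_k(\xi)\right]=D\varphi(\xi,\zeta)\,\sigma^{-1}(1-\sigma)$; these are the $\lambda_k$ used. The operator associated with $T$ is $${}_a^{\psi}\overline\partial_x^{\alpha,\sigma,\varphi,T}[g](x,y)={}^{\psi}\overline\partial_x\Big[\sum_{k=0}^2\lambda_k\circ T(x)\Big]\,{}_aI^{1-\alpha,\sigma,\varphi}[g](T(x),T(y))+{}^{\psi}\overline\partial_x\Big({}_aI^{1-\alpha,\sigma,\varphi}[g](T(x),T(y))\Big).$$ The module of fractional hyperholomorphic functions associated with $T$ is $${}_a^{\psi}\mathcal M^{\alpha,\sigma,\varphi,T}(\Xi)=\{h\in AC^1(\Xi,\mathbb H): h\circ T^{-1}\in\mathrm{Ker}({}_a^{\psi}\overline\partial_x^{\alpha,\sigma,\varphi,T})\cap C^1(J_a^b,\mathbb H)\},$$ where $\mathrm{Ker}$ means ${}_a^{\psi}\overline\partial_x^{\alpha,\sigma,\varphi,T}[h\circ T^{-1}](x,y)=0$ for all $x\in\Xi$, and $AC^1(\Xi,\mathbb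 H)$ is the set of $\mathbb H$-valued functions on $\Xi$ whose real components are absolutely continuous in each coordinate separately.
   Formalization: At the lower endpoint t = a_i the fractional integral is taken as its limit from the right (not as the empty integral 0, for which the claim can fail), and Ξ is assumed bounded, i.e. the value of T at infinity does not lie on the boundary of J_a^b. *)

theory Defs
  imports "HOL-Analysis.Analysis"
begin

section \<open>Quaternions and complexified quaternions\<close>

text \<open>
  \<open>\<H>\<close> is \<^typ>\<open>real^4\<close> and \<open>\<complex> \<otimes> \<H>\<close> is \<^typ>\<open>complex^4\<close>, both with the components indexed by
  \<open>0, 1, 2, 3 :: 4\<close> relative to \<open>e\<^sub>0 = 1, e\<^sub>1, e\<^sub>2, e\<^sub>3\<close>.  The product \<open>*\<close> of
  the library on these types is the componentwise one; the Hamilton product is \<open>\<odot>\<close>.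
\<close>

type_synonym quat = "real^4"
type_synonym cquat = "complex^4"

definition mk_quat :: "'a \<Rightarrow> 'a \<Rightarrow> 'a \<Rightarrow> 'a \<Rightarrow> 'a^4" where
  "mk_quat u0 u1 u2 u3 =
     (\<chi> i. if i = 0 then u0 else if i = 1 then u1 else if i = 2 then u2 else u3)"

definition qmult :: "('a::comm_ring_1)^4 \<Rightarrow> 'a^4 \<Rightarrow> 'a^4" (infixl "\<odot>" 70) where
  "u \<odot> v = mk_quat
     (u$0 * v$0 - u$1 * v$1 - u$2 * v$2 - u$3 * v$3)
     (u$0 * v$1 + u$1 * v$0 + u$2 * v$3 - u$3 * v$2)
     (u$0 * v$2 - u$1 * v$3 + u$2 * v$0 + u$3 * v$1)
     (u$0 * v$3 + u$1 * v$2 - u$2 * v$1 + u$3 * v$0)"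

definition qone :: quat where
  "qone = axis 0 1"

definition qcnj :: "quat \<Rightarrow> quat" where
  "qcnj u = mk_quat (u$0) (- (u$1)) (- (u$2)) (- (u$3))"

definition qinv :: "quat \<Rightarrow> quat" where
  "qinv u = inverse ((norm u)\<^sup>2) *\<^sub>R qcnj u"

definition cquat_of :: "quat \<Rightarrow> cquat" where
  "cquat_of u = (\<chi> i. complex_of_real (u$i))"

definition structural_set :: "(3 \<Rightarrow> quat) \<Rightarrow> bool" where
  "structural_set \<psi> \<longleftrightarrow>
     (\<forall>k. \<psi> k \<in> span {axis 0 1, axis 1 1, axis 2 1}) \<and>
     (\<forall>k s. \<psi> k \<odot> qcnj (\<psi> s) + \<psi> s \<odot> qcnj (\<psi> k) = (if k = s then 2 *\<^sub>R qone else 0)) \<and>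
     \<psi> 0 = qone"

definition im_part :: "quat \<Rightarrow> real^3" where
  "im_part u = vector [u$1, u$2, u$3]"

text \<open>
  \<open>\<psi>3\<close> completes \<open>\<psi>\<close> to an orthonormal basis of \<open>\<H>\<close>, and \<open>\<psi>\<^sub>1, \<psi>\<^sub>2, \<psi>\<^sub>3\<close> (which are then purely
  imaginary) have the orientation of \<open>e\<^sub>1, e\<^sub>2, e\<^sub>3\<close>.
\<close>

definition completes_basis :: "(3 \<Rightarrow> quat) \<Rightarrow> quat \<Rightarrow> bool" where
  "completes_basis \<psi> \<psi>3 \<longleftrightarrow>
     norm \<psi>3 = 1 \<and> (\<forall>k. \<psi> k \<bullet> \<psi>3 = 0) \<and>
     det (vector [im_part (\<psi> 1), im_part (\<psi> 2), im_part \<psi>3] :: real^3^3) > 0"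

text \<open>
  A point \<open>\<Sum>k. x\<^sub>k \<psi>\<^sub>k\<close> of \<open>\<A> = span \<psi>\<close> is represented by its coordinate vector
  in \<^typ>\<open>real^3\<close>, with indices \<open>0, 1, 2 :: 3\<close> (arithmetic on the type \<open>3\<close> is modulo 3).
\<close>

definition emb :: "(3 \<Rightarrow> quat) \<Rightarrow> real^3 \<Rightarrow> quat" where
  "emb \<psi> x = (\<Sum>k\<in>UNIV. (x$k) *\<^sub>R \<psi> k)"

definition upd :: "real^3 \<Rightarrow> 3 \<Rightarrow> real \<Rightarrow> real^3" where
  "upd x i t = (\<chi> k. if k = i then t else x$k)"


section \<open>Regularity classes\<close>

definition C1_on :: "'a::euclidean_space set \<Rightarrow> ('a \<Rightarrow> 'b::real_normed_vector) \<Rightarrow> bool" where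
  "C1_on S f \<longleftrightarrow> (\<exists>f'. (\<forall>x\<in>S. (f has_derivative blinfun_apply (f' x)) (at x within S)) \<and>
                       continuous_on S f')"

definition abs_continuous_on :: "real set \<Rightarrow> (real \<Rightarrow> real) \<Rightarrow> bool" where
  "abs_continuous_on S f \<longleftrightarrow>
     (\<forall>\<epsilon>>0. \<exists>\<delta>>0. \<forall>\<I>::(real \<times> real) set.
        finite \<I> \<and> (\<forall>(u, v)\<in>\<I>. u \<le> v \<and> {u..v} \<subseteq> S) \<and>
        pairwise (\<lambda>(u, v) (u', v'). {u<..<v} \<inter> {u'<..<v'} = {}) \<I> \<and>
        (\<Sum>(u, v)\<in>\<I>. v - u) < \<delta>
        \<longrightarrow> (\<Sum>(u, v)\<in>\<I>. \<bar>f v - f u\<bar>) < \<epsilon>)"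

definition AC1 :: "(3 \<Rightarrow> quat) \<Rightarrow> quat \<Rightarrow> (real^3) set \<Rightarrow> (real^3 \<Rightarrow> quat) \<Rightarrow> bool" where
  "AC1 \<psi> \<psi>3 \<Xi> h \<longleftrightarrow>
     (\<forall>e \<in> insert \<psi>3 (range \<psi>). \<forall>k. \<forall>x\<in>\<Xi>.
        abs_continuous_on {t. upd x k t \<in> \<Xi>} (\<lambda>t. h (upd x k t) \<bullet> e))"


section \<open>The Cauchy-Riemann operator, the Cauchy kernel and integration of the area form\<close>

definition CR :: "(3 \<Rightarrow> quat) \<Rightarrow> (real^3 \<Rightarrow> cquat) \<Rightarrow> real^3 \<Rightarrow> cquat" where
  "CR \<psi> f x =
     (\<Sum>k\<in>UNIV. cquat_of (\<psi> k) \<odot> vector_derivative (\<lambda>t. f (upd x k t)) (at (x$k)))"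

definition CR_real :: "(3 \<Rightarrow> quat) \<Rightarrow> (real^3 \<Rightarrow> real) \<Rightarrow> real^3 \<Rightarrow> quat" where
  "CR_real \<psi> f x = (\<Sum>k\<in>UNIV. deriv (\<lambda>t. f (upd x k t)) (x$k) *\<^sub>R \<psi> k)"

definition cauchy_kernel :: "(3 \<Rightarrow> quat) \<Rightarrow> real^3 \<Rightarrow> quat" where
  "cauchy_kernel \<psi> x = inverse (4 * pi * norm x ^ 3) *\<^sub>R ((x$0) *\<^sub>R \<psi> 0 - (x$1) *\<^sub>R \<psi> 1 - (x$2) *\<^sub>R \<psi> 2)"

text \<open>
  The value of \<open>\<eta> = \<psi>\<^sub>0 dx\<^sub>1 \<and> dx\<^sub>2 - \<psi>\<^sub>1 dx\<^sub>0 \<and> dx\<^sub>2 + \<psi>\<^sub>2 dx\<^sub>0 \<and> dx\<^sub>1\<close>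
  on a pair of tangent vectors.
\<close>

definition area_form :: "(3 \<Rightarrow> quat) \<Rightarrow> real^3 \<Rightarrow> real^3 \<Rightarrow> quat" where
  "area_form \<psi> v w =
       (v$1 * w$2 - v$2 * w$1) *\<^sub>R \<psi> 0
     - (v$0 * w$2 - v$2 * w$0) *\<^sub>R \<psi> 1
     + (v$0 * w$1 - v$1 * w$0) *\<^sub>R \<psi> 2"

text \<open>
  Integration over the boundary of \<open>S ` box a b\<close>, where \<open>S\<close> is a diffeomorphism on a
  neighbourhood of \<open>cbox a b\<close>: the form is pulled back along \<open>S\<close> to the six faces of the box.
  The face \<open>\<xi>\<^sub>i = c\<close> is parametrised by \<open>(\<xi>\<^bsub>i+1\<^esub>, \<xi>\<^bsub>i+2\<^esub>)\<close>, indices modulo 3, which is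
  positively oriented with respect to the outward normal of the box for \<open>c = b\<^sub>i\<close>
  and negatively for \<open>c = a\<^sub>i\<close>.  The boundary of \<open>S ` box a b\<close> carries the orientation induced by
  \<open>(x\<^sub>0, x\<^sub>1, x\<^sub>2)\<close> (outward normal), whence the sign of the Jacobian determinant: \<open>S\<close> may reverse
  the orientation, as \<open>x \<mapsto> x\<^sup>-\<^sup>1\<close> does.  An integrand \<open>L(\<tau>) \<eta>\<^sub>\<tau> R(\<tau>)\<close> is given as the function
  \<open>\<Theta>\<close> that takes \<open>\<tau>\<close> and the quaternion that is the value of \<open>\<eta>\<^sub>\<tau>\<close>.
\<close>

definition face_point :: "3 \<Rightarrow> real \<Rightarrow> real \<times> real \<Rightarrow> real^3" where
  "face_point i c w = (\<chi> k. if k = i then c else if k = i + 1 then fst w else snd w)"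

definition face_rect :: "real^3 \<Rightarrow> real^3 \<Rightarrow> 3 \<Rightarrow> (real \<times> real) set" where
  "face_rect a b i = {a$(i+1)..b$(i+1)} \<times> {a$(i+2)..b$(i+2)}"

definition boundary_pullback ::
  "(3 \<Rightarrow> quat) \<Rightarrow> (real^3 \<Rightarrow> real^3) \<Rightarrow> (real^3 \<Rightarrow> quat \<Rightarrow> cquat) \<Rightarrow> 3 \<Rightarrow> real^3 \<Rightarrow> cquat" where
  "boundary_pullback \<psi> S \<Theta> i \<xi> =
     (let S' = frechet_derivative S (at \<xi>)
      in \<Theta> (S \<xi>) (sgn (det (matrix S')) *\<^sub>R area_form \<psi> (S' (axis (i+1) 1)) (S' (axis (i+2) 1))))"

definition boundary_integrable ::
  "(3 \<Rightarrow> quat) \<Rightarrow> real^3 \<Rightarrow> real^3 \<Rightarrow> (real^3 \<Rightarrow> real^3) \<Rightarrow> (real^3 \<Rightarrow> quat \<Rightarrow> cquat) \<Rightarrow> bool" where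
  "boundary_integrable \<psi> a b S \<Theta> \<longleftrightarrow>
     (\<forall>i. \<forall>c\<in>{a$i, b$i}.
        set_integrable lborel (face_rect a b i) (\<lambda>w. boundary_pullback \<psi> S \<Theta> i (face_point i c w)))"

definition boundary_integral ::
  "(3 \<Rightarrow> quat) \<Rightarrow> real^3 \<Rightarrow> real^3 \<Rightarrow> (real^3 \<Rightarrow> real^3) \<Rightarrow> (real^3 \<Rightarrow> quat \<Rightarrow> cquat) \<Rightarrow> cquat" where
  "boundary_integral \<psi> a b S \<Theta> =
     (\<Sum>i\<in>UNIV.
        (LINT w:face_rect a b i|lborel. boundary_pullback \<psi> S \<Theta> i (face_point i (b$i) w)) -
        (LINT w:face_rect a b i|lborel. boundary_pullback \<psi> S \<Theta> i (face_point i (a$i) w)))"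


section \<open>Moebius transformations\<close>

definition mobius_data :: "(3 \<Rightarrow> quat) \<Rightarrow> quat \<Rightarrow> quat \<Rightarrow> quat \<Rightarrow> quat \<Rightarrow> quat \<Rightarrow> bool" where
  "mobius_data \<psi> \<psi>3 p q r s \<longleftrightarrow>
     (if r = 0 then
        p \<noteq> 0 \<and> s \<noteq> 0 \<and> q \<odot> qinv s \<in> range (emb \<psi>) \<and>
        qinv s /\<^sub>R norm (qinv s) = \<psi>3 \<odot> (qcnj p /\<^sub>R norm p) \<odot> qcnj \<psi>3
      else
        (let d = q - p \<odot> qinv r \<odot> s
         in d \<noteq> 0 \<and>
            qinv d /\<^sub>R norm (qinv d) = \<psi>3 \<odot> (qcnj r /\<^sub>R norm r) \<odot> qcnj \<psi>3 \<and>
            p \<odot> qinv r \<in> range (emb \<psi>) \<and> s \<odot> qinv d \<in> range (emb \<psi>)))"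

definition mobius_dom :: "(3 \<Rightarrow> quat) \<Rightarrow> quat \<Rightarrow> quat \<Rightarrow> (real^3) set" where
  "mobius_dom \<psi> r s = {x. r \<odot> emb \<psi> x + s \<noteq> 0}"

text \<open>
  The inner products with the orthonormal \<open>\<psi>\<^sub>k\<close> are the coordinates of \<open>(px+q)(rx+s)\<^sup>-\<^sup>1 \<in> \<A>\<close>.
\<close>

definition mobius :: "(3 \<Rightarrow> quat) \<Rightarrow> quat \<Rightarrow> quat \<Rightarrow> quat \<Rightarrow> quat \<Rightarrow> real^3 \<Rightarrow> real^3" where
  "mobius \<psi> p q r s x = (\<chi> k. ((p \<odot> emb \<psi> x + q) \<odot> qinv (r \<odot> emb \<psi> x + s)) \<bullet> \<psi> k)"

definition mobius_inv :: "(3 \<Rightarrow> quat) \<Rightarrow> quat \<Rightarrow> quat \<Rightarrow> quat \<Rightarrow> quat \<Rightarrow> real^3 \<Rightarrow> real^3" where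
  "mobius_inv \<psi> p q r s = inv_into (mobius_dom \<psi> r s) (mobius \<psi> p q r s)"


section \<open>Proportional fractional integrals and derivatives\<close>

text \<open>\<open>\<Phi>\<close> is the one-variable function written \<open>\<phi>\<^sub>i\<close> in the multivariate setting.\<close>

definition frac_integrand ::
  "complex \<Rightarrow> real \<Rightarrow> (real \<Rightarrow> real) \<Rightarrow> (real \<Rightarrow> cquat) \<Rightarrow> real \<Rightarrow> real \<Rightarrow> cquat" where
  "frac_integrand \<beta> \<rho> \<Phi> u t \<tau> =
     (complex_of_real (exp ((\<rho> - 1) / \<rho> * (\<Phi> t - \<Phi> \<tau>))) *
      complex_of_real (\<Phi> t - \<Phi> \<tau>) powr (\<beta> - 1) * complex_of_real (deriv \<Phi> \<tau>)) *s u \<tau>"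

definition frac_integral_formula ::
  "complex \<Rightarrow> real \<Rightarrow> (real \<Rightarrow> real) \<Rightarrow> real \<Rightarrow> (real \<Rightarrow> cquat) \<Rightarrow> real \<Rightarrow> cquat" where
  "frac_integral_formula \<beta> \<rho> \<Phi> a u t =
     (1 / (complex_of_real \<rho> powr \<beta> * Gamma \<beta>)) *s
     (LINT \<tau>:{a<..<t}|lborel. frac_integrand \<beta> \<rho> \<Phi> u t \<tau>)"

text \<open>
  At the lower endpoint the fractional integral is its initial value \<open>(I u)(a+)\<close>, as is customary.
  This is \<open>0\<close>, the value of the formula, if \<open>u\<close> is bounded near \<open>a\<close>,
  but not for \<open>u(\<tau>) = (\<Phi> \<tau> - \<Phi> a)\<^bsup>-\<beta>\<^esup>\<close>.
\<close>

definition frac_integral ::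
  "complex \<Rightarrow> real \<Rightarrow> (real \<Rightarrow> real) \<Rightarrow> real \<Rightarrow> (real \<Rightarrow> cquat) \<Rightarrow> real \<Rightarrow> cquat" where
  "frac_integral \<beta> \<rho> \<Phi> a u t =
     (if t = a then Lim (at_right a) (frac_integral_formula \<beta> \<rho> \<Phi> a u)
      else frac_integral_formula \<beta> \<rho> \<Phi> a u t)"

definition frac_deriv ::
  "complex \<Rightarrow> real \<Rightarrow> (real \<Rightarrow> real) \<Rightarrow> real \<Rightarrow> (real \<Rightarrow> cquat) \<Rightarrow> real \<Rightarrow> cquat" where
  "frac_deriv \<beta> \<rho> \<Phi> a u t =
     (let v = frac_integral (1 - \<beta>) \<rho> \<Phi> a u
      in (1 - \<rho>) *\<^sub>R v t + (\<rho> / deriv \<Phi> t) *\<^sub>R vector_derivative v (at t))"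

definition phi_slice :: "(real^3 \<Rightarrow> real) \<Rightarrow> real^3 \<Rightarrow> 3 \<Rightarrow> real \<Rightarrow> real" where
  "phi_slice \<phi> \<zeta> i t = \<phi> (upd \<zeta> i t)"

definition D_phi :: "(real^3 \<Rightarrow> real) \<Rightarrow> real^3 \<Rightarrow> real^3 \<Rightarrow> real" where
  "D_phi \<phi> \<xi> \<zeta> = (\<Sum>i\<in>UNIV. deriv (phi_slice \<phi> \<zeta> i) (\<xi>$i))"

definition partial_frac_integral ::
  "real^3 \<Rightarrow> complex^3 \<Rightarrow> real^3 \<Rightarrow> (real^3 \<Rightarrow> real) \<Rightarrow> real^3 \<Rightarrow> 3 \<Rightarrow> (real^3 \<Rightarrow> quat) \<Rightarrow> real \<Rightarrow> cquat"
where
  "partial_frac_integral a \<beta> \<sigma> \<phi> \<zeta> i f t =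
     frac_integral (\<beta>$i) (\<sigma>$i) (phi_slice \<phi> \<zeta> i) (a$i) (\<lambda>\<tau>. cquat_of (f (upd \<zeta> i \<tau>))) t"

definition total_frac_integral ::
  "real^3 \<Rightarrow> complex^3 \<Rightarrow> real^3 \<Rightarrow> (real^3 \<Rightarrow> real) \<Rightarrow> (real^3 \<Rightarrow> quat) \<Rightarrow> real^3 \<Rightarrow> real^3 \<Rightarrow> cquat"
where
  "total_frac_integral a \<beta> \<sigma> \<phi> f \<xi> \<zeta> =
     (\<Sum>i\<in>UNIV. partial_frac_integral a \<beta> \<sigma> \<phi> \<zeta> i f (\<xi>$i))"

text \<open>
  The fractional derivative in the \<open>j\<close>-th coordinate of \<open>\<xi>\<close>; the other coordinates are those of \<open>\<xi>\<close>,
  and \<open>\<zeta>\<close> enters through \<open>\<phi>\<^sub>j\<close> only.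
\<close>

definition partial_frac_deriv ::
  "real^3 \<Rightarrow> complex^3 \<Rightarrow> real^3 \<Rightarrow> (real^3 \<Rightarrow> real) \<Rightarrow> real^3 \<Rightarrow> 3 \<Rightarrow> (real^3 \<Rightarrow> cquat) \<Rightarrow> real^3 \<Rightarrow> cquat"
where
  "partial_frac_deriv a \<beta> \<sigma> \<phi> \<zeta> j F \<xi> =
     frac_deriv (\<beta>$j) (\<sigma>$j) (phi_slice \<phi> \<zeta> j) (a$j) (\<lambda>t. F (upd \<xi> j t)) (\<xi>$j)"

definition total_frac_deriv ::
  "real^3 \<Rightarrow> complex^3 \<Rightarrow> real^3 \<Rightarrow> (real^3 \<Rightarrow> real) \<Rightarrow> real^3 \<Rightarrow> (real^3 \<Rightarrow> cquat) \<Rightarrow> real^3 \<Rightarrow> cquat"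
where
  "total_frac_deriv a \<beta> \<sigma> \<phi> \<zeta> F \<xi> = (\<Sum>j\<in>UNIV. partial_frac_deriv a \<beta> \<sigma> \<phi> \<zeta> j F \<xi>)"


section \<open>Fractional hyperholomorphic functions associated with a transformation\<close>

definition frac_CR ::
  "(3 \<Rightarrow> quat) \<Rightarrow> real^3 \<Rightarrow> complex^3 \<Rightarrow> real^3 \<Rightarrow> (real^3 \<Rightarrow> real) \<Rightarrow> (3 \<Rightarrow> real^3 \<Rightarrow> real) \<Rightarrow>
   (real^3 \<Rightarrow> real^3) \<Rightarrow> (real^3 \<Rightarrow> quat) \<Rightarrow> real^3 \<Rightarrow> real^3 \<Rightarrow> cquat" where
  "frac_CR \<psi> a \<alpha> \<sigma> \<phi> lam T g x y =
     cquat_of (CR_real \<psi> (\<lambda>x. \<Sum>k\<in>UNIV. lam k (T x)) x) \<odot>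
       total_frac_integral a (1 - \<alpha>) \<sigma> \<phi> g (T x) (T y)
     + CR \<psi> (\<lambda>x. total_frac_integral a (1 - \<alpha>) \<sigma> \<phi> g (T x) (T y)) x"

text \<open>
  The integrals and derivatives occurring in \<^const>\<open>frac_CR\<close> exist.  Integrals and derivatives are
  total functions here, so membership in the kernel has to include this.
\<close>

definition frac_CR_defined ::
  "real^3 \<Rightarrow> real^3 \<Rightarrow> complex^3 \<Rightarrow> real^3 \<Rightarrow> (real^3 \<Rightarrow> real) \<Rightarrow> (real^3 \<Rightarrow> real^3) \<Rightarrow>
   (real^3) set \<Rightarrow> (real^3 \<Rightarrow> quat) \<Rightarrow> real^3 \<Rightarrow> bool" where
  "frac_CR_defined a b \<alpha> \<sigma> \<phi> T \<Xi> g y \<longleftrightarrow>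
     (\<forall>i. \<forall>t\<in>{a$i<..<b$i}.
        set_integrable lborel {a$i<..<t}
          (frac_integrand (1 - \<alpha>$i) (\<sigma>$i) (phi_slice \<phi> (T y) i)
             (\<lambda>\<tau>. cquat_of (g (upd (T y) i \<tau>))) t)) \<and>
     (\<forall>x\<in>\<Xi>. (\<lambda>x. total_frac_integral a (1 - \<alpha>) \<sigma> \<phi> g (T x) (T y)) differentiable (at x))"

definition frac_hyperholomorphic ::
  "(3 \<Rightarrow> quat) \<Rightarrow> quat \<Rightarrow> real^3 \<Rightarrow> real^3 \<Rightarrow> complex^3 \<Rightarrow> real^3 \<Rightarrow> (real^3 \<Rightarrow> real) \<Rightarrow>
   (3 \<Rightarrow> real^3 \<Rightarrow> real) \<Rightarrow> (real^3 \<Rightarrow> real^3) \<Rightarrow> (real^3 \<Rightarrow> real^3) \<Rightarrow> (real^3) set \<Rightarrow> real^3 \<Rightarrow>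
   (real^3 \<Rightarrow> quat) set" where
  "frac_hyperholomorphic \<psi> \<psi>3 a b \<alpha> \<sigma> \<phi> lam T T' \<Xi> y =
     {h. AC1 \<psi> \<psi>3 \<Xi> h \<and> C1_on (box a b) (h \<circ> T') \<and>
         frac_CR_defined a b \<alpha> \<sigma> \<phi> T \<Xi> (h \<circ> T') y \<and>
         (\<forall>x\<in>\<Xi>. frac_CR \<psi> a \<alpha> \<sigma> \<phi> lam T (h \<circ> T') x y = 0)}"

end

theory Submission imports Defs begin

text \<open>
Put \<open>\<xi> = T x\<close> and \<open>\<zeta> = T y\<close>.  The fractional integral \<open>F\<close> of \<open>h \<circ> T\<^sup>-\<^sup>1\<close> is a sum \<open>\<Sum>\<^sub>i G\<^sub>i(\<xi>\<^sub>i)\<close>, where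
\<open>G\<^sub>i\<close> is the one-variable fractional integral of \<open>h \<circ> T\<^sup>-\<^sup>1\<close> along the \<open>i\<close>-th coordinate line through \<open>\<zeta>\<close>.
By the product rule the equation that defines the module says that \<open>M = e\<^sup>\<Lambda> F\<close> is annihilated by
the Cauchy-Riemann operator.  Hence the first assertion is Cauchy's theorem for \<open>M\<close>, and the integral in
brackets is \<open>e\<^sup>-\<^sup>\<Lambda> M = F\<close> in \<open>\<Xi>\<close> and \<open>0\<close> outside the closure, by Cauchy's formula.  The \<open>j\<close>-th fractional
derivative inverts the \<open>j\<close>-th fractional integral, so it turns the summand \<open>G\<^sub>j\<close> of \<open>F\<close> into
\<open>h \<circ> T\<^sup>-\<^sup>1\<close>; the other two summands are constant in \<open>\<xi>\<^sub>j\<close> and give the mixed terms.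

Cauchy's theorem and formula are proved on the box, for the pullback along \<open>S = T\<^sup>-\<^sup>1\<close>
(\<open>mobius_conformal_chart\<close>).  Since \<open>S\<close> is conformal with factor \<open>\<mu>\<close>, the area form restricts to \<open>\<mu> \<partial>\<^sub>iS\<close>
on the faces orthogonal to the \<open>i\<close>-th axis (\<open>sgn_det_area_form\<close>), this frame is free of divergence,
and the operator can be evaluated in it.  So a form \<open>\<kappa> \<eta> M\<close> with a right monogenic \<open>\<kappa>\<close> becomes a
divergence free field and has no flux through the boundary of a box (\<open>pulled_form_flux_zero\<close>).  If \<open>\<kappa>\<close>
is the Cauchy kernel with its pole in the box, the flux equals that through small cubes about the pole,
where it tends to the value of \<open>M\<close> times the full solid angle, normalised to \<open>1\<close> (\<open>cauchy_formula\<close>).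

The equation holds in the open set \<open>\<Xi>\<close>, whereas the integrals extend over its boundary.  Along a coordinate
line the equation is a linear ordinary differential equation for \<open>G\<^sub>i\<close> whose coefficients are
continuous on the closed interval (\<open>slice_ode\<close>), so \<open>G\<^sub>i\<close> is Lipschitz and extends, with its derivative,
to the ends.  At the lower end the value of \<open>G\<^sub>i\<close> is the limit by definition.  At the upper end it is
an integral of \<open>h \<circ> T\<^sup>-\<^sup>1\<close> over the whole interval.  To see that this integral exists and is the limit,
\<open>h \<circ> T\<^sup>-\<^sup>1\<close> is expressed by \<open>G\<^sub>i\<close>: as \<open>G\<^sub>i\<close> is Lipschitz, \<open>h \<circ> T\<^sup>-\<^sup>1\<close> is bounded near the upper end
(\<open>abel_pair.bounded_near_right_end\<close>, \<open>abel_pair.right_end\<close>, \<open>continuous_G\<close>).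

The substitution \<open>w = \<phi>\<^sub>i(t) - \<phi>\<^sub>i(a\<^sub>i)\<close> and an exponential weight reduce proportional fractional integrals to
convolutions with powers (\<open>change_of_variable\<close>).  Their inversion is Abel's: the convolution of the kernels
of orders \<open>\<alpha>\<close> and \<open>1 - \<alpha>\<close> is the constant \<open>Gamma \<alpha> * Gamma (1 - \<alpha>)\<close> (\<open>abel_inversion\<close>), whence
\<open>frac_deriv_G\<close>.
\<close>

section \<open>Quaternions\<close>

lemma UNIV_3_zero: "(UNIV::3 set) = {0,1,2}"
  unfolding UNIV_3 by auto

lemma sum_3_zero: "sum f (UNIV::3 set) = f 0 + f 1 + f 2"
  unfolding UNIV_3_zero by (simp add: ac_simps)

lemma forall_3_zero: "(\<forall>i::3. P i) \<longleftrightarrow> P 0 \<and> P 1 \<and> P 2"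
  using UNIV_3_zero by (metis UNIV_I empty_iff insert_iff)

lemma exhaust_3_zero: "(k::3) = 0 \<or> k = 1 \<or> k = 2"
  using UNIV_3_zero by auto

lemma four_eq_zero: "(4::4) = 0"
  by simp

lemma sum_4_zero: "sum f (UNIV::4 set) = f 0 + f 1 + f 2 + f 3"
  unfolding UNIV_4 by (simp add: four_eq_zero ac_simps)

lemma forall_4_zero: "(\<forall>i::4. P i) \<longleftrightarrow> P 0 \<and> P 1 \<and> P 2 \<and> P 3"
  by (metis forall_4 four_eq_zero)

lemma vec4_eq_iff: "(u::'a^4) = v \<longleftrightarrow> u$0 = v$0 \<and> u$1 = v$1 \<and> u$2 = v$2 \<and> u$3 = v$3"
  by (simp add: vec_eq_iff forall_4_zero)

lemma vec3_eq_iff: "(u::'a^3) = v \<longleftrightarrow> u$0 = v$0 \<and> u$1 = v$1 \<and> u$2 = v$2"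
  by (simp add: vec_eq_iff forall_3_zero)

lemma inner_quat: "(u::quat) \<bullet> v = u$0 * v$0 + u$1 * v$1 + u$2 * v$2 + u$3 * v$3"
  by (simp add: inner_vec_def sum_4_zero)

lemma inner_real3: "(u::real^3) \<bullet> v = u$0 * v$0 + u$1 * v$1 + u$2 * v$2"
  by (simp add: inner_vec_def sum_3_zero)

lemma norm_sq_quat: "(norm (u::quat))\<^sup>2 = u$0 ^ 2 + u$1 ^ 2 + u$2 ^ 2 + u$3 ^ 2"
  unfolding power2_norm_eq_inner inner_quat by (simp add: power2_eq_square)

lemma mk_quat_nth [simp]:
  "mk_quat u0 u1 u2 u3 $ 0 = u0" "mk_quat u0 u1 u2 u3 $ 1 = u1"
  "mk_quat u0 u1 u2 u3 $ 2 = u2" "mk_quat u0 u1 u2 u3 $ 3 = u3"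
  by (simp_all add: mk_quat_def)

lemma qmult_nth:
  "(u \<odot> v)$0 = u$0 * v$0 - u$1 * v$1 - u$2 * v$2 - u$3 * v$3"
  "(u \<odot> v)$1 = u$0 * v$1 + u$1 * v$0 + u$2 * v$3 - u$3 * v$2"
  "(u \<odot> v)$2 = u$0 * v$2 - u$1 * v$3 + u$2 * v$0 + u$3 * v$1"
  "(u \<odot> v)$3 = u$0 * v$3 + u$1 * v$2 - u$2 * v$1 + u$3 * v$0"
  by (simp_all add: qmult_def)

lemma qcnj_nth:
  "qcnj u $ 0 = u$0" "qcnj u $ 1 = - (u$1)" "qcnj u $ 2 = - (u$2)" "qcnj u $ 3 = - (u$3)"
  by (simp_all add: qcnj_def)

lemma qone_nth: "qone$0 = 1" "qone$1 = 0" "qone$2 = 0" "qone$3 = 0"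
  by (simp_all add: qone_def axis_def)

lemma qmult_assoc: "(u \<odot> v) \<odot> w = u \<odot> (v \<odot> w)"
  by (simp add: vec4_eq_iff qmult_nth algebra_simps)

lemma bounded_bilinear_qmult_real: "bounded_bilinear ((\<odot>) :: quat \<Rightarrow> quat \<Rightarrow> quat)"
  by (subst bilinear_conv_bounded_bilinear[symmetric])
     (auto simp: bilinear_def linear_iff vec4_eq_iff qmult_nth algebra_simps)

lemma bounded_bilinear_qmult_complex: "bounded_bilinear ((\<odot>) :: cquat \<Rightarrow> cquat \<Rightarrow> cquat)"
  by (subst bilinear_conv_bounded_bilinear[symmetric])
     (auto simp: bilinear_def linear_iff vec4_eq_iff qmult_nth algebra_simps)

interpretation qmult_real: bounded_bilinear "(\<odot>) :: quat \<Rightarrow> quat \<Rightarrow> quat"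
  by (rule bounded_bilinear_qmult_real)

interpretation qmult_complex: bounded_bilinear "(\<odot>) :: cquat \<Rightarrow> cquat \<Rightarrow> cquat"
  by (rule bounded_bilinear_qmult_complex)

lemma qone_qmult [simp]: "qone \<odot> u = u" "u \<odot> qone = u"
  by (simp_all add: vec4_eq_iff qmult_nth qone_nth)

lemma qcnj_qmult_self: "u \<odot> qcnj u = (norm u)\<^sup>2 *\<^sub>R qone" "qcnj u \<odot> u = (norm u)\<^sup>2 *\<^sub>R qone"
  unfolding norm_sq_quat by (simp_all add: vec4_eq_iff qmult_nth qcnj_nth qone_nth power2_eq_square)

lemma norm_qmult: "norm (u \<odot> v) = norm u * norm (v::quat)"
proof -
  have "(norm (u \<odot> v))\<^sup>2 = (norm u * norm v)\<^sup>2"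
    unfolding power_mult_distrib norm_sq_quat qmult_nth by algebra
  then show ?thesis by (simp add: power2_eq_iff_nonneg)
qed

lemma norm_qcnj [simp]: "norm (qcnj u) = norm u"
  using power2_eq_iff_nonneg[of "norm (qcnj u)" "norm u"] by (simp add: norm_sq_quat qcnj_nth)

lemma qinv_right: "u \<noteq> 0 \<Longrightarrow> u \<odot> qinv u = qone"
  by (simp add: qinv_def qmult_real.scaleR_right qcnj_qmult_self)

lemma qinv_left: "u \<noteq> 0 \<Longrightarrow> qinv u \<odot> u = qone"
  by (simp add: qinv_def qmult_real.scaleR_left qcnj_qmult_self)

lemma norm_qinv: "norm (qinv u) = inverse (norm u)"
  by (cases "u = 0") (simp_all add: qinv_def power2_eq_square)

lemma qinv_nonzero: "u \<noteq> 0 \<Longrightarrow> qinv u \<noteq> 0"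
  using norm_qinv[of u] by auto

lemma qinv_unique: "u \<odot> v = qone \<Longrightarrow> v = qinv u"
  by (metis mult_zero_left norm_eq_zero norm_qmult qinv_left qmult_assoc qone_qmult(1,2) qone_nth(1)
      zero_index zero_neq_one)

lemma qinv_qmult: "u \<noteq> 0 \<Longrightarrow> v \<noteq> 0 \<Longrightarrow> qinv (u \<odot> v) = qinv v \<odot> qinv u"
  by (rule qinv_unique[symmetric]) (metis qinv_right qmult_assoc qone_qmult(2))

lemma qinv_qinv: "u \<noteq> 0 \<Longrightarrow> qinv (qinv u) = u"
  by (metis qinv_left qinv_unique)

lemma qmult_eq_0_iff: "u \<odot> v = 0 \<longleftrightarrow> u = 0 \<or> (v::quat) = 0"
  by (metis mult_eq_0_iff norm_eq_zero norm_qmult)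

lemma linear_cquat_of: "linear cquat_of"
  by (auto simp: linear_iff cquat_of_def vec_eq_iff of_real_def algebra_simps)

lemma bounded_linear_cquat_of: "bounded_linear cquat_of"
  using linear_cquat_of linear_conv_bounded_linear by blast

lemmas cquat_of_linear =
  linear_add[OF linear_cquat_of] linear_scale[OF linear_cquat_of] linear_0[OF linear_cquat_of]
  linear_diff[OF linear_cquat_of] linear_sum[OF linear_cquat_of]

lemma cquat_of_nth: "cquat_of u $ i = complex_of_real (u$i)"
  by (simp add: cquat_of_def)

lemma cquat_of_qmult: "cquat_of (u \<odot> v) = cquat_of u \<odot> cquat_of v"
  by (simp add: vec4_eq_iff cquat_of_nth qmult_nth)

lemma cquat_of_qone_qmult [simp]: "cquat_of qone \<odot> u = u"
  by (simp add: vec4_eq_iff cquat_of_nth qmult_nth qone_nth)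

section \<open>Coordinates on the span of a structural set\<close>

lemma span_e012: "v \<in> span {axis 0 1, axis 1 1, axis 2 1 :: quat} \<Longrightarrow> v$3 = 0"
proof -
  have "subspace {v::quat. v$3 = 0}"
    by (auto simp: subspace_def)
  then have "span {axis 0 1, axis 1 1, axis 2 1 :: quat} \<subseteq> {v. v$3 = 0}"
    by (intro span_minimal) (auto simp: axis_def)
  then show "v \<in> span {axis 0 1, axis 1 1, axis 2 1 :: quat} \<Longrightarrow> v$3 = 0" by auto
qed

lemma linear_emb: "linear (emb \<psi>)"
  by (auto simp: linear_iff emb_def sum_3_zero algebra_simps)

lemma bounded_linear_emb: "bounded_linear (emb \<psi>)"
  using linear_emb linear_conv_bounded_linear by blast

lemmas emb_linear = linear_add[OF linear_emb] linear_scale[OF linear_emb] linear_0[OF linear_emb]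
  linear_diff[OF linear_emb] linear_neg[OF linear_emb]

context
  fixes \<psi> :: "3 \<Rightarrow> quat"
  assumes struct: "structural_set \<psi>"
begin

lemma psi_zero: "\<psi> 0 = qone"
  using struct by (simp add: structural_set_def)

lemma psi_orthonormal: "\<psi> k \<bullet> \<psi> l = (if k = l then 1 else 0)"
proof -
  have "\<psi> k \<odot> qcnj (\<psi> l) + \<psi> l \<odot> qcnj (\<psi> k) = (if k = l then 2 *\<^sub>R qone else 0)"
    using struct by (simp add: structural_set_def)
  then have "(\<psi> k \<odot> qcnj (\<psi> l) + \<psi> l \<odot> qcnj (\<psi> k))$0 = (if k = l then 2 *\<^sub>R qone else 0)$0"
    by simp
  then show ?thesis
    by (auto simp: inner_quat qmult_nth qcnj_nth qone_nth split: if_splits)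
qed

lemma psi_nth:
  "\<psi> 0 $ 0 = 1" "\<psi> 0 $ 1 = 0" "\<psi> 0 $ 2 = 0" "\<psi> k $ 3 = 0" "\<psi> 1 $ 0 = 0" "\<psi> 2 $ 0 = 0"
  using span_e012[of "\<psi> k"] struct psi_orthonormal[of 1 0] psi_orthonormal[of 2 0]
  by (auto simp: structural_set_def psi_zero qone_nth inner_quat)

lemma emb_inner_psi: "emb \<psi> x \<bullet> \<psi> k = x$k"
  using exhaust_3_zero[of k]
  by (auto simp: emb_def sum_3_zero inner_add_left psi_orthonormal)

lemma inner_emb: "emb \<psi> x \<bullet> emb \<psi> y = x \<bullet> y"
  by (subst (2) emb_def) (simp add: inner_add_right emb_inner_psi inner_real3 sum_3_zero)

lemma norm_emb: "norm (emb \<psi> x) = norm x"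
  by (simp add: norm_eq_sqrt_inner inner_emb)

lemma emb_eq_0_iff: "emb \<psi> x = 0 \<longleftrightarrow> x = 0"
  by (metis norm_emb norm_eq_zero)

lemma emb_nth_3: "emb \<psi> x $ 3 = 0"
  by (simp add: emb_def sum_3_zero psi_nth)

lemma qcnj_emb: "qcnj (emb \<psi> x) = (x$0) *\<^sub>R \<psi> 0 - (x$1) *\<^sub>R \<psi> 1 - (x$2) *\<^sub>R \<psi> 2"
  by (simp add: vec4_eq_iff qcnj_nth emb_def sum_3_zero psi_nth)

text \<open>
The two vectors are orthonormal in the plane of \<open>e\<^sub>1, e\<^sub>2\<close>, so their Gram determinant, the square of
this determinant by Lagrange's identity, is \<open>1\<close>.
\<close>

lemma psi_det: "(\<psi> 1 $ 1 * \<psi> 2 $ 2 - \<psi> 1 $ 2 * \<psi> 2 $ 1)\<^sup>2 = 1"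
proof -
  have *: "(\<psi> 1 $ 1)\<^sup>2 + (\<psi> 1 $ 2)\<^sup>2 = 1" "(\<psi> 2 $ 1)\<^sup>2 + (\<psi> 2 $ 2)\<^sup>2 = 1"
    "\<psi> 1 $ 1 * \<psi> 2 $ 1 + \<psi> 1 $ 2 * \<psi> 2 $ 2 = 0"
    using psi_orthonormal[of 1 1] psi_orthonormal[of 2 2] psi_orthonormal[of 1 2]
    by (simp_all add: inner_quat psi_nth power2_eq_square)
  have "(\<psi> 1 $ 1 * \<psi> 2 $ 2 - \<psi> 1 $ 2 * \<psi> 2 $ 1)\<^sup>2
      = ((\<psi> 1 $ 1)\<^sup>2 + (\<psi> 1 $ 2)\<^sup>2) * ((\<psi> 2 $ 1)\<^sup>2 + (\<psi> 2 $ 2)\<^sup>2)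
        - (\<psi> 1 $ 1 * \<psi> 2 $ 1 + \<psi> 1 $ 2 * \<psi> 2 $ 2)\<^sup>2"
    by algebra
  then show ?thesis unfolding * by simp
qed

text \<open>
\<open>\<psi>\<^sub>1, \<psi>\<^sub>2\<close> is a basis of the plane of \<open>e\<^sub>1, e\<^sub>2\<close>, and Cramer's rule gives the coordinates.  The
conditions on Moebius coefficients thereby become polynomial identities in one component.
\<close>

lemma range_emb: "range (emb \<psi>) = {v. v$3 = 0}"
proof
  show "{v. v$3 = 0} \<subseteq> range (emb \<psi>)"
  proof
    fix v :: quat assume v: "v \<in> {v. v$3 = 0}"
    define D where "D = \<psi> 1 $ 1 * \<psi> 2 $ 2 - \<psi> 1 $ 2 * \<psi> 2 $ 1"
    have D: "D * D = 1" using psi_det by (simp add: D_def power2_eq_square)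
    define x :: "real^3" where "x = (\<chi> k. if k = 0 then v$0
       else if k = 1 then D * (v$1 * \<psi> 2 $ 2 - v$2 * \<psi> 2 $ 1)
       else D * (\<psi> 1 $ 1 * v$2 - \<psi> 1 $ 2 * v$1))"
    have x: "x$0 = v$0" "x$1 = D * (v$1 * \<psi> 2 $ 2 - v$2 * \<psi> 2 $ 1)"
      "x$2 = D * (\<psi> 1 $ 1 * v$2 - \<psi> 1 $ 2 * v$1)"
      by (simp_all add: x_def)
    have "x$1 * \<psi> 1 $ 1 + x$2 * \<psi> 2 $ 1 = D * D * v$1"
         "x$1 * \<psi> 1 $ 2 + x$2 * \<psi> 2 $ 2 = D * D * v$2"
      unfolding x by (simp_all add: D_def algebra_simps)
    with v have "emb \<psi> x = v"
      by (simp add: vec4_eq_iff emb_def sum_3_zero psi_nth x(1) D)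
    then show "v \<in> range (emb \<psi>)" by blast
  qed
qed (auto simp: emb_nth_3)

text \<open>
\<open>\<psi>\<^sub>3\<close> is orthogonal to \<open>\<A>\<close>, which is the hyperplane orthogonal to \<open>e\<^sub>3\<close>; so \<open>\<psi>\<^sub>3 = \<plusminus>e\<^sub>3\<close>.
\<close>

lemma completion_is_e3:
  assumes "completes_basis \<psi> \<psi>3"
  shows "\<psi>3$0 = 0" "\<psi>3$1 = 0" "\<psi>3$2 = 0" "(\<psi>3$3)\<^sup>2 = 1"
proof -
  have o: "\<psi> k \<bullet> \<psi>3 = 0" "norm \<psi>3 = 1" for k using assms by (auto simp: completes_basis_def)
  show 0: "\<psi>3$0 = 0" using o(1)[of 0] by (simp add: inner_quat psi_nth)
  have 1: "\<psi> 1 $ 1 * \<psi>3$1 + \<psi> 1 $ 2 * \<psi>3$2 = 0" and 2: "\<psi> 2 $ 1 * \<psi>3$1 + \<psi> 2 $ 2 * \<psi>3$2 = 0"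
    using o(1)[of 1] o(1)[of 2] by (simp_all add: inner_quat psi_nth)
  define D where "D = \<psi> 1 $ 1 * \<psi> 2 $ 2 - \<psi> 1 $ 2 * \<psi> 2 $ 1"
  have D: "D \<noteq> 0" using psi_det by (auto simp: D_def)
  have "D * \<psi>3$1 = 0" unfolding D_def using 1 2 by algebra
  then show e1: "\<psi>3$1 = 0" using D by simp
  have "D * \<psi>3$2 = 0" unfolding D_def using 1 2 by algebra
  then show e2: "\<psi>3$2 = 0" using D by simp
  show "(\<psi>3$3)\<^sup>2 = 1" using o(2) norm_sq_quat[of \<psi>3] by (simp add: 0 e1 e2)
qed

end

section \<open>Conformal charts and Moebius transformations\<close>

lemma upd_eq: "upd x i t = x + (t - x$i) *\<^sub>R axis i 1"
  by (simp add: vec_eq_iff upd_def axis_def)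

lemma upd_nth [simp]: "upd x i t $ i = t" "k \<noteq> i \<Longrightarrow> upd x i t $ k = x$k"
  by (simp_all add: upd_def)

lemma upd_self [simp]: "upd x i (x$i) = x"
  by (simp add: upd_eq)

lemma upd_upd [simp]: "upd (upd x i s) i t = upd x i t"
  by (simp add: upd_def vec_eq_iff)

lemma has_derivative_imp_partial:
  assumes "(f has_derivative f') (at x within A)" "(\<lambda>t. upd x i t) ` B \<subseteq> A"
  shows "((\<lambda>t. f (upd x i t)) has_vector_derivative f' (axis i 1)) (at (x$i) within B)"
proof -
  have "((\<lambda>t. upd x i t) has_derivative (\<lambda>h. h *\<^sub>R axis i 1)) (at (x$i) within B)"
    unfolding upd_eq by (auto intro!: derivative_eq_intros)
  moreover have "(f has_derivative f') (at (upd x i (x$i)) within (\<lambda>t. upd x i t) ` B)"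
    using assms by (simp add: has_derivative_subset)
  ultimately have "((\<lambda>t. f (upd x i t)) has_derivative (\<lambda>h. f' (h *\<^sub>R axis i 1))) (at (x$i) within B)"
    by (rule has_derivative_in_compose)
  moreover have "f' (h *\<^sub>R axis i 1) = h *\<^sub>R f' (axis i 1)" for h
    using assms(1) has_derivative_bounded_linear bounded_linear.linear linear_scale by blast
  ultimately show ?thesis by (simp add: has_vector_derivative_def)
qed

text \<open>
\<open>S\<close> is a conformal map with conformal factor \<open>\<mu>\<close>; it may reverse the orientation.  The last condition
says that the frame \<open>\<mu> \<partial>\<^sub>iS\<close> is free of divergence, \<open>P i\<close> being the \<open>i\<close>-th partial derivative of its
\<open>i\<close>-th member.  This is the Piola identity: up to a common sign the frame consists of the columns of
the cofactor matrix of \<open>S'\<close>.  Recorded in this form it makes second derivatives of \<open>S\<close> superfluous.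
\<close>

locale conformal_chart =
  fixes V :: "(real^3) set" and S :: "real^3 \<Rightarrow> real^3" and S' :: "real^3 \<Rightarrow> real^3 \<Rightarrow> real^3"
    and \<mu> :: "real^3 \<Rightarrow> real" and P :: "3 \<Rightarrow> real^3 \<Rightarrow> real^3"
  assumes open_V: "open V"
    and deriv: "\<And>\<xi>. \<xi> \<in> V \<Longrightarrow> (S has_derivative S' \<xi>) (at \<xi>)"
    and mu_pos: "\<And>\<xi>. \<xi> \<in> V \<Longrightarrow> \<mu> \<xi> > 0"
    and norm_deriv: "\<And>\<xi> h. \<xi> \<in> V \<Longrightarrow> norm (S' \<xi> h) = \<mu> \<xi> * norm h"
    and cont_mu: "continuous_on V \<mu>"
    and cont_deriv: "\<And>h. continuous_on V (\<lambda>\<xi>. S' \<xi> h)"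
    and cont_P: "\<And>i. continuous_on V (P i)"
    and deriv_P: "\<And>i \<xi>. \<xi> \<in> V \<Longrightarrow>
       ((\<lambda>t. \<mu> (upd \<xi> i t) *\<^sub>R S' (upd \<xi> i t) (axis i 1)) has_vector_derivative P i \<xi>) (at (\<xi>$i))"
    and div_P: "\<And>\<xi>. \<xi> \<in> V \<Longrightarrow> (\<Sum>i\<in>UNIV. P i \<xi>) = 0"

lemma conformal_chart_affine:
  assumes "linear B" "\<kappa> > 0" "\<And>x. norm (B x) = \<kappa> * norm x"
  shows "conformal_chart UNIV (\<lambda>\<xi>. B (\<xi> - c)) (\<lambda>_. B) (\<lambda>_. \<kappa>) (\<lambda>_ _. 0)"
proof -
  have bl: "bounded_linear B" using assms(1) linear_conv_bounded_linear by blast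
  show ?thesis
    by standard (auto simp: assms intro!: derivative_eq_intros bounded_linear.has_derivative[OF bl])
qed

text \<open>
Quaternionic conjugation of \<open>\<A>\<close>, in coordinates; \<open>inversion\<close> below is \<open>z \<mapsto> z\<^sup>-\<^sup>1\<close>.
\<close>

definition refl0 :: "real^3 \<Rightarrow> real^3" where
  "refl0 z = (\<chi> k. if k = 0 then z$0 else - (z$k))"

definition inversion :: "real^3 \<Rightarrow> real^3" where
  "inversion z = inverse (z \<bullet> z) *\<^sub>R refl0 z"

lemma linear_refl0: "linear refl0"
  by (auto simp: linear_iff refl0_def vec_eq_iff)

lemma norm_refl0 [simp]: "norm (refl0 z) = norm z"
  by (simp add: norm_eq_sqrt_inner inner_real3 refl0_def)

lemma refl0_refl0 [simp]: "refl0 (refl0 z) = z"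
  by (simp add: refl0_def vec_eq_iff)

lemma norm_inversion: "norm (inversion z) = inverse (norm z)"
  by (cases "z = 0") (simp_all add: inversion_def linear_0[OF linear_refl0] dot_square_norm power2_eq_square)

lemma inversion_inversion: "inversion (inversion z) = z"
proof (cases "z = 0")
  case False
  have "inversion z \<bullet> inversion z = inverse (z \<bullet> z)"
    by (simp add: dot_square_norm norm_inversion power_inverse)
  then show ?thesis using False
    by (simp add: inversion_def linear_scale[OF linear_refl0])
qed (simp add: inversion_def linear_0[OF linear_refl0])

lemma inversion_eq_0_iff: "inversion z = 0 \<longleftrightarrow> z = 0"
  by (metis norm_inversion inverse_nonzero_iff_nonzero norm_eq_zero)

lemma has_derivative_shift:
  assumes "(f has_derivative f') (at (x - c))"
  shows "((\<lambda>x. f (x - c)) has_derivative f') (at (x :: 'a::real_normed_vector))"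
proof -
  have "((\<lambda>x. x - c) has_derivative (\<lambda>h. h)) (at x)"
    by (auto intro!: derivative_eq_intros)
  from has_derivative_compose[OF this assms] show ?thesis by simp
qed

text \<open>
Here \<open>D z\<close> is the derivative of \<open>z \<mapsto> z / n\<close> with \<open>n = z \<bullet> z\<close>.  The frame is, up to a constant
conformal map, \<open>e\<^sub>i / n\<^sup>2 - 2 z\<^sub>i z / n\<^sup>3\<close>, and \<open>E i\<close> is the \<open>i\<close>-th partial derivative of its \<open>i\<close>-th
member; the sum of these is \<open>(-4 - 8 + 12) z / n\<^sup>3 = 0\<close>.
\<close>

lemma conformal_chart_inversion:
  assumes B: "linear B" "\<kappa> > 0" "\<And>x. norm (B x) = \<kappa> * norm x"
  defines "D \<equiv> \<lambda>z h. inverse (z \<bullet> z) *\<^sub>R h - (2 * (z \<bullet> h) * inverse (z \<bullet> z) ^ 2) *\<^sub>R z"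
  defines "E \<equiv> \<lambda>i z. - (4 * z$i * inverse (z \<bullet> z) ^ 3) *\<^sub>R axis i 1
       - 2 *\<^sub>R (inverse (z \<bullet> z) ^ 3 *\<^sub>R z + (z$i * inverse (z \<bullet> z) ^ 3) *\<^sub>R axis i 1
         - (6 * (z$i)\<^sup>2 * inverse (z \<bullet> z) ^ 4) *\<^sub>R z)"
  shows "conformal_chart (- {c}) (\<lambda>\<xi>. B (inversion (\<xi> - c) - d))
     (\<lambda>\<xi> h. B (refl0 (D (\<xi> - c) h))) (\<lambda>\<xi>. \<kappa> * inverse ((\<xi> - c) \<bullet> (\<xi> - c)))
     (\<lambda>i \<xi>. \<kappa> *\<^sub>R B (refl0 (E i (\<xi> - c))))"
proof
  have blB: "bounded_linear B" using B(1) linear_conv_bounded_linear by blast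
  have blR: "bounded_linear refl0" using linear_refl0 linear_conv_bounded_linear by blast
  have blBR: "bounded_linear (\<lambda>x. B (refl0 x))"
    using bounded_linear_compose[OF blB blR] by simp
  have contBR: "continuous_on A (\<lambda>x. B (refl0 (f x)))" if "continuous_on A f" for A and f :: "real^3 \<Rightarrow> real^3"
    using bounded_linear.continuous_on[OF blBR that] .
  show "open (- {c})" by auto
  fix \<xi> h :: "real^3" and i
  show "continuous_on (- {c}) (\<lambda>\<xi>. \<kappa> * inverse ((\<xi> - c) \<bullet> (\<xi> - c)))"
    by (intro continuous_intros) auto
  show "continuous_on (- {c}) (\<lambda>\<xi>. B (refl0 (D (\<xi> - c) h)))"
    unfolding D_def by (intro contBR continuous_intros) auto
  show "continuous_on (- {c}) (\<lambda>\<xi>. \<kappa> *\<^sub>R B (refl0 (E i (\<xi> - c))))"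
    unfolding E_def by (intro contBR continuous_intros) auto
  assume "\<xi> \<in> - {c}"
  define z where "z = \<xi> - c"
  have z: "z \<noteq> 0" "z \<bullet> z \<noteq> 0" "z \<bullet> z > 0" using \<open>\<xi> \<in> - {c}\<close> by (auto simp: z_def)
  show "\<kappa> * inverse ((\<xi> - c) \<bullet> (\<xi> - c)) > 0" using z B(2) by (simp add: z_def)
  have "((\<lambda>z. inverse (z \<bullet> z) *\<^sub>R z) has_derivative D z) (at z)"
    unfolding D_def using z
    by (auto intro!: derivative_eq_intros simp: fun_eq_iff inner_commute
        power2_eq_square algebra_simps)
  then have "((\<lambda>\<xi>. inverse ((\<xi> - c) \<bullet> (\<xi> - c)) *\<^sub>R (\<xi> - c)) has_derivative D z) (at \<xi>)"
    unfolding z_def by (rule has_derivative_shift)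
  from bounded_linear.has_derivative[OF blBR this]
  have "((\<lambda>\<xi>. B (inversion (\<xi> - c))) has_derivative (\<lambda>h. B (refl0 (D z h)))) (at \<xi>)"
    by (simp add: inversion_def linear_scale[OF linear_refl0])
  then have "((\<lambda>\<xi>. B (inversion (\<xi> - c)) - B d) has_derivative (\<lambda>h. B (refl0 (D z h)))) (at \<xi>)"
    by (auto intro!: derivative_eq_intros)
  then show "((\<lambda>\<xi>. B (inversion (\<xi> - c) - d)) has_derivative (\<lambda>h. B (refl0 (D (\<xi> - c) h)))) (at \<xi>)"
    by (simp add: linear_diff[OF B(1)] z_def)
  have "(norm (D z h))\<^sup>2 = (inverse (z \<bullet> z) * norm h)\<^sup>2"
    unfolding power2_norm_eq_inner power_mult_distrib D_def using z
    by (simp add: inner_diff_left inner_diff_right inner_commute field_simps power2_eq_square)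
  then have "norm (D z h) = inverse (z \<bullet> z) * norm h"
    using z by (subst (asm) power2_eq_iff_nonneg) auto
  then show "norm (B (refl0 (D (\<xi> - c) h))) = \<kappa> * inverse ((\<xi> - c) \<bullet> (\<xi> - c)) * norm h"
    by (simp add: B(3) z_def)
  have "((\<lambda>z. inverse (z \<bullet> z) *\<^sub>R D z (axis i 1)) has_derivative
        (\<lambda>h. (- (2 * (z \<bullet> h)) * inverse (z \<bullet> z) ^ 2) *\<^sub>R D z (axis i 1) +
           inverse (z \<bullet> z) *\<^sub>R ((- (2 * (z \<bullet> h)) * inverse (z \<bullet> z) ^ 2) *\<^sub>R axis i 1
            - ((2 * (h$i) * inverse (z \<bullet> z) ^ 2) *\<^sub>R z
             + (2 * (z$i) * (- (4 * (z \<bullet> h)) * inverse (z \<bullet> z) ^ 3)) *\<^sub>R z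
             + (2 * (z$i) * inverse (z \<bullet> z) ^ 2) *\<^sub>R h)))) (at z)"
    unfolding D_def inner_axis using z
    by (auto intro!: derivative_eq_intros bounded_linear.has_derivative[OF bounded_linear_vec_nth]
        simp: fun_eq_iff vec_eq_iff inner_commute power2_eq_square power3_eq_cube algebra_simps)
  from has_derivative_shift[OF this[unfolded z_def]]
  have "((\<lambda>\<xi>. inverse ((\<xi> - c) \<bullet> (\<xi> - c)) *\<^sub>R D (\<xi> - c) (axis i 1)) has_derivative
        (\<lambda>h. (- (2 * (z \<bullet> h)) * inverse (z \<bullet> z) ^ 2) *\<^sub>R D z (axis i 1) +
           inverse (z \<bullet> z) *\<^sub>R ((- (2 * (z \<bullet> h)) * inverse (z \<bullet> z) ^ 2) *\<^sub>R axis i 1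
            - ((2 * (h$i) * inverse (z \<bullet> z) ^ 2) *\<^sub>R z
             + (2 * (z$i) * (- (4 * (z \<bullet> h)) * inverse (z \<bullet> z) ^ 3)) *\<^sub>R z
             + (2 * (z$i) * inverse (z \<bullet> z) ^ 2) *\<^sub>R h)))) (at \<xi> within UNIV)"
    by (simp add: z_def)
  from has_derivative_imp_partial[OF this, of i UNIV]
  have "((\<lambda>t. inverse ((upd \<xi> i t - c) \<bullet> (upd \<xi> i t - c)) *\<^sub>R D (upd \<xi> i t - c) (axis i 1))
      has_vector_derivative E i z) (at (\<xi>$i))"
    by (rule has_vector_derivative_eq_rhs)
       (simp_all add: E_def D_def inner_axis eval_nat_numeral vec_eq_iff algebra_simps)
  from bounded_linear.has_vector_derivative[OF bounded_linear_compose[OF bounded_linear_scaleR_right[of \<kappa>] blBR] this]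
  show "((\<lambda>t. (\<kappa> * inverse ((upd \<xi> i t - c) \<bullet> (upd \<xi> i t - c))) *\<^sub>R B (refl0 (D (upd \<xi> i t - c) (axis i 1))))
       has_vector_derivative \<kappa> *\<^sub>R B (refl0 (E i (\<xi> - c)))) (at (\<xi> $ i))"
    by (simp add: z_def linear_scale[OF linear_refl0] linear_scale[OF B(1)])
  have zz: "z \<bullet> z * inverse (z \<bullet> z) ^ 4 = inverse (z \<bullet> z) ^ 3"
    using z by (simp add: field_simps eval_nat_numeral)
  have ax: "(\<Sum>i\<in>UNIV. z$i *\<^sub>R axis i 1) = z"
    by (simp add: vec_eq_iff axis_def sum.delta' if_distrib cong: if_cong)
  have "(\<Sum>i\<in>UNIV. E i z) = (\<Sum>i\<in>UNIV. - (6 * inverse (z \<bullet> z) ^ 3) *\<^sub>R (z$i *\<^sub>R axis i 1)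
       + (12 * ((z$i)\<^sup>2 * inverse (z \<bullet> z) ^ 4)) *\<^sub>R z - (2 * inverse (z \<bullet> z) ^ 3) *\<^sub>R z)"
    by (rule sum.cong) (simp_all add: E_def vec_eq_iff algebra_simps)
  also have "\<dots> = - (6 * inverse (z \<bullet> z) ^ 3) *\<^sub>R z
       + (12 * (z \<bullet> z * inverse (z \<bullet> z) ^ 4)) *\<^sub>R z - (6 * inverse (z \<bullet> z) ^ 3) *\<^sub>R z"
    unfolding sum.distrib sum_subtractf
    unfolding scaleR_sum_right[symmetric] scaleR_sum_left[symmetric] sum_distrib_left[symmetric]
      sum_distrib_right[symmetric] ax
    by (simp add: inner_vec_def power2_eq_square vec_eq_iff algebra_simps)
  also have "\<dots> = 0" unfolding zz by (simp flip: scaleR_left_distrib scaleR_left_diff_distrib)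
  finally have "(\<Sum>i\<in>UNIV. E i z) = 0" .
  then show "(\<Sum>i\<in>UNIV. \<kappa> *\<^sub>R B (refl0 (E i (\<xi> - c)))) = 0"
    unfolding z_def[symmetric] scaleR_sum_right[symmetric] linear_sum[OF B(1), symmetric]
       linear_sum[OF linear_refl0, symmetric]
    by (simp add: linear_0[OF linear_refl0] linear_0[OF B(1)])
qed

lemma conformal_chart_cong:
  assumes "conformal_chart V S S' \<mu> P" "\<And>\<xi>. \<xi> \<in> V \<Longrightarrow> S2 \<xi> = S \<xi>"
  shows "conformal_chart V S2 S' \<mu> P"
proof -
  interpret conformal_chart V S S' \<mu> P by fact
  show ?thesis
  proof
    fix \<xi> assume "\<xi> \<in> V"
    show "(S2 has_derivative S' \<xi>) (at \<xi>)"
      using has_derivative_transform_within_open[OF deriv[OF \<open>\<xi> \<in> V\<close>] open_V \<open>\<xi> \<in> V\<close>] assms(2)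
      by auto
  qed (use open_V mu_pos norm_deriv cont_mu cont_deriv cont_P deriv_P div_P in auto)
qed

text \<open>
The hypothesis makes \<open>e\<^sup>-\<^sup>1\<close> a positive multiple of \<open>\<psi>\<^sub>3 (conj g) (conj \<psi>\<^sub>3)\<close>.  Right multiplication by
\<open>\<psi>\<^sub>3\<close> takes \<open>\<A>\<close> to the imaginary quaternions, \<open>v \<mapsto> g v (conj g)\<close> preserves these, and right
multiplication by \<open>conj \<psi>\<^sub>3\<close> leads back to \<open>\<A>\<close>.  Thus \<open>x \<mapsto> g x e\<^sup>-\<^sup>1\<close> acts on \<open>\<A>\<close>, and it multiplies
norms by a constant.
\<close>

lemma conformal_conjugation:
  assumes struct: "structural_set \<psi>" and compl: "completes_basis \<psi> \<psi>3"
    and g: "g \<noteq> 0" and e: "e \<noteq> 0"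
    and ge: "qinv e /\<^sub>R norm (qinv e) = \<psi>3 \<odot> (qcnj g /\<^sub>R norm g) \<odot> qcnj \<psi>3"
  obtains A B \<kappa> where "linear A" "linear B" "\<kappa> > 0" "\<And>x. emb \<psi> (A x) = g \<odot> emb \<psi> x \<odot> qinv e"
    "\<And>x. norm (B x) = \<kappa> * norm x" "\<And>x. A (B x) = x" "\<And>x. B (A x) = x"
proof -
  note c = completion_is_e3[OF struct compl]
  have ne: "norm (qinv e) > 0" using qinv_nonzero[OF e] by simp
  have "qinv e = norm (qinv e) *\<^sub>R (qinv e /\<^sub>R norm (qinv e))" using ne by simp
  also have "\<dots> = (norm (qinv e) / norm g) *\<^sub>R (\<psi>3 \<odot> qcnj g \<odot> qcnj \<psi>3)"
    unfolding ge by (simp add: qmult_real.scaleR_right qmult_real.scaleR_left divide_inverse)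
  finally have qe: "qinv e = (norm (qinv e) / norm g) *\<^sub>R (\<psi>3 \<odot> qcnj g \<odot> qcnj \<psi>3)" .
  have in_range: "g \<odot> emb \<psi> x \<odot> qinv e \<in> range (emb \<psi>)" for x
  proof -
    have "(g \<odot> emb \<psi> x \<odot> (\<psi>3 \<odot> qcnj g \<odot> qcnj \<psi>3)) $ 3 = 0"
      unfolding qmult_nth qcnj_nth emb_nth_3[OF struct] c by (simp add: algebra_simps)
    then show ?thesis
      unfolding range_emb[OF struct] by (subst qe) (simp add: qmult_real.scaleR_right)
  qed
  define A where "A x = (\<chi> k. (g \<odot> emb \<psi> x \<odot> qinv e) \<bullet> \<psi> k)" for x
  have emb_A: "emb \<psi> (A x) = g \<odot> emb \<psi> x \<odot> qinv e" for x
  proof -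
    obtain w where "g \<odot> emb \<psi> x \<odot> qinv e = emb \<psi> w" using in_range[of x] by auto
    moreover from this have "A x = w" by (simp add: A_def emb_inner_psi[OF struct])
    ultimately show ?thesis by simp
  qed
  have lin: "linear A"
    by (auto simp: linear_iff A_def vec_eq_iff emb_linear qmult_real.add_left qmult_real.add_right
        inner_add_left qmult_real.scaleR_left qmult_real.scaleR_right)
  define \<kappa> where "\<kappa> = norm g * norm (qinv e)"
  have \<kappa>: "\<kappa> > 0" using g ne by (simp add: \<kappa>_def)
  have norm_A: "norm (A x) = \<kappa> * norm x" for x
    using norm_emb[OF struct, of "A x"] by (simp add: emb_A norm_qmult norm_emb[OF struct] \<kappa>_def mult_ac)
  have "inj A"
    using norm_A \<kappa> by (intro linear_injective_0[THEN iffD2] lin) (metis less_irrefl mult_eq_0_iff norm_eq_zero)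
  then obtain B where B: "linear B" "\<And>x. B (A x) = x" "\<And>x. A (B x) = x"
    using linear_injective_isomorphism[OF lin] by blast
  have "norm (B x) = inverse \<kappa> * norm x" for x
    using norm_A[of "B x"] \<kappa> by (simp add: B field_simps)
  with lin B \<kappa> emb_A show thesis by (intro that[of A B "inverse \<kappa>"]) auto
qed

lemma emb_inversion:
  assumes "structural_set \<psi>"
  shows "emb \<psi> (inversion z) = qinv (emb \<psi> z)"
  unfolding inversion_def qinv_def qcnj_emb[OF assms] norm_emb[OF assms]
  by (simp add: emb_def sum_3_zero refl0_def dot_square_norm algebra_simps)

text \<open>
For \<open>r \<noteq> 0\<close> and \<open>d = q - p r\<^sup>-\<^sup>1 s\<close> one has \<open>T x = p r\<^sup>-\<^sup>1 + (r x d\<^sup>-\<^sup>1 + s d\<^sup>-\<^sup>1)\<^sup>-\<^sup>1\<close>, and the conditions on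
the coefficients say that the affine map in the bracket preserves \<open>\<A>\<close>.  So \<open>T\<close> and its inverse are
composed of conformal affine maps and the inversion; for \<open>r = 0\<close> they are affine.
\<close>

lemma mobius_conformal_chart:
  assumes struct: "structural_set \<psi>" and compl: "completes_basis \<psi> \<psi>3"
    and mob: "mobius_data \<psi> \<psi>3 p q r s"
    and ab: "\<And>k. a$k < b$k"
    and Xi: "\<Xi> \<subseteq> mobius_dom \<psi> r s" "mobius \<psi> p q r s ` \<Xi> = box a b" "bounded \<Xi>"
  obtains V S' \<mu> P where "conformal_chart V (mobius_inv \<psi> p q r s) S' \<mu> P" "cbox a b \<subseteq> V"
    "\<And>\<xi>. \<xi> \<in> V \<Longrightarrow> mobius \<psi> p q r s (mobius_inv \<psi> p q r s \<xi>) = \<xi>"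
    "mobius_inv \<psi> p q r s ` box a b = \<Xi>"
    "\<And>x. x \<in> \<Xi> \<Longrightarrow> mobius_inv \<psi> p q r s (mobius \<psi> p q r s x) = x"
proof -
  note conclusion = that
  define T where "T = mobius \<psi> p q r s"
  define T' where "T' = mobius_inv \<psi> p q r s"
  define dom where "dom = mobius_dom \<psi> r s"
  have finish: thesis if chart: "conformal_chart V S S' \<mu> P" and cb: "cbox a b \<subseteq> V"
    and S: "\<And>\<xi>. \<xi> \<in> V \<Longrightarrow> S \<xi> \<in> dom \<and> T (S \<xi>) = \<xi>" and TS: "\<And>x. x \<in> dom \<Longrightarrow> S (T x) = x"
    for V S S' \<mu> P
  proof -
    have "inj_on T dom" using TS by (rule inj_on_inverseI)
    then have inv: "T' (T x) = x" if "x \<in> dom" for x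
      using that by (simp add: T'_def T_def dom_def mobius_inv_def)
    have T': "T' \<xi> = S \<xi>" if "\<xi> \<in> V" for \<xi>
      using inv S[OF that] by metis
    have "T' ` box a b = \<Xi>"
      using inv Xi(1) unfolding Xi(2)[symmetric] T_def[symmetric] dom_def[symmetric] image_image
      by (force simp: subset_iff)
    moreover have "conformal_chart V T' S' \<mu> P"
      by (rule conformal_chart_cong[OF chart T'])
    ultimately show thesis
      using cb S T' inv Xi(1) unfolding T_def T'_def dom_def by (intro conclusion[of V S' \<mu> P]) auto
  qed
  show thesis
  proof (cases "r = 0")
    case True
    with mob have p: "p \<noteq> 0" and s: "s \<noteq> 0" and qs: "q \<odot> qinv s \<in> range (emb \<psi>)"
      and ps: "qinv s /\<^sub>R norm (qinv s) = \<psi>3 \<odot> (qcnj p /\<^sub>R norm p) \<odot> qcnj \<psi>3"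
      by (auto simp: mobius_data_def)
    obtain A B \<kappa> where AB: "linear A" "linear B" "\<kappa> > 0"
      "\<And>x. emb \<psi> (A x) = p \<odot> emb \<psi> x \<odot> qinv s" "\<And>x. norm (B x) = \<kappa> * norm x"
      "\<And>x. A (B x) = x" "\<And>x. B (A x) = x"
      using conformal_conjugation[OF struct compl p s ps] by metis
    obtain c where c: "q \<odot> qinv s = emb \<psi> c" using qs by auto
    have dom: "dom = UNIV" using s by (simp add: dom_def mobius_dom_def True qmult_real.zero_left)
    have T: "T x = A x + c" for x
      by (simp add: T_def mobius_def True qmult_real.zero_left qmult_real.add_left c AB(4)[symmetric]
          emb_inner_psi[OF struct] inner_add_left vec_eq_iff)
    show thesis
      using conformal_chart_affine[OF AB(2,3,5)] by (rule finish[of _ _ _ _ _]) (auto simp: dom T AB)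
  next
    case False
    define d where "d = q - p \<odot> qinv r \<odot> s"
    from mob False have d: "d \<noteq> 0" and c1: "p \<odot> qinv r \<in> range (emb \<psi>)"
      and c2: "s \<odot> qinv d \<in> range (emb \<psi>)"
      and rd: "qinv d /\<^sub>R norm (qinv d) = \<psi>3 \<odot> (qcnj r /\<^sub>R norm r) \<odot> qcnj \<psi>3"
      by (auto simp: mobius_data_def d_def Let_def)
    obtain A B \<kappa> where AB: "linear A" "linear B" "\<kappa> > 0"
      "\<And>x. emb \<psi> (A x) = r \<odot> emb \<psi> x \<odot> qinv d" "\<And>x. norm (B x) = \<kappa> * norm x"
      "\<And>x. A (B x) = x" "\<And>x. B (A x) = x"
      using conformal_conjugation[OF struct compl False d rd] by metis
    obtain c1 where c1: "p \<odot> qinv r = emb \<psi> c1" using c1 by auto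
    obtain c2 where c2: "s \<odot> qinv d = emb \<psi> c2" using c2 by auto
    have den: "(r \<odot> emb \<psi> x + s) \<odot> qinv d = emb \<psi> (A x + c2)" for x
      by (simp add: qmult_real.add_left AB(4) c2 emb_linear)
    have dom: "x \<in> dom \<longleftrightarrow> A x + c2 \<noteq> 0" for x
    proof -
      have "x \<in> dom \<longleftrightarrow> (r \<odot> emb \<psi> x + s) \<odot> qinv d \<noteq> 0"
        using qinv_nonzero[OF d] by (simp add: dom_def mobius_dom_def qmult_eq_0_iff)
      then show ?thesis by (simp add: den emb_eq_0_iff[OF struct])
    qed
    have T: "T x = c1 + inversion (A x + c2)" if "x \<in> dom" for x
    proof -
      define w where "w = r \<odot> emb \<psi> x + s"
      have w: "w \<noteq> 0" using that by (simp add: w_def dom_def mobius_dom_def)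
      have "p \<odot> qinv r \<odot> r = p" using qinv_left[OF False] by (simp add: qmult_assoc)
      then have "p \<odot> emb \<psi> x + q = p \<odot> qinv r \<odot> w + d"
        by (simp add: w_def d_def qmult_real.add_right flip: qmult_assoc)
      then have "(p \<odot> emb \<psi> x + q) \<odot> qinv w = p \<odot> qinv r \<odot> w \<odot> qinv w + d \<odot> qinv w"
        by (simp add: qmult_real.add_left)
      also have "p \<odot> qinv r \<odot> w \<odot> qinv w = p \<odot> qinv r"
        using qinv_right[OF w] by (simp add: qmult_assoc)
      also have "d \<odot> qinv w = qinv (w \<odot> qinv d)"
        using w d by (simp add: qinv_qmult qinv_nonzero qinv_qinv)
      also have "w \<odot> qinv d = emb \<psi> (A x + c2)" by (simp add: w_def den)
      also have "p \<odot> qinv r + qinv (emb \<psi> (A x + c2)) = emb \<psi> (c1 + inversion (A x + c2))"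
        by (simp add: emb_linear(1) c1 emb_inversion[OF struct])
      finally show ?thesis
        by (simp add: T_def mobius_def w_def[symmetric] emb_inner_psi[OF struct] del: vector_add_component)
    qed
    define S where "S \<xi> = B (inversion (\<xi> - c1) - c2)" for \<xi>
    have dom_S: "S \<xi> \<in> dom \<and> T (S \<xi>) = \<xi>" if "\<xi> \<noteq> c1" for \<xi>
    proof -
      have *: "A (S \<xi>) + c2 = inversion (\<xi> - c1)" by (simp add: S_def AB)
      then have "S \<xi> \<in> dom" using that by (simp add: dom inversion_eq_0_iff)
      then show ?thesis using T[of "S \<xi>"] by (simp add: * inversion_inversion)
    qed
    have S_T: "S (T x) = x" if "x \<in> dom" for x
      using T[OF that] by (simp add: S_def inversion_inversion AB)
    have T_ne: "T x \<noteq> c1" if "x \<in> dom" for x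
      using T[OF that] that by (simp add: dom inversion_eq_0_iff)
    \<comment> \<open>If the box reached the value \<open>c1 = T \<infinity>\<close>, then \<open>\<Xi>\<close> would be unbounded.\<close>
    have "c1 \<notin> cbox a b"
    proof
      assume "c1 \<in> cbox a b"
      moreover have "box a b \<noteq> {}" using ab by (auto simp: interval_eq_empty_cart not_le)
      ultimately have cl: "c1 \<in> closure (box a b)" by (simp add: closure_box)
      obtain R where R: "\<And>x. x \<in> \<Xi> \<Longrightarrow> norm x \<le> R" using Xi(3) by (auto simp: bounded_iff)
      define M where "M = \<bar>R\<bar> / \<kappa> + norm c2 + 1"
      have M: "M > 0" using AB(3) by (simp add: M_def add_nonneg_pos)
      obtain \<xi> where \<xi>: "\<xi> \<in> box a b" "dist \<xi> c1 < inverse M"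
        using cl M unfolding closure_approachable by (metis inverse_positive_iff_positive)
      then obtain x where x: "x \<in> \<Xi>" "\<xi> = T x" using Xi(2) by (auto simp: T_def)
      have xd: "x \<in> dom" using x(1) Xi(1) by (auto simp: dom_def)
      have "\<xi> \<noteq> c1" using T_ne[OF xd] x by simp
      then have "M < inverse (norm (\<xi> - c1))"
        using \<xi>(2) M by (simp add: dist_norm less_imp_inverse_less[of "norm (\<xi> - c1)" "inverse M", simplified])
      also have "\<dots> = norm (inversion (\<xi> - c1))" by (simp add: norm_inversion)
      also have "\<dots> \<le> norm (inversion (\<xi> - c1) - c2) + norm c2" using norm_triangle_ineq[of "inversion (\<xi> - c1) - c2" c2] by simp
      finally have "\<bar>R\<bar> / \<kappa> + 1 < norm (inversion (\<xi> - c1) - c2)" by (simp add: M_def)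
      then have "\<bar>R\<bar> < \<kappa> * norm (inversion (\<xi> - c1) - c2)"
        using AB(3) by (simp add: field_simps)
      also have "\<dots> = norm x" using S_T[OF xd] by (simp add: AB(5)[symmetric] S_def x(2))
      finally show False using R[OF x(1)] by simp
    qed
    then show thesis
      using conformal_chart_inversion[OF AB(2,3,5), of c1 c2] dom_S S_T unfolding S_def[symmetric]
      by (intro finish[of "- {c1}" S]) auto
  qed
qed

lemma three_eq_zero: "(3::3) = 0"
  by simp

lemma area_form_cross: "area_form \<psi> v w = emb \<psi> (cross3 v w)"
  by (simp add: area_form_def emb_def sum_3_zero cross_components[unfolded three_eq_zero] algebra_simps)

lemma cross3_axis: "cross3 (axis (i+1) 1) (axis (i+2) 1) = (axis i 1 :: real^3)"
proof -
  have "cross3 (axis (i+1) 1) (axis (i+2) 1) = (axis i 1 :: real^3)" if "i = 0 \<or> i = 1 \<or> i = 2"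
    using that by (auto simp: vec3_eq_iff cross_components[unfolded three_eq_zero] axis_def)
  then show ?thesis using exhaust_3_zero[of i] by blast
qed

text \<open>
The sum is the trace of \<open>b\<close>.  Both the Cauchy-Riemann operator and its mirror image are such traces,
so that they may be evaluated in the frame of a conformal chart.
\<close>

lemma sum_bilinear_orthogonal_basis:
  fixes b :: "real^3 \<Rightarrow> real^3 \<Rightarrow> 'b::real_vector"
  assumes b1: "\<And>y. linear (\<lambda>x. b x y)" and b2: "\<And>x. linear (b x)"
    and f: "orthogonal_transformation (f :: real^3 \<Rightarrow> real^3)"
  shows "(\<Sum>i\<in>UNIV. b (f (axis i 1)) (f (axis i 1))) = (\<Sum>i\<in>UNIV. b (axis i 1) (axis i 1))"
proof -
  define m where "m k i = f (axis i 1) $ k" for k i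
  have expand: "f (axis i 1) = (\<Sum>k\<in>UNIV. m k i *\<^sub>R axis k 1)" for i
    by (simp add: m_def vec_eq_iff axis_def if_distrib cong: if_cong)
  have "orthogonal_matrix (matrix f)" using f orthogonal_transformation_matrix by blast
  then have "matrix f ** transpose (matrix f) = mat 1" by (simp add: orthogonal_matrix_def)
  then have "(matrix f ** transpose (matrix f)) $ k $ l = (if k = l then 1 else 0)" for k l
    by (simp add: mat_def)
  then have m: "(\<Sum>i\<in>UNIV. m k i * m l i) = (if k = l then 1 else 0)" for k l
    by (simp add: matrix_matrix_mult_def transpose_def matrix_def m_def)
  have "(\<Sum>i\<in>UNIV. b (f (axis i 1)) (f (axis i 1)))
      = (\<Sum>i\<in>UNIV. \<Sum>k\<in>UNIV. \<Sum>l\<in>UNIV. (m k i * m l i) *\<^sub>R b (axis k 1) (axis l 1))"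
  proof (rule sum.cong)
    fix i
    have "b (f (axis i 1)) (f (axis i 1)) = (\<Sum>k\<in>UNIV. m k i *\<^sub>R b (axis k 1) (f (axis i 1)))"
      by (subst (1) expand) (simp add: linear_sum[OF b1] linear_scale[OF b1])
    also have "\<dots> = (\<Sum>k\<in>UNIV. m k i *\<^sub>R (\<Sum>l\<in>UNIV. m l i *\<^sub>R b (axis k 1) (axis l 1)))"
      by (subst expand) (simp add: linear_sum[OF b2] linear_scale[OF b2])
    finally show "b (f (axis i 1)) (f (axis i 1))
        = (\<Sum>k\<in>UNIV. \<Sum>l\<in>UNIV. (m k i * m l i) *\<^sub>R b (axis k 1) (axis l 1))"
      by (simp add: scaleR_sum_right)
  qed simp
  also have "\<dots> = (\<Sum>k\<in>UNIV. \<Sum>l\<in>UNIV. (\<Sum>i\<in>UNIV. m k i * m l i) *\<^sub>R b (axis k 1) (axis l 1))"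
    unfolding scaleR_sum_left
    by (subst sum.swap) (intro sum.cong refl sum.swap)
  also have "\<dots> = (\<Sum>i\<in>UNIV. b (axis i 1) (axis i 1))"
    unfolding m by (simp add: if_distrib[of "\<lambda>c. c *\<^sub>R _"] cong: if_cong)
  finally show ?thesis .
qed

context conformal_chart
begin

lemma linear_deriv: "\<xi> \<in> V \<Longrightarrow> linear (S' \<xi>)"
  using deriv has_derivative_linear by blast

lemma continuous_S: "continuous_on V S"
  using deriv by (meson continuous_at_imp_continuous_on has_derivative_continuous)

lemma orthogonal_normalized_deriv:
  assumes "\<xi> \<in> V"
  shows "orthogonal_transformation (\<lambda>h. S' \<xi> h /\<^sub>R \<mu> \<xi>)"
  using linear_deriv[OF assms] mu_pos[OF assms] norm_deriv[OF assms]
  by (auto simp: orthogonal_transformation linear_iff algebra_simps)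

text \<open>
The cross product of two columns of an orthogonal matrix is the third column times the determinant.
The sign in the boundary integral cancels this determinant.
\<close>

lemma sgn_det_area_form:
  assumes \<xi>: "\<xi> \<in> V"
  shows "sgn (det (matrix (S' \<xi>))) *\<^sub>R area_form \<psi> (S' \<xi> (axis (i+1) 1)) (S' \<xi> (axis (i+2) 1))
       = emb \<psi> (\<mu> \<xi> *\<^sub>R S' \<xi> (axis i 1))"
proof -
  define f where "f h = S' \<xi> h /\<^sub>R \<mu> \<xi>" for h
  note pos = mu_pos[OF \<xi>]
  have S': "S' \<xi> h = \<mu> \<xi> *\<^sub>R f h" for h using pos by (simp add: f_def)
  have orth: "orthogonal_transformation f"
    using orthogonal_normalized_deriv[OF \<xi>] by (simp add: f_def[abs_def])
  have "matrix (S' \<xi>) = \<mu> \<xi> *\<^sub>R matrix f"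
    by (simp add: matrix_def S' vec_eq_iff)
  then have "det (matrix (S' \<xi>)) = \<mu> \<xi> ^ 3 * det (matrix f)"
    by (simp add: det_3 power3_eq_cube algebra_simps)
  moreover have d: "\<bar>det (matrix f)\<bar> = 1" using orth by (rule orthogonal_transformation_det)
  ultimately have "sgn (det (matrix (S' \<xi>))) = det (matrix f)"
    using pos by (auto simp: sgn_mult abs_if sgn_if split: if_splits)
  moreover have "cross3 (S' \<xi> (axis (i+1) 1)) (S' \<xi> (axis (i+2) 1))
     = (\<mu> \<xi> * \<mu> \<xi> * det (matrix f)) *\<^sub>R f (axis i 1)"
    by (simp add: S' cross_mult_left cross_mult_right cross_orthogonal_transformation[OF orth] cross3_axis)
  moreover have "det (matrix f) * det (matrix f) = 1" using d by (auto simp: abs_if split: if_splits)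
  ultimately show ?thesis
    unfolding area_form_cross by (simp add: S' emb_linear(2)[symmetric] mult_ac)
qed

lemma sum_bilinear_deriv:
  fixes b :: "real^3 \<Rightarrow> real^3 \<Rightarrow> 'b::real_vector"
  assumes b1: "\<And>y. linear (\<lambda>x. b x y)" and b2: "\<And>x. linear (b x)" and \<xi>: "\<xi> \<in> V"
  shows "(\<Sum>i\<in>UNIV. b (S' \<xi> (axis i 1)) (S' \<xi> (axis i 1))) = (\<mu> \<xi>)\<^sup>2 *\<^sub>R (\<Sum>i\<in>UNIV. b (axis i 1) (axis i 1))"
proof -
  define f where "f h = S' \<xi> h /\<^sub>R \<mu> \<xi>" for h
  have S': "S' \<xi> h = \<mu> \<xi> *\<^sub>R f h" for h using mu_pos[OF \<xi>] by (simp add: f_def)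
  have "orthogonal_transformation f"
    using orthogonal_normalized_deriv[OF \<xi>] by (simp add: f_def[abs_def])
  from sum_bilinear_orthogonal_basis[OF b1 b2 this] show ?thesis
    unfolding S' by (simp add: linear_scale[OF b1] linear_scale[OF b2] power2_eq_square
        flip: scaleR_sum_right)
qed

lemma inverse_has_derivative:
  assumes TS: "\<And>\<xi>. \<xi> \<in> V \<Longrightarrow> T (S \<xi>) = \<xi>" and \<xi>: "\<xi> \<in> V"
  obtains T'' where "(T has_derivative T'') (at (S \<xi>))" "\<And>h. T'' (S' \<xi> h) = h" "\<And>h. S' \<xi> (T'' h) = h"
proof -
  have "inj (S' \<xi>)"
    using norm_deriv[OF \<xi>] mu_pos[OF \<xi>]
    by (intro linear_injective_0[THEN iffD2] linear_deriv \<xi>) (metis less_irrefl mult_eq_0_iff norm_eq_zero)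
  then obtain T'' where T'': "linear T''" "\<And>h. T'' (S' \<xi> h) = h" "\<And>h. S' \<xi> (T'' h) = h"
    using linear_injective_isomorphism[OF linear_deriv[OF \<xi>]] by blast
  have "(T has_derivative T'') (at (S \<xi>))"
    by (rule has_derivative_inverse_strong[OF open_V \<xi> continuous_S TS deriv[OF \<xi>]])
       (auto simp: T'' fun_eq_iff)
  with T'' show thesis by (intro that)
qed

end

section \<open>Flux through the boundary of a box\<close>

definition box_flux :: "(3 \<Rightarrow> real^3 \<Rightarrow> 'b::euclidean_space) \<Rightarrow> real^3 \<Rightarrow> real^3 \<Rightarrow> 'b" where
  "box_flux W c d = (\<Sum>i\<in>UNIV.
     integral (face_rect c d i) (\<lambda>w. W i (face_point i (d$i) w)) -
     integral (face_rect c d i) (\<lambda>w. W i (face_point i (c$i) w)))"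

lemma index_3_cyclic [simp]:
  "(i::3) + 1 \<noteq> i" "i + 2 \<noteq> i" "i + 1 \<noteq> i + 2" "i + 2 \<noteq> i + 1" "i \<noteq> i + 1" "i \<noteq> i + 2"
  "i + 1 + 1 = i + 2" "i + 1 + 2 = i" "i + 2 + 1 = i" "i + 2 + 2 = i + 1"
  using exhaust_3_zero[of i] by auto

lemma UNIV_3_cyclic: "(UNIV :: 3 set) = {i, i + 1, i + 2}"
proof -
  have "x = i \<or> x = i + 1 \<or> x = i + 2" for x
    using exhaust_3_zero[of i] exhaust_3_zero[of x] by auto
  then show ?thesis by auto
qed

lemma sum_3_cyclic: "sum f (UNIV :: 3 set) = f i + f (i + 1) + f (i + 2)"
  by (subst UNIV_3_cyclic[of i]) (simp add: add.assoc)

lemma all_3_cyclic: "(\<forall>k::3. P k) \<longleftrightarrow> P i \<and> P (i + 1) \<and> P (i + 2)"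
  using UNIV_3_cyclic[of i] by (metis UNIV_I empty_iff insert_iff)

lemma face_point_nth [simp]:
  "face_point i t w $ i = t" "face_point i t w $ (i + 1) = fst w" "face_point i t w $ (i + 2) = snd w"
  by (simp_all add: face_point_def)

lemma face_point_eq:
  "face_point i t w = t *\<^sub>R axis i 1 + fst w *\<^sub>R axis (i + 1) 1 + snd w *\<^sub>R axis (i + 2) 1"
  unfolding vec_eq_iff all_3_cyclic[of _ i] by (simp add: axis_def)

lemma upd_face_point [simp]: "upd (face_point i t w) i s = face_point i s w"
  unfolding vec_eq_iff all_3_cyclic[of _ i] by simp

lemma face_point_cyclic: "face_point (i + 1) x (y, z) = face_point i z (x, y)"
  unfolding vec_eq_iff all_3_cyclic[of _ i]
  using face_point_nth[of "i + 1" x "(y, z)"] by simp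

lemma face_rect_cbox: "face_rect c d i = cbox (c$(i+1), c$(i+2)) (d$(i+1), d$(i+2))"
  by (simp add: face_rect_def cbox_Pair_eq)

lemma face_point_in_cbox:
  "face_point i t w \<in> cbox c d \<longleftrightarrow> t \<in> {c$i..d$i} \<and> w \<in> face_rect c d i"
  unfolding mem_box_cart all_3_cyclic[of _ i] by (auto simp: face_rect_def mem_Times_iff)

lemma continuous_on_face_point [continuous_intros]:
  assumes "continuous_on A f" "continuous_on A g"
  shows "continuous_on A (\<lambda>x. face_point i (f x) (g x))"
  unfolding face_point_eq by (intro continuous_intros assms)

lemma continuous_on_face:
  assumes "continuous_on A f" "\<And>w. w \<in> B \<Longrightarrow> face_point i t w \<in> A"
  shows "continuous_on B (\<lambda>w. f (face_point i t w))"
  by (rule continuous_on_compose2[OF assms(1)]) (use assms(2) in \<open>auto intro!: continuous_intros\<close>)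

text \<open>
The volume integral with the innermost integration along the \<open>i\<close>-th axis, which is how the
fundamental theorem of calculus produces it from a pair of opposite faces.
\<close>

definition layered_integral :: "(real^3 \<Rightarrow> 'b::euclidean_space) \<Rightarrow> real^3 \<Rightarrow> real^3 \<Rightarrow> 3 \<Rightarrow> 'b" where
  "layered_integral f c d i =
     integral (face_rect c d i) (\<lambda>w. integral {c$i..d$i} (\<lambda>t. f (face_point i t w)))"

lemma continuous_layer:
  fixes f :: "real^3 \<Rightarrow> 'b::euclidean_space"
  assumes "continuous_on (cbox c d) f"
  shows "continuous_on (face_rect c d i) (\<lambda>w. integral {c$i..d$i} (\<lambda>t. f (face_point i t w)))"
proof -
  have "continuous_on (face_rect c d i \<times> cbox (c$i) (d$i)) (\<lambda>(w, t). f (face_point i t w))"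
    unfolding split_beta
    by (rule continuous_on_compose2[OF assms])
       (auto intro!: continuous_intros simp: face_point_in_cbox)
  from integral_continuous_on_param[OF this] show ?thesis by simp
qed

text \<open>
Both sides are iterated integrals in which the coordinate \<open>i + 1\<close> is outermost and \<open>i\<close> is innermost:
one after splitting the outer double integral, the other after exchanging it with the inner integral.
\<close>

lemma layered_integral_cyclic:
  assumes f: "continuous_on (cbox c d) f"
  shows "layered_integral f c d (i + 1) = layered_integral f c d i"
proof -
  let ?I = "\<lambda>k. {c$k..d$k}"
  have "layered_integral f c d i = integral (cbox (c$(i+1), c$(i+2)) (d$(i+1), d$(i+2)))
      (\<lambda>w. integral (?I i) (\<lambda>t. f (face_point i t w)))"
    by (simp add: layered_integral_def face_rect_cbox)
  also have "\<dots> = integral (?I (i+1)) (\<lambda>x. integral (?I (i+2)) (\<lambda>y. integral (?I i) (\<lambda>t. f (face_point i t (x, y)))))"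
    using integral_prod_continuous[OF continuous_layer[OF f, of i, unfolded face_rect_cbox]] by simp
  finally have 1: "layered_integral f c d i = \<dots>" .
  have "continuous_on (cbox (c$(i+1), (c$(i+2), c$i)) (d$(i+1), (d$(i+2), d$i)))
      (\<lambda>(x, w). f (face_point (i+1) x w))"
    unfolding split_beta
    by (rule continuous_on_compose2[OF f])
       (auto intro!: continuous_intros simp: face_point_in_cbox face_rect_cbox cbox_Pair_eq)
  note swap = integral_swap_continuous[OF this]
  have "layered_integral f c d (i+1) = integral (cbox (c$(i+2), c$i) (d$(i+2), d$i))
      (\<lambda>w. integral (?I (i+1)) (\<lambda>x. f (face_point (i+1) x w)))"
    by (simp add: layered_integral_def face_rect_cbox)
  also have "\<dots> = integral (?I (i+1)) (\<lambda>x. integral (cbox (c$(i+2), c$i) (d$(i+2), d$i)) (\<lambda>w. f (face_point (i+1) x w)))"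
    using swap by simp
  also have "\<dots> = integral (?I (i+1)) (\<lambda>x. integral (?I (i+2)) (\<lambda>y. integral (?I i) (\<lambda>t. f (face_point (i+1) x (y, t)))))"
  proof (rule integral_cong)
    fix x assume x: "x \<in> ?I (i+1)"
    have "continuous_on (cbox (c$(i+2), c$i) (d$(i+2), d$i)) (\<lambda>w. f (face_point (i+1) x w))"
      by (rule continuous_on_face[OF f])
         (use x in \<open>auto simp: face_point_in_cbox face_rect_cbox\<close>)
    from integral_prod_continuous[OF this]
    show "integral (cbox (c$(i+2), c$i) (d$(i+2), d$i)) (\<lambda>w. f (face_point (i+1) x w))
        = integral (?I (i+2)) (\<lambda>y. integral (?I i) (\<lambda>t. f (face_point (i+1) x (y, t))))"
      by simp
  qed
  finally show ?thesis unfolding 1 face_point_cyclic .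
qed

lemma layered_integral_any:
  assumes f: "continuous_on (cbox c d) f"
  shows "layered_integral f c d i = layered_integral f c d 0"
  using exhaust_3_zero[of i] layered_integral_cyclic[OF f, of 0] layered_integral_cyclic[OF f, of 1]
  by auto

lemma layered_integral_sum_zero:
  assumes f: "\<And>i. continuous_on (cbox c d) (f i)" and 0: "\<And>\<xi>. \<xi> \<in> cbox c d \<Longrightarrow> (\<Sum>i\<in>(UNIV::3 set). f i \<xi>) = 0"
  shows "(\<Sum>i\<in>(UNIV::3 set). layered_integral (f i) c d 0) = 0"
proof -
  have int: "(\<lambda>w. integral {c$0..d$0} (\<lambda>t. f i (face_point 0 t w))) integrable_on face_rect c d 0" for i
    using continuous_layer[OF f[of i], of 0] unfolding face_rect_cbox by (rule integrable_continuous)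
  have int1: "(\<lambda>t. f i (face_point 0 t w)) integrable_on {c$0..d$0}" if "w \<in> face_rect c d 0" for i w
    by (intro integrable_continuous_interval continuous_on_compose2[OF f])
       (use that in \<open>auto intro!: continuous_intros simp: face_point_in_cbox\<close>)
  have "(\<Sum>i\<in>UNIV. layered_integral (f i) c d 0)
     = integral (face_rect c d 0) (\<lambda>w. \<Sum>i\<in>UNIV. integral {c$0..d$0} (\<lambda>t. f i (face_point 0 t w)))"
    unfolding layered_integral_def using int by (subst integral_sum) auto
  also have "\<dots> = integral (face_rect c d 0) (\<lambda>w. 0)"
  proof (rule integral_cong)
    fix w assume w: "w \<in> face_rect c d 0"
    have "(\<Sum>i\<in>UNIV. integral {c$0..d$0} (\<lambda>t. f i (face_point 0 t w)))
       = integral {c$0..d$0} (\<lambda>t. \<Sum>i\<in>UNIV. f i (face_point 0 t w))"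
      using int1[OF w] by (subst integral_sum) auto
    also have "\<dots> = integral {c$0..d$0} (\<lambda>t. 0)"
      by (rule integral_cong) (use w in \<open>auto simp: face_point_in_cbox intro!: 0\<close>)
    finally show "(\<Sum>i\<in>UNIV. integral {c$0..d$0} (\<lambda>t. f i (face_point 0 t w))) = 0" by simp
  qed
  finally show ?thesis by simp
qed

text \<open>
By the fundamental theorem of calculus on the lines that join a pair of opposite faces, the flux
through this pair is the volume integral of \<open>DW i\<close>.
\<close>

lemma box_flux_divergence_free:
  fixes W DW :: "3 \<Rightarrow> real^3 \<Rightarrow> 'b::euclidean_space"
  assumes cd: "\<And>k. c$k \<le> d$k"
    and W: "\<And>i. continuous_on (cbox c d) (W i)"
    and DW: "\<And>i. continuous_on (cbox c d) (DW i)"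
    and deriv: "\<And>i \<xi>. \<xi> \<in> cbox c d \<Longrightarrow>
      ((\<lambda>t. W i (upd \<xi> i t)) has_vector_derivative DW i \<xi>) (at (\<xi>$i) within {c$i..d$i})"
    and 0: "\<And>\<xi>. \<xi> \<in> cbox c d \<Longrightarrow> (\<Sum>i\<in>UNIV. DW i \<xi>) = 0"
  shows "box_flux W c d = 0"
proof -
  have "integral (face_rect c d i) (\<lambda>w. W i (face_point i (d$i) w)) -
     integral (face_rect c d i) (\<lambda>w. W i (face_point i (c$i) w)) = layered_integral (DW i) c d 0" for i
  proof -
    have "(\<lambda>w. W i (face_point i t w)) integrable_on face_rect c d i" if "t \<in> {c$i..d$i}" for t
      unfolding face_rect_cbox
      by (intro integrable_continuous continuous_on_face[OF W])
         (use that in \<open>auto simp: face_point_in_cbox face_rect_cbox\<close>)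
    then have "integral (face_rect c d i) (\<lambda>w. W i (face_point i (d$i) w)) -
       integral (face_rect c d i) (\<lambda>w. W i (face_point i (c$i) w))
       = integral (face_rect c d i) (\<lambda>w. W i (face_point i (d$i) w) - W i (face_point i (c$i) w))"
      using cd[of i] by (subst integral_diff) auto
    also have "\<dots> = layered_integral (DW i) c d i"
      unfolding layered_integral_def
    proof (rule integral_cong)
      fix w assume w: "w \<in> face_rect c d i"
      have "((\<lambda>t. W i (face_point i t w)) has_vector_derivative DW i (face_point i t w))
          (at t within {c$i..d$i})" if "t \<in> {c$i..d$i}" for t
        using deriv[of "face_point i t w" i] that w by (simp add: face_point_in_cbox)
      from fundamental_theorem_of_calculus[OF cd this]
      show "W i (face_point i (d$i) w) - W i (face_point i (c$i) w)
          = integral {c$i..d$i} (\<lambda>t. DW i (face_point i t w))"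
        by (simp add: integral_unique)
    qed
    also have "\<dots> = layered_integral (DW i) c d 0" by (rule layered_integral_any[OF DW])
    finally show ?thesis .
  qed
  then show ?thesis
    unfolding box_flux_def using layered_integral_sum_zero[of c d DW] DW 0 by simp
qed

text \<open>
The cutting plane is a face of both parts, with opposite signs.  The field may be singular at \<open>\<xi>0\<close>;
the values of the integrals over the cutting plane cancel even if it passes through \<open>\<xi>0\<close>.
\<close>

lemma box_flux_split:
  assumes m: "c$i \<le> m" "m \<le> d$i"
    and W: "\<And>j. continuous_on (cbox c d - {\<xi>0}) (W j)"
    and \<xi>0: "\<And>k. c$k < \<xi>0$k" "\<And>k. \<xi>0$k < d$k"
  shows "box_flux W c d = box_flux W c (upd d i m) + box_flux W (upd c i m) d"
proof -
  have split: "integral (face_rect c d j) (\<lambda>w. W j (face_point j t w))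
     = integral (face_rect c (upd d i m) j) (\<lambda>w. W j (face_point j t w))
     + integral (face_rect (upd c i m) d j) (\<lambda>w. W j (face_point j t w))"
    if j: "j \<noteq> i" and t: "t = c$j \<or> t = d$j" for j t
  proof -
    have "continuous_on (face_rect c d j) (\<lambda>w. W j (face_point j t w))"
      by (rule continuous_on_face[OF W])
         (use t \<xi>0[of j] order.strict_trans[OF \<xi>0] in
           \<open>auto simp: face_point_in_cbox intro: less_imp_le\<close>)
    then have int: "(\<lambda>w. W j (face_point j t w)) integrable_on face_rect c d j"
      unfolding face_rect_cbox by (rule integrable_continuous)
    have "i \<in> {j, j + 1, j + 2}" using UNIV_3_cyclic[of j] by auto
    then consider "i = j + 1" | "i = j + 2" using j by blast
    then show ?thesis
    proof cases
      case 1
      have "face_rect c d j \<inter> {x. x \<bullet> (1, 0) \<le> m} = face_rect c (upd d i m) j"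
        "face_rect c d j \<inter> {x. x \<bullet> (1, 0) \<ge> m} = face_rect (upd c i m) d j"
        using m by (auto simp: face_rect_def 1)
      with integral_split[OF int[unfolded face_rect_cbox], of "(1, 0)" m]
      show ?thesis by (simp add: face_rect_cbox Basis_prod_def)
    next
      case 2
      have "face_rect c d j \<inter> {x. x \<bullet> (0, 1) \<le> m} = face_rect c (upd d i m) j"
        "face_rect c d j \<inter> {x. x \<bullet> (0, 1) \<ge> m} = face_rect (upd c i m) d j"
        using m by (auto simp: face_rect_def 2)
      with integral_split[OF int[unfolded face_rect_cbox], of "(0, 1)" m]
      show ?thesis by (simp add: face_rect_cbox Basis_prod_def)
    qed
  qed
  have same: "face_rect c (upd d i m) i = face_rect c d i" "face_rect (upd c i m) d i = face_rect c d i"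
    by (simp_all add: face_rect_def)
  show ?thesis
    unfolding box_flux_def sum_3_cyclic[of _ i]
    by (simp add: same split algebra_simps)
qed

text \<open>
The coordinates are shrunk one after the other, \<open>K\<close> being the set of those that are done: each step
cuts off two slabs that avoid \<open>\<xi>0\<close>.
\<close>

lemma box_flux_shrink:
  assumes W: "\<And>j. continuous_on (cbox c d - {\<xi>0}) (W j)"
    and zero: "\<And>c' d'. cbox c' d' \<subseteq> cbox c d - {\<xi>0} \<Longrightarrow> (\<And>k. c'$k \<le> d'$k) \<Longrightarrow> box_flux W c' d' = 0"
    and cc: "\<And>k. c$k \<le> c'$k" "\<And>k. c'$k < \<xi>0$k" and dd: "\<And>k. \<xi>0$k < d'$k" "\<And>k. d'$k \<le> d$k"
  shows "box_flux W c d = box_flux W c' d'"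
proof -
  define p where "p K = (\<chi> k. if k \<in> K then c'$k else c$k)" for K
  define q where "q K = (\<chi> k. if k \<in> K then d'$k else d$k)" for K
  have p: "c$k \<le> p K $ k" "p K $ k < \<xi>0$k" and q: "q K $ k \<le> d$k" "\<xi>0$k < q K $ k" for K k
    using cc[of k] dd[of k] by (auto simp: p_def q_def)
  have pq: "p K $ k < q K $ k" for K k
    using p(2)[where K=K and k=k] q(2)[where K=K and k=k] by linarith
  have "box_flux W c d = box_flux W (p K) (q K)" if "finite K" for K
    using that
  proof (induction K rule: finite_induct)
    case empty
    have "p {} = c" "q {} = d" by (simp_all add: p_def q_def vec_eq_iff)
    then show ?case by simp
  next
    case (insert i K)
    have 1: "p (insert i K) = upd (p K) i (c'$i)" "q (insert i K) = upd (q K) i (d'$i)"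
      by (simp_all add: p_def q_def vec_eq_iff upd_def)
    have 2: "p K $ i \<le> c'$i" "c'$i \<le> q K $ i" "d'$i \<le> q K $ i" "upd (p K) i (c'$i) $ i \<le> d'$i"
      using cc[of i] dd[of i] q[where K=K and k=i] by (auto simp: p_def q_def)
    have sub: "cbox u v \<subseteq> cbox c d - {\<xi>0}"
      if "\<And>k. c$k \<le> u$k" "\<And>k. v$k \<le> d$k" "v$i < \<xi>0$i \<or> \<xi>0$i < u$i" for u v
    proof -
      have "\<xi>0 \<notin> cbox u v" using that(3) by (auto simp: mem_box_cart not_le)
      moreover have "cbox u v \<subseteq> cbox c d"
        using that(1,2) by (meson mem_box_cart(2) order_trans subsetI)
      ultimately show ?thesis by blast
    qed
    have W': "continuous_on (cbox u v - {\<xi>0}) (W j)"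
      if "\<And>k. c$k \<le> u$k" "\<And>k. v$k \<le> d$k" for u v j
    proof (rule continuous_on_subset[OF W])
      have "cbox u v \<subseteq> cbox c d"
        using that by (meson mem_box_cart(2) order_trans subsetI)
      then show "cbox u v - {\<xi>0} \<subseteq> cbox c d - {\<xi>0}" by blast
    qed
    have upc: "c$k \<le> upd (p K) i (c'$i) $ k" "upd (p K) i (c'$i) $ k < \<xi>0$k" for k
      using p[where K=K and k=k] cc[of k] by (cases "k = i"; simp)+
    have "box_flux W (p K) (q K) = box_flux W (p K) (upd (q K) i (c'$i)) + box_flux W (upd (p K) i (c'$i)) (q K)"
      by (rule box_flux_split[OF 2(1,2) W']) (use p q in auto)
    also have "box_flux W (p K) (upd (q K) i (c'$i)) = 0"
    proof (rule zero)
      show "p K $ k \<le> upd (q K) i (c'$i) $ k" for k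
        using pq[of K k] 2(1) by (cases "k = i") (auto intro: less_imp_le)
      show "cbox (p K) (upd (q K) i (c'$i)) \<subseteq> cbox c d - {\<xi>0}"
      proof (rule sub)
        show "upd (q K) i (c'$i) $ k \<le> d$k" for k
          using q(1)[where K=K and k=k] 2(2) order_trans[OF 2(2) q(1)] by (cases "k = i") auto
      qed (use p(1) cc(2)[of i] in auto)
    qed
    also have "box_flux W (upd (p K) i (c'$i)) (q K) = box_flux W (upd (p K) i (c'$i)) (upd (q K) i (d'$i))
        + box_flux W (upd (upd (p K) i (c'$i)) i (d'$i)) (q K)"
      by (rule box_flux_split[OF 2(4,3) W']) (use upc q in auto)
    also have "box_flux W (upd (upd (p K) i (c'$i)) i (d'$i)) (q K) = 0"
    proof (rule zero)
      show "upd (upd (p K) i (c'$i)) i (d'$i) $ k \<le> q K $ k" for k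
        using pq[of K k] 2(3) by (cases "k = i") (auto intro: less_imp_le)
      show "cbox (upd (upd (p K) i (c'$i)) i (d'$i)) (q K) \<subseteq> cbox c d - {\<xi>0}"
      proof (rule sub)
        show "c$k \<le> upd (upd (p K) i (c'$i)) i (d'$i) $ k" for k
          using p(1)[where K=K and k=k] upc(1)[of i] 2(4) by (cases "k = i") auto
      qed (use q(1) dd(1)[of i] in auto)
    qed
    finally show ?case using insert.IH by (simp add: 1)
  qed
  moreover have "p UNIV = c'" "q UNIV = d'" by (simp_all add: p_def q_def vec_eq_iff)
  ultimately show ?thesis by (metis finite_code)
qed

section \<open>The Cauchy kernel\<close>

lemma emb_axis: "emb \<psi> (axis k 1) = \<psi> k"
  by (simp add: emb_def axis_def if_distrib[of "\<lambda>c. c *\<^sub>R _"] cong: if_cong)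

lemma emb_sum: "emb \<psi> (\<Sum>i\<in>A. f i) = (\<Sum>i\<in>A. emb \<psi> (f i))"
  by (rule linear_sum[OF linear_emb])

lemma linear_qcnj: "linear qcnj"
  by (auto simp: linear_iff vec4_eq_iff qcnj_nth algebra_simps)

lemma bounded_linear_qcnj_emb: "bounded_linear (\<lambda>x. qcnj (emb \<psi> x))"
  using linear_compose[OF linear_emb linear_qcnj] by (simp add: o_def linear_conv_bounded_linear)

lemmas qcnj_linear = linear_add[OF linear_qcnj] linear_scale[OF linear_qcnj] linear_0[OF linear_qcnj]
  linear_diff[OF linear_qcnj] linear_neg[OF linear_qcnj]

definition cauchy_kernel_deriv :: "(3 \<Rightarrow> quat) \<Rightarrow> real^3 \<Rightarrow> real^3 \<Rightarrow> quat" where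
  "cauchy_kernel_deriv \<psi> x h = inverse (4 * pi) *\<^sub>R
     (inverse (norm x) ^ 3 *\<^sub>R qcnj (emb \<psi> h) - (3 * (x \<bullet> h) * inverse (norm x) ^ 5) *\<^sub>R qcnj (emb \<psi> x))"

context
  fixes \<psi> :: "3 \<Rightarrow> quat"
  assumes struct: "structural_set \<psi>"
begin

lemma cauchy_kernel_eq:
  "cauchy_kernel \<psi> x = inverse (4 * pi) *\<^sub>R (inverse (norm x) ^ 3 *\<^sub>R qcnj (emb \<psi> x))"
  by (simp add: cauchy_kernel_def qcnj_emb[OF struct] power_inverse)

lemma norm_cauchy_kernel: "norm (cauchy_kernel \<psi> x) = inverse (4 * pi) * inverse (norm x) ^ 2"
  by (cases "x = 0") (simp_all add: cauchy_kernel_eq norm_emb[OF struct] eval_nat_numeral field_simps)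

lemma cauchy_kernel_scale:
  assumes "r > 0"
  shows "cauchy_kernel \<psi> (x /\<^sub>R r) = r\<^sup>2 *\<^sub>R cauchy_kernel \<psi> x"
  using assms by (simp add: cauchy_kernel_eq emb_linear qcnj_linear field_simps eval_nat_numeral)

lemma has_derivative_cauchy_kernel:
  assumes "x \<noteq> 0"
  shows "(cauchy_kernel \<psi> has_derivative cauchy_kernel_deriv \<psi> x) (at x)"
proof -
  have "((\<lambda>x. inverse (4 * pi) *\<^sub>R (inverse (norm x) ^ 3 *\<^sub>R qcnj (emb \<psi> x)))
     has_derivative cauchy_kernel_deriv \<psi> x) (at x)"
    unfolding cauchy_kernel_deriv_def using assms
    by (auto intro!: derivative_eq_intros bounded_linear.has_derivative[OF bounded_linear_qcnj_emb]
        has_derivative_norm simp: fun_eq_iff sgn_div_norm inner_commute eval_nat_numeral algebra_simps)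
  then show ?thesis unfolding cauchy_kernel_eq[abs_def] .
qed

lemma continuous_cauchy_kernel: "continuous_on (- {0}) (cauchy_kernel \<psi>)"
  by (rule continuous_at_imp_continuous_on)
     (auto intro!: has_derivative_continuous has_derivative_cauchy_kernel)

lemma continuous_cauchy_kernel_deriv: "continuous_on (- {0}) (\<lambda>x. cauchy_kernel_deriv \<psi> x h)"
  unfolding cauchy_kernel_deriv_def
  by (intro continuous_intros bounded_linear.continuous_on[OF bounded_linear_qcnj_emb]) auto

text \<open>
Since \<open>\<Sum>\<^sub>k (conj \<psi>\<^sub>k) \<psi>\<^sub>k = 3\<close> and \<open>(conj x) x = |x|\<^sup>2\<close>, the two terms of the derivative contribute
\<open>3 |x|\<^sup>-\<^sup>3\<close> and \<open>-3 |x|\<^sup>-\<^sup>3\<close>.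
\<close>

lemma cauchy_kernel_right_monogenic:
  assumes "x \<noteq> 0"
  shows "(\<Sum>k\<in>UNIV. cauchy_kernel_deriv \<psi> x (axis k 1) \<odot> \<psi> k) = 0"
proof -
  have unit: "qcnj (\<psi> k) \<odot> \<psi> k = qone" for k
    using psi_orthonormal[OF struct, of k k] by (simp add: qcnj_qmult_self power2_norm_eq_inner)
  have "cauchy_kernel_deriv \<psi> x (axis k 1) \<odot> \<psi> k = inverse (4 * pi) *\<^sub>R
      (inverse (norm x) ^ 3 *\<^sub>R qone - (3 * inverse (norm x) ^ 5) *\<^sub>R (qcnj (emb \<psi> x) \<odot> (x$k *\<^sub>R \<psi> k)))" for k
    by (simp add: cauchy_kernel_deriv_def emb_axis qmult_real.scaleR_left qmult_real.diff_left
        qmult_real.scaleR_right unit inner_axis)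
  then have "(\<Sum>k\<in>UNIV. cauchy_kernel_deriv \<psi> x (axis k 1) \<odot> \<psi> k) = inverse (4 * pi) *\<^sub>R
      ((3 * inverse (norm x) ^ 3) *\<^sub>R qone - (3 * inverse (norm x) ^ 5) *\<^sub>R (qcnj (emb \<psi> x) \<odot> emb \<psi> x))"
    by (simp add: sum_subtractf emb_def flip: scaleR_sum_right qmult_real.sum_right)
       (simp add: vec_eq_iff)
  also have "\<dots> = 0"
    using assms by (simp add: qcnj_qmult_self norm_emb[OF struct] eval_nat_numeral field_simps)
  finally show ?thesis .
qed

end

section \<open>Cauchy's theorem in a conformal chart\<close>

text \<open>
\<open>N = M \<circ> S\<close> for a function \<open>M\<close> that is annihilated by the left Cauchy-Riemann operator; the equation
for \<open>M\<close> is expressed in the orthogonal frame \<open>S' e\<^sub>i\<close>.  On the faces of the box the derivatives are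
one-sided.
\<close>

locale monogenic_pullback = conformal_chart +
  fixes \<psi> :: "3 \<Rightarrow> quat" and a b :: "real^3" and N :: "real^3 \<Rightarrow> cquat" and DN :: "3 \<Rightarrow> real^3 \<Rightarrow> cquat"
  assumes struct: "structural_set \<psi>"
    and cbox_V: "cbox a b \<subseteq> V"
    and cont_N: "continuous_on (cbox a b) N"
    and cont_DN: "\<And>i. continuous_on (cbox a b) (DN i)"
    and deriv_N: "\<And>i \<xi>. \<xi> \<in> cbox a b \<Longrightarrow>
       ((\<lambda>t. N (upd \<xi> i t)) has_vector_derivative DN i \<xi>) (at (\<xi>$i) within {a$i..b$i})"
    and inj_S: "inj_on S (cbox a b)"
    and CR_N: "\<And>\<xi>. \<xi> \<in> cbox a b \<Longrightarrow> (\<Sum>i\<in>UNIV. cquat_of (emb \<psi> (S' \<xi> (axis i 1))) \<odot> DN i \<xi>) = 0"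
begin

text \<open>
The integrand \<open>\<kappa> \<eta> M\<close> on the faces orthogonal to the \<open>i\<close>-th axis, in view of \<open>sgn_det_area_form\<close>.
\<close>

definition pulled_form :: "(real^3 \<Rightarrow> quat) \<Rightarrow> 3 \<Rightarrow> real^3 \<Rightarrow> cquat" where
  "pulled_form \<kappa> i \<xi> = cquat_of (\<kappa> (S \<xi>) \<odot> emb \<psi> (\<mu> \<xi> *\<^sub>R S' \<xi> (axis i 1))) \<odot> N \<xi>"

lemma continuous_qmult_real:
  "continuous_on A f \<Longrightarrow> continuous_on A g \<Longrightarrow> continuous_on A (\<lambda>x. f x \<odot> (g x :: quat))"
  by (rule qmult_real.continuous_on)

lemma continuous_qmult_complex:
  "continuous_on A f \<Longrightarrow> continuous_on A g \<Longrightarrow> continuous_on A (\<lambda>x. f x \<odot> (g x :: cquat))"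
  by (rule qmult_complex.continuous_on)

lemmas continuous_quat = continuous_qmult_real continuous_qmult_complex
  bounded_linear.continuous_on[OF bounded_linear_cquat_of] bounded_linear.continuous_on[OF bounded_linear_emb]

lemma continuous_pulled_form:
  assumes "A \<subseteq> cbox a b" "continuous_on (S ` A) \<kappa>"
  shows "continuous_on A (pulled_form \<kappa> i)"
proof -
  have "continuous_on A S" "continuous_on A \<mu>" "continuous_on A (\<lambda>\<xi>. S' \<xi> (axis i 1))" "continuous_on A N"
    using assms(1) cbox_V continuous_S cont_mu cont_deriv cont_N by (meson continuous_on_subset order_trans)+
  then show ?thesis
    unfolding pulled_form_def
    by (intro continuous_quat continuous_intros continuous_on_compose2[OF assms(2)]) auto
qed

text \<open>
The divergence has three parts by the product rule.  The derivatives of \<open>\<kappa>\<close> sum to zero because \<open>\<kappa>\<close>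
is right monogenic, those of the frame because it is free of divergence, and those of \<open>N\<close> because
of the Cauchy-Riemann equation.
\<close>

lemma pulled_form_flux_zero:
  assumes sub: "cbox c d \<subseteq> cbox a b" and cd: "\<And>k. c$k \<le> d$k"
    and \<kappa>: "\<And>x. x \<in> S ` cbox c d \<Longrightarrow> (\<kappa> has_derivative \<kappa>' x) (at x)"
    and cont: "\<And>h. continuous_on (S ` cbox c d) (\<lambda>x. \<kappa>' x h)"
    and right: "\<And>x. x \<in> S ` cbox c d \<Longrightarrow> (\<Sum>k\<in>UNIV. \<kappa>' x (axis k 1) \<odot> \<psi> k) = 0"
  shows "box_flux (pulled_form \<kappa>) c d = 0"
proof (rule box_flux_divergence_free[OF cd])
  have subV: "cbox c d \<subseteq> V" using sub cbox_V by auto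
  have cont\<kappa>: "continuous_on (S ` cbox c d) \<kappa>"
    by (intro continuous_at_imp_continuous_on ballI has_derivative_continuous[OF \<kappa>])
  define X where "X i \<xi> = emb \<psi> (\<mu> \<xi> *\<^sub>R S' \<xi> (axis i 1))" for i \<xi>
  define DW where "DW i \<xi> =
      cquat_of (\<kappa>' (S \<xi>) (S' \<xi> (axis i 1)) \<odot> X i \<xi> + \<kappa> (S \<xi>) \<odot> emb \<psi> (P i \<xi>)) \<odot> N \<xi>
      + cquat_of (\<kappa> (S \<xi>) \<odot> X i \<xi>) \<odot> DN i \<xi>" for i \<xi>
  have sum_axis: "h = (\<Sum>k\<in>UNIV. h$k *\<^sub>R axis k 1)" for h :: "real^3"
    by (simp add: vec_eq_iff axis_def if_distrib cong: if_cong)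
  have cS: "continuous_on (cbox c d) S" and cmu: "continuous_on (cbox c d) \<mu>"
    and cS': "continuous_on (cbox c d) (\<lambda>\<xi>. S' \<xi> h)"
    and cP: "continuous_on (cbox c d) (P i)" and cN: "continuous_on (cbox c d) N"
    and cDN: "continuous_on (cbox c d) (DN i)" for h i
    using subV sub continuous_S cont_mu cont_deriv cont_P cont_N cont_DN by (meson continuous_on_subset)+
  have lin\<kappa>': "linear (\<kappa>' x)" if "x \<in> S ` cbox c d" for x
    using \<kappa>[OF that] has_derivative_linear by blast
  fix i
  show "continuous_on (cbox c d) (pulled_form \<kappa> i)"
    by (rule continuous_pulled_form[OF sub cont\<kappa>])
  have "continuous_on (cbox c d) (\<lambda>\<xi>. \<Sum>k\<in>UNIV. (S' \<xi> (axis i 1) $ k) *\<^sub>R \<kappa>' (S \<xi>) (axis k 1))"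
    by (intro continuous_intros continuous_on_compose2[OF cont] cS cS') auto
  then have c1: "continuous_on (cbox c d) (\<lambda>\<xi>. \<kappa>' (S \<xi>) (S' \<xi> (axis i 1)))"
  proof (rule continuous_on_eq)
    fix \<xi> assume "\<xi> \<in> cbox c d"
    then have lin: "linear (\<kappa>' (S \<xi>))" by (intro lin\<kappa>') auto
    show "(\<Sum>k\<in>UNIV. (S' \<xi> (axis i 1) $ k) *\<^sub>R \<kappa>' (S \<xi>) (axis k 1)) = \<kappa>' (S \<xi>) (S' \<xi> (axis i 1))"
      by (subst (3) sum_axis) (simp add: linear_sum[OF lin] linear_scale[OF lin])
  qed
  show "continuous_on (cbox c d) (DW i)"
    unfolding DW_def X_def
    by (intro continuous_quat continuous_intros c1 cS cmu cS' cP cN cDN continuous_on_compose2[OF cont\<kappa>]) auto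
  fix \<xi> assume \<xi>: "\<xi> \<in> cbox c d"
  have \<xi>V: "\<xi> \<in> V" and \<xi>ab: "\<xi> \<in> cbox a b" using \<xi> sub subV by auto
  have "(S has_derivative S' \<xi>) (at \<xi> within UNIV)" using deriv[OF \<xi>V] by simp
  from has_derivative_imp_partial[OF this]
  have dS: "((\<lambda>t. S (upd \<xi> i t)) has_vector_derivative S' \<xi> (axis i 1)) (at (\<xi>$i))" by simp
  have "((\<lambda>t. S (upd \<xi> i t)) has_derivative (\<lambda>h. h *\<^sub>R S' \<xi> (axis i 1))) (at (\<xi>$i))"
    using dS by (simp add: has_vector_derivative_def)
  moreover have "(\<kappa> has_derivative \<kappa>' (S \<xi>)) (at (S (upd \<xi> i (\<xi>$i))))" using \<kappa> \<xi> by simp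
  ultimately have "((\<lambda>t. \<kappa> (S (upd \<xi> i t))) has_derivative (\<lambda>h. \<kappa>' (S \<xi>) (h *\<^sub>R S' \<xi> (axis i 1)))) (at (\<xi>$i))"
    by (rule has_derivative_compose)
  then have dk: "((\<lambda>t. \<kappa> (S (upd \<xi> i t))) has_vector_derivative \<kappa>' (S \<xi>) (S' \<xi> (axis i 1))) (at (\<xi>$i))"
    using lin\<kappa>'[of "S \<xi>"] \<xi> by (simp add: has_vector_derivative_def linear_scale)
  have dX: "((\<lambda>t. X i (upd \<xi> i t)) has_vector_derivative emb \<psi> (P i \<xi>)) (at (\<xi>$i))"
    unfolding X_def by (rule bounded_linear.has_vector_derivative[OF bounded_linear_emb deriv_P[OF \<xi>V]])
  have dN: "((\<lambda>t. N (upd \<xi> i t)) has_vector_derivative DN i \<xi>) (at (\<xi>$i) within {c$i..d$i})"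
  proof (rule has_vector_derivative_within_subset[OF deriv_N[OF \<xi>ab]])
    show "{c$i..d$i} \<subseteq> {a$i..b$i}"
    proof -
      have "cbox c d \<noteq> {}" using \<xi> by blast
      then have "a$i \<le> c$i" "d$i \<le> b$i" using sub cd unfolding subset_interval_cart(1) by auto
      then show ?thesis by auto
    qed
  qed
  note product_rule = qmult_complex.has_vector_derivative[OF
      bounded_linear.has_vector_derivative[OF bounded_linear_cquat_of
        qmult_real.has_vector_derivative[OF has_vector_derivative_at_within[OF dk]
          has_vector_derivative_at_within[OF dX]]] dN]
  have "((\<lambda>t. pulled_form \<kappa> i (upd \<xi> i t)) has_vector_derivative
      cquat_of (\<kappa> (S \<xi>) \<odot> X i \<xi>) \<odot> DN i \<xi>
      + cquat_of (\<kappa> (S \<xi>) \<odot> emb \<psi> (P i \<xi>) + \<kappa>' (S \<xi>) (S' \<xi> (axis i 1)) \<odot> X i \<xi>) \<odot> N \<xi>)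
      (at (\<xi>$i) within {c$i..d$i})"
    using product_rule unfolding pulled_form_def X_def[symmetric] upd_self .
  then show "((\<lambda>t. pulled_form \<kappa> i (upd \<xi> i t)) has_vector_derivative DW i \<xi>) (at (\<xi>$i) within {c$i..d$i})"
    by (simp add: DW_def add.commute)
  have "(\<Sum>i\<in>UNIV. \<kappa>' (S \<xi>) (S' \<xi> (axis i 1)) \<odot> emb \<psi> (S' \<xi> (axis i 1)))
      = (\<mu> \<xi>)\<^sup>2 *\<^sub>R (\<Sum>i\<in>UNIV. \<kappa>' (S \<xi>) (axis i 1) \<odot> emb \<psi> (axis i 1))"
  proof (rule sum_bilinear_deriv[where b = "\<lambda>x y. \<kappa>' (S \<xi>) x \<odot> emb \<psi> y", OF _ _ \<xi>V])
    have lin: "linear (\<kappa>' (S \<xi>))" using \<xi> by (intro lin\<kappa>') auto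
    show "linear (\<lambda>x. \<kappa>' (S \<xi>) x \<odot> emb \<psi> y)" for y
      by (auto simp: linear_iff linear_add[OF lin] linear_scale[OF lin] qmult_real.add_left qmult_real.scaleR_left)
    show "linear (\<lambda>y. \<kappa>' (S \<xi>) x \<odot> emb \<psi> y)" for x
      by (auto simp: linear_iff emb_linear qmult_real.add_right qmult_real.scaleR_right)
  qed
  also have "\<dots> = 0" using right[of "S \<xi>"] \<xi> by (simp add: emb_axis)
  finally have 1: "(\<Sum>i\<in>UNIV. \<kappa>' (S \<xi>) (S' \<xi> (axis i 1)) \<odot> X i \<xi>) = 0"
    by (simp add: X_def emb_linear qmult_real.scaleR_right flip: scaleR_sum_right)
  have 2: "(\<Sum>i\<in>UNIV. \<kappa> (S \<xi>) \<odot> emb \<psi> (P i \<xi>)) = 0"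
    using div_P[OF \<xi>V] by (simp add: emb_linear flip: qmult_real.sum_right emb_sum) (simp add: qmult_real.zero_right)
  have 3: "(\<Sum>i\<in>UNIV. cquat_of (X i \<xi>) \<odot> DN i \<xi>) = 0"
    using CR_N[OF \<xi>ab]
    by (simp add: X_def emb_linear cquat_of_linear qmult_complex.scaleR_left flip: scaleR_sum_right)
  have "(\<Sum>i\<in>UNIV. DW i \<xi>) =
     cquat_of ((\<Sum>i\<in>UNIV. \<kappa>' (S \<xi>) (S' \<xi> (axis i 1)) \<odot> X i \<xi>) + (\<Sum>i\<in>UNIV. \<kappa> (S \<xi>) \<odot> emb \<psi> (P i \<xi>))) \<odot> N \<xi>
     + cquat_of (\<kappa> (S \<xi>)) \<odot> (\<Sum>i\<in>UNIV. cquat_of (X i \<xi>) \<odot> DN i \<xi>)"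
    unfolding DW_def by (simp add: sum.distrib cquat_of_linear cquat_of_qmult qmult_complex.sum_left
        qmult_complex.sum_right qmult_complex.add_left qmult_assoc)
  then show "(\<Sum>i\<in>UNIV. DW i \<xi>) = 0"
    unfolding 1 2 3 by (simp add: cquat_of_linear qmult_complex.zero_left qmult_complex.zero_right)
qed

end

section \<open>Cauchy's integral formula in a conformal chart\<close>

text \<open>
Four times \<open>\<pi> / 6\<close>: a face of the cube \<open>[-1, 1]\<^sup>3\<close> is seen from its centre under a sixth of the solid
angle \<open>4 \<pi>\<close>.  The inner integral has an elementary primitive, the outer one the primitive
\<open>2 arctan (x / sqrt (2 + x\<^sup>2))\<close>.
\<close>

lemma integral_solid_angle_face:
  "integral (cbox (-1, -1) (1, 1)) (\<lambda>w. inverse (sqrt (1 + (fst w)\<^sup>2 + (snd w)\<^sup>2)) ^ 3) = 2 * pi / 3"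
proof -
  have pos: "1 + x\<^sup>2 + y\<^sup>2 > 0" for x y :: real by (simp add: add_pos_nonneg)
  have cont: "continuous_on (cbox (-1, -1) (1::real, 1::real))
      (\<lambda>w. inverse (sqrt (1 + (fst w)\<^sup>2 + (snd w)\<^sup>2)) ^ 3)"
    using pos by (intro continuous_intros) (auto simp: less_imp_neq[symmetric])
  have inner: "integral {-1..1} (\<lambda>y. inverse (sqrt (1 + x\<^sup>2 + y\<^sup>2)) ^ 3) = 2 / ((1 + x\<^sup>2) * sqrt (2 + x\<^sup>2))" for x :: real
  proof -
    have x: "1 + x\<^sup>2 > 0" by (simp add: add_pos_nonneg)
    have "((\<lambda>y. y / ((1 + x\<^sup>2) * sqrt (1 + x\<^sup>2 + y\<^sup>2))) has_vector_derivative inverse (sqrt (1 + x\<^sup>2 + y\<^sup>2)) ^ 3)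
        (at y within {-1..1})" for y
    proof -
      define s where "s = sqrt (1 + x\<^sup>2 + y\<^sup>2)"
      have s: "s > 0" "s\<^sup>2 = 1 + x\<^sup>2 + y\<^sup>2" using pos[of x y] by (simp_all add: s_def)
      have "((\<lambda>y. y / ((1 + x\<^sup>2) * sqrt (1 + x\<^sup>2 + y\<^sup>2))) has_real_derivative
          (1 * ((1 + x\<^sup>2) * s) - y * ((1 + x\<^sup>2) * (y / s))) / (((1 + x\<^sup>2) * s) * ((1 + x\<^sup>2) * s))) (at y within {-1..1})"
        using pos[of x y] x s unfolding s_def
        by (auto intro!: derivative_eq_intros simp: divide_simps)
      moreover have "(1 * ((1 + x\<^sup>2) * s) - y * ((1 + x\<^sup>2) * (y / s))) / (((1 + x\<^sup>2) * s) * ((1 + x\<^sup>2) * s))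
          = (s\<^sup>2 - y\<^sup>2) / (1 + x\<^sup>2) * inverse s ^ 3"
      proof -
        define A where "A = 1 + x\<^sup>2"
        have "A > 0" using x by (simp add: A_def)
        then have "(1 * (A * s) - y * (A * (y / s))) / ((A * s) * (A * s)) = (s\<^sup>2 - y\<^sup>2) / A * inverse s ^ 3"
          using s(1) by (simp add: field_simps power2_eq_square power3_eq_cube)
        then show ?thesis by (simp only: A_def)
      qed
      moreover have "(s\<^sup>2 - y\<^sup>2) / (1 + x\<^sup>2) = 1" using x by (simp add: s)
      ultimately show ?thesis
        by (simp add: has_real_derivative_iff_has_vector_derivative s_def)
    qed
    from fundamental_theorem_of_calculus[OF _ this]
    have "integral {-1..1} (\<lambda>y. inverse (sqrt (1 + x\<^sup>2 + y\<^sup>2)) ^ 3) = 2 / ((1 + x\<^sup>2) * sqrt (1 + x\<^sup>2 + 1))"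
      by (simp add: integral_unique)
    then show ?thesis by (simp add: add.commute)
  qed
  have "((\<lambda>x. 2 * arctan (x / sqrt (2 + x\<^sup>2))) has_vector_derivative 2 / ((1 + x\<^sup>2) * sqrt (2 + x\<^sup>2)))
      (at x within {-1..1})" for x :: real
  proof -
    define s where "s = sqrt (2 + x\<^sup>2)"
    have x: "2 + x\<^sup>2 > 0" "1 + x\<^sup>2 > 0" by (simp_all add: add_pos_nonneg)
    have s: "s > 0" "s\<^sup>2 = 2 + x\<^sup>2" using x by (simp_all add: s_def)
    have "((\<lambda>x. 2 * arctan (x / sqrt (2 + x\<^sup>2))) has_real_derivative
        2 * (((1 * s - x * (x / s)) / (s * s)) / (1 + (x / s)\<^sup>2))) (at x within {-1..1})"
      using x s unfolding s_def
      by (auto intro!: derivative_eq_intros simp: divide_simps)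
    moreover have "2 * (((1 * s - x * (x / s)) / (s * s)) / (1 + (x / s)\<^sup>2)) = 2 * (s\<^sup>2 - x\<^sup>2) / (s * (s\<^sup>2 + x\<^sup>2))"
      using s(1) by (simp add: divide_simps power2_eq_square add_pos_nonneg)
    moreover have "\<dots> = 2 / ((1 + x\<^sup>2) * s)"
      using s x by (simp add: divide_simps)
    ultimately show ?thesis
      by (simp add: has_real_derivative_iff_has_vector_derivative s_def)
  qed
  from fundamental_theorem_of_calculus[OF _ this]
  have "integral {-1..1} (\<lambda>x::real. 2 / ((1 + x\<^sup>2) * sqrt (2 + x\<^sup>2))) = 4 * arctan (1 / sqrt 3)"
    by (simp add: integral_unique arctan_minus)
  also have "arctan (1 / sqrt 3) = pi / 6"
    using arctan_tan[of "pi / 6"] by (simp add: tan_30)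
  finally show ?thesis
    using integral_prod_continuous[OF cont] by (simp add: inner)
qed

lemma directional_derivative_sequentially:
  assumes "(f has_derivative f') (at x)" "\<And>k. r k > 0" "r \<longlonglongrightarrow> 0"
  shows "(\<lambda>k. (f (x + r k *\<^sub>R z) - f x) /\<^sub>R r k) \<longlonglongrightarrow> f' z"
proof -
  have 1: "((\<lambda>t. x + t *\<^sub>R z) has_derivative (\<lambda>h. h *\<^sub>R z)) (at 0)"
    by (auto intro!: derivative_eq_intros)
  have "(f has_derivative f') (at (x + 0 *\<^sub>R z))" using assms(1) by simp
  from has_derivative_compose[OF 1 this]
  have "((\<lambda>t. f (x + t *\<^sub>R z)) has_derivative (\<lambda>h. f' (h *\<^sub>R z))) (at 0)" .
  moreover have lin: "f' (h *\<^sub>R z) = h *\<^sub>R f' z" for h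
    using assms(1) has_derivative_linear linear_scale by blast
  ultimately have "((\<lambda>h. norm (f (x + h *\<^sub>R z) - f x - h *\<^sub>R f' z) / norm h) \<longlongrightarrow> 0) (at 0)"
    by (simp add: has_derivative_at)
  moreover have "filterlim r (at 0) sequentially"
    using assms(2,3) by (simp add: filterlim_at less_imp_neq[symmetric])
  ultimately have "(\<lambda>k. norm (f (x + r k *\<^sub>R z) - f x - r k *\<^sub>R f' z) / norm (r k)) \<longlonglongrightarrow> 0"
    by (rule filterlim_compose)
  moreover have "norm (f (x + r k *\<^sub>R z) - f x - r k *\<^sub>R f' z) / norm (r k)
      = norm ((f (x + r k *\<^sub>R z) - f x) /\<^sub>R r k - f' z)" for k
  proof -
    have "(f (x + r k *\<^sub>R z) - f x) /\<^sub>R r k - f' z = (f (x + r k *\<^sub>R z) - f x - r k *\<^sub>R f' z) /\<^sub>R r k"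
      using assms(2)[of k] by (simp add: scaleR_diff_right)
    then show ?thesis using assms(2)[of k] by (simp add: divide_inverse_commute)
  qed
  ultimately show ?thesis
    using LIM_zero_cancel tendsto_norm_zero_cancel by fastforce
qed

lemma face_point_scaled:
  "x + r *\<^sub>R face_point i t w = face_point i (x$i + r * t) (r *\<^sub>R w + (x$(i+1), x$(i+2)))"
  unfolding vec_eq_iff all_3_cyclic[of _ i] by simp

lemma norm_face_point: "norm (face_point i t w) = sqrt (t\<^sup>2 + (fst w)\<^sup>2 + (snd w)\<^sup>2)"
  by (simp add: norm_eq_sqrt_inner inner_vec_def sum_3_cyclic[of _ i] power2_eq_square)

text \<open>
Scaling to the fixed cube \<open>[-1, 1]\<^sup>3\<close>, with opposite faces combined under one integral, so that the
limit \<open>r \<rightarrow> 0\<close> can be taken under the integral sign.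
\<close>

lemma box_flux_cube:
  fixes W :: "3 \<Rightarrow> real^3 \<Rightarrow> 'b::euclidean_space"
  assumes r: "r > 0" and W: "\<And>i. continuous_on (cbox (x - vec r) (x + vec r) - {x}) (W i)"
  shows "box_flux W (x - vec r) (x + vec r) = (\<Sum>i\<in>UNIV.
    integral (cbox (-1, -1) (1, 1)) (\<lambda>w. r\<^sup>2 *\<^sub>R (W i (x + r *\<^sub>R face_point i 1 w) - W i (x + r *\<^sub>R face_point i (-1) w))))"
    and "\<And>i. (\<lambda>w. r\<^sup>2 *\<^sub>R (W i (x + r *\<^sub>R face_point i 1 w) - W i (x + r *\<^sub>R face_point i (-1) w)))
      integrable_on cbox (-1, -1) (1, 1)"
proof -
  define p where "p i = (x$(i+1), x$(i+2))" for i
  have rect: "face_rect (x - vec r) (x + vec r) i = cbox (p i - (r, r)) (p i + (r, r))" for i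
    by (simp add: face_rect_cbox p_def)
  have face: "((\<lambda>w. r\<^sup>2 *\<^sub>R W i (x + r *\<^sub>R face_point i t w)) has_integral
      integral (face_rect (x - vec r) (x + vec r) i) (\<lambda>w. W i (face_point i (x$i + r * t) w))) (cbox (-1, -1) (1, 1))"
    if t: "t = 1 \<or> t = -1" for i t
  proof -
    let ?I = "integral (cbox (p i - (r, r)) (p i + (r, r))) (\<lambda>w. W i (face_point i (x$i + r * t) w))"
    have "continuous_on (cbox (p i - (r, r)) (p i + (r, r))) (\<lambda>w. W i (face_point i (x$i + r * t) w))"
    proof (rule continuous_on_face[OF W])
      fix w assume "w \<in> cbox (p i - (r, r)) (p i + (r, r))"
      then have "face_point i (x$i + r * t) w \<in> cbox (x - vec r) (x + vec r)"
        using t r unfolding face_point_in_cbox rect by auto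
      moreover have "face_point i (x$i + r * t) w $ i \<noteq> x$i" using t r by auto
      then have "face_point i (x$i + r * t) w \<noteq> x" by metis
      ultimately show "face_point i (x$i + r * t) w \<in> cbox (x - vec r) (x + vec r) - {x}" by auto
    qed
    then have "((\<lambda>w. W i (face_point i (x$i + r * t) w)) has_integral ?I) (cbox (p i - (r, r)) (p i + (r, r)))"
      by (simp add: integrable_continuous integrable_integral)
    note * = has_integral_cmul[OF has_integral_affinity'[OF this r, of "p i"], of "r\<^sup>2"]
    have "((\<lambda>w. r\<^sup>2 *\<^sub>R W i (face_point i (x$i + r * t) (r *\<^sub>R w + p i))) has_integral ?I) (cbox (-1, -1) (1, 1))"
    proof -
      have "r * r * (inverse r * inverse r) = 1" using r by (simp add: field_simps)
      with * show ?thesis using r by (simp add: eval_nat_numeral)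
    qed
    then show ?thesis by (simp add: face_point_scaled p_def rect)
  qed
  have diff: "((\<lambda>w. r\<^sup>2 *\<^sub>R (W i (x + r *\<^sub>R face_point i 1 w) - W i (x + r *\<^sub>R face_point i (-1) w))) has_integral
      integral (face_rect (x - vec r) (x + vec r) i) (\<lambda>w. W i (face_point i (x$i + r) w)) -
      integral (face_rect (x - vec r) (x + vec r) i) (\<lambda>w. W i (face_point i (x$i - r) w))) (cbox (-1, -1) (1, 1))" for i
    using has_integral_diff[OF face[of 1 i] face[of "-1" i]] by (simp add: scaleR_diff_right)
  then show "\<And>i. (\<lambda>w. r\<^sup>2 *\<^sub>R (W i (x + r *\<^sub>R face_point i 1 w) - W i (x + r *\<^sub>R face_point i (-1) w)))
      integrable_on cbox (-1, -1) (1, 1)" by blast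
  show "box_flux W (x - vec r) (x + vec r) = (\<Sum>i\<in>UNIV.
    integral (cbox (-1, -1) (1, 1)) (\<lambda>w. r\<^sup>2 *\<^sub>R (W i (x + r *\<^sub>R face_point i 1 w) - W i (x + r *\<^sub>R face_point i (-1) w))))"
    unfolding box_flux_def integral_unique[OF diff] by simp
qed

context monogenic_pullback
begin

abbreviation kernel_at :: "real^3 \<Rightarrow> real^3 \<Rightarrow> quat" where
  "kernel_at x \<equiv> \<lambda>y. cauchy_kernel \<psi> (y - x)"

lemma kernel_flux_zero:
  assumes sub: "cbox c d \<subseteq> cbox a b" and cd: "\<And>k. c$k \<le> d$k" and x: "x \<notin> S ` cbox c d"
  shows "box_flux (pulled_form (kernel_at x)) c d = 0"
proof (rule pulled_form_flux_zero[OF sub cd])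
  show "(kernel_at x has_derivative cauchy_kernel_deriv \<psi> (y - x)) (at y)" if "y \<in> S ` cbox c d" for y
    by (rule has_derivative_shift[OF has_derivative_cauchy_kernel[OF struct]]) (use that x in auto)
  show "continuous_on (S ` cbox c d) (\<lambda>y. cauchy_kernel_deriv \<psi> (y - x) h)" for h
    by (rule continuous_on_compose2[OF continuous_cauchy_kernel_deriv[OF struct]])
       (use x in \<open>auto intro!: continuous_intros\<close>)
  show "(\<Sum>k\<in>UNIV. cauchy_kernel_deriv \<psi> (y - x) (axis k 1) \<odot> \<psi> k) = 0" if "y \<in> S ` cbox c d" for y
    by (rule cauchy_kernel_right_monogenic[OF struct]) (use that x in auto)
qed

lemma continuous_kernel_form:
  assumes "A \<subseteq> cbox a b" "x \<notin> S ` A"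
  shows "continuous_on A (pulled_form (kernel_at x) i)"
  by (rule continuous_pulled_form[OF assms(1)],
      rule continuous_on_compose2[OF continuous_cauchy_kernel[OF struct]])
     (use assms in \<open>auto intro!: continuous_intros\<close>)

lemma S_notin_image:
  assumes "\<xi>0 \<in> box a b" "A \<subseteq> cbox a b - {\<xi>0}"
  shows "S \<xi>0 \<notin> S ` A"
proof
  assume "S \<xi>0 \<in> S ` A"
  then obtain \<xi> where "\<xi> \<in> A" "S \<xi>0 = S \<xi>" by auto
  moreover from this have "\<xi>0 = \<xi>"
    using assms box_subset_cbox[of a b] by (blast intro: inj_onD[OF inj_S])
  ultimately show False using assms(2) by auto
qed

text \<open>
The kernel is homogeneous of degree \<open>-2\<close>, so the factor \<open>r\<^sup>2\<close> turns the argument \<open>S (\<xi>0 + r z) - S \<xi>0\<close>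
into a difference quotient.
\<close>

lemma kernel_form_limit:
  assumes \<xi>0: "\<xi>0 \<in> box a b" and r: "\<And>k. r k > 0" "r \<longlonglongrightarrow> 0" and z: "z \<noteq> 0"
  shows "(\<lambda>k. (r k)\<^sup>2 *\<^sub>R pulled_form (kernel_at (S \<xi>0)) i (\<xi>0 + r k *\<^sub>R z))
    \<longlonglongrightarrow> cquat_of (cauchy_kernel \<psi> (S' \<xi>0 z) \<odot> emb \<psi> (\<mu> \<xi>0 *\<^sub>R S' \<xi>0 (axis i 1))) \<odot> N \<xi>0"
proof -
  have \<xi>0V: "\<xi>0 \<in> V" using \<xi>0 cbox_V box_subset_cbox by blast
  have conv: "(\<lambda>k. \<xi>0 + r k *\<^sub>R z) \<longlonglongrightarrow> \<xi>0"
    using tendsto_add[OF tendsto_const tendsto_scaleR[OF r(2) tendsto_const[of z]], of \<xi>0] by simp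
  have lim: "(\<lambda>k. f (\<xi>0 + r k *\<^sub>R z)) \<longlonglongrightarrow> f \<xi>0" if "continuous_on A f" "open A" "\<xi>0 \<in> A"
    for f :: "real^3 \<Rightarrow> 'z::topological_space" and A
    using that conv continuous_on_eq_continuous_at isCont_tendsto_compose by blast
  have q: "(\<lambda>k. (S (\<xi>0 + r k *\<^sub>R z) - S \<xi>0) /\<^sub>R r k) \<longlonglongrightarrow> S' \<xi>0 z"
    by (rule directional_derivative_sequentially[OF deriv[OF \<xi>0V] r])
  have "norm (S' \<xi>0 z) \<noteq> 0" using norm_deriv[OF \<xi>0V, of z] mu_pos[OF \<xi>0V] z by simp
  then have nz: "S' \<xi>0 z \<noteq> 0" by simp
  have "isCont (cauchy_kernel \<psi>) (S' \<xi>0 z)"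
    using has_derivative_continuous[OF has_derivative_cauchy_kernel[OF struct nz]] .
  from isCont_tendsto_compose[OF this q]
  have 1: "(\<lambda>k. cauchy_kernel \<psi> ((S (\<xi>0 + r k *\<^sub>R z) - S \<xi>0) /\<^sub>R r k)) \<longlonglongrightarrow> cauchy_kernel \<psi> (S' \<xi>0 z)" .
  have 2: "(\<lambda>k. emb \<psi> (\<mu> (\<xi>0 + r k *\<^sub>R z) *\<^sub>R S' (\<xi>0 + r k *\<^sub>R z) (axis i 1)))
      \<longlonglongrightarrow> emb \<psi> (\<mu> \<xi>0 *\<^sub>R S' \<xi>0 (axis i 1))"
    by (intro bounded_linear.tendsto[OF bounded_linear_emb] tendsto_scaleR
        lim[OF cont_mu open_V \<xi>0V] lim[OF cont_deriv open_V \<xi>0V])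
  have "continuous_on (box a b) N" using cont_N box_subset_cbox continuous_on_subset by blast
  note 3 = lim[OF this open_box \<xi>0]
  have "(\<lambda>k. cquat_of (cauchy_kernel \<psi> ((S (\<xi>0 + r k *\<^sub>R z) - S \<xi>0) /\<^sub>R r k)
       \<odot> emb \<psi> (\<mu> (\<xi>0 + r k *\<^sub>R z) *\<^sub>R S' (\<xi>0 + r k *\<^sub>R z) (axis i 1))) \<odot> N (\<xi>0 + r k *\<^sub>R z))
     \<longlonglongrightarrow> cquat_of (cauchy_kernel \<psi> (S' \<xi>0 z) \<odot> emb \<psi> (\<mu> \<xi>0 *\<^sub>R S' \<xi>0 (axis i 1))) \<odot> N \<xi>0"
    by (intro qmult_complex.tendsto bounded_linear.tendsto[OF bounded_linear_cquat_of] qmult_real.tendsto 1 2 3)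
  then show ?thesis
    by (simp add: pulled_form_def cauchy_kernel_scale[OF struct r(1)] qmult_real.scaleR_left
        cquat_of_linear qmult_complex.scaleR_left)
qed

text \<open>
Near \<open>\<xi>0\<close> the map \<open>S\<close> multiplies the distance to \<open>\<xi>0\<close> at least by \<open>\<mu> \<xi>0 / 2\<close>, so the kernel is
\<open>O(|h|\<^sup>-\<^sup>2)\<close>.  This dominates the scaled integrands in the next limit.
\<close>

lemma kernel_form_bound:
  assumes \<xi>0: "\<xi>0 \<in> box a b"
  obtains \<delta> C where "\<delta> > 0"
    "\<And>h. h \<noteq> 0 \<Longrightarrow> norm h < \<delta> \<Longrightarrow> norm (pulled_form (kernel_at (S \<xi>0)) i (\<xi>0 + h)) * (norm h)\<^sup>2 \<le> C"
proof -
  have \<xi>0V: "\<xi>0 \<in> V" using \<xi>0 cbox_V box_subset_cbox by blast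
  note pos = mu_pos[OF \<xi>0V]
  have near: "\<exists>\<delta>>0. \<forall>h. norm h < \<delta> \<longrightarrow> \<xi>0 + h \<in> A \<and> norm (f (\<xi>0 + h)) \<le> norm (f \<xi>0) + 1"
    if "continuous_on A f" "open A" "\<xi>0 \<in> A" for f :: "real^3 \<Rightarrow> 'z::real_normed_vector" and A
  proof -
    have "isCont f \<xi>0" using that continuous_on_eq_continuous_at by blast
    then have "\<exists>d>0. \<forall>y. dist y \<xi>0 < d \<longrightarrow> dist (f y) (f \<xi>0) < 1"
      unfolding continuous_at_eps_delta by (auto dest: spec[of _ "1::real"])
    then obtain d1 where d1: "d1 > 0" "\<And>y. dist y \<xi>0 < d1 \<Longrightarrow> dist (f y) (f \<xi>0) < 1"
      by auto
    have "\<exists>d>0. ball \<xi>0 d \<subseteq> A" using that(2,3) open_contains_ball by blast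
    then obtain d2 where d2: "d2 > 0" "ball \<xi>0 d2 \<subseteq> A" by blast
    have "\<xi>0 + h \<in> A \<and> norm (f (\<xi>0 + h)) \<le> norm (f \<xi>0) + 1" if "norm h < min d1 d2" for h
    proof -
      have "\<xi>0 + h \<in> ball \<xi>0 d2" using that by (simp add: dist_norm)
      moreover have "norm (f (\<xi>0 + h) - f \<xi>0) < 1" using d1(2)[of "\<xi>0 + h"] that by (simp add: dist_norm)
      ultimately show ?thesis using d2 norm_triangle_sub[of "f (\<xi>0 + h)" "f \<xi>0"] by auto
    qed
    then show ?thesis using d1(1) d2(1) by (intro exI[of _ "min d1 d2"]) auto
  qed
  have "continuous_on (box a b) N" using cont_N box_subset_cbox continuous_on_subset by blast
  from near[OF this open_box \<xi>0] obtain dN where dN: "dN > 0"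
    "\<And>h. norm h < dN \<Longrightarrow> norm (N (\<xi>0 + h)) \<le> norm (N \<xi>0) + 1" by blast
  from near[OF cont_mu open_V \<xi>0V] obtain dm where dm: "dm > 0"
    "\<And>h. norm h < dm \<Longrightarrow> \<xi>0 + h \<in> V \<and> norm (\<mu> (\<xi>0 + h)) \<le> norm (\<mu> \<xi>0) + 1" by blast
  have "\<mu> \<xi>0 / 2 > 0" using pos by simp
  with deriv[OF \<xi>0V, unfolded has_derivative_at_alt] obtain dS where dS: "dS > 0"
    "\<And>y. norm (y - \<xi>0) < dS \<Longrightarrow> norm (S y - S \<xi>0 - S' \<xi>0 (y - \<xi>0)) \<le> \<mu> \<xi>0 / 2 * norm (y - \<xi>0)" by blast
  obtain B where B: "\<And>u v :: cquat. norm (u \<odot> v) \<le> norm u * norm v * B" "B > 0"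
    using qmult_complex.pos_bounded by blast
  obtain B' where B': "\<And>u. norm (cquat_of u) \<le> norm u * B'" "B' > 0"
    using bounded_linear.pos_bounded[OF bounded_linear_cquat_of] by blast
  define C where "C = inverse (4 * pi) * inverse ((\<mu> \<xi>0 / 2)\<^sup>2) * (\<mu> \<xi>0 + 1)\<^sup>2 * B' * (norm (N \<xi>0) + 1) * B"
  have "norm (pulled_form (kernel_at (S \<xi>0)) i (\<xi>0 + h)) * (norm h)\<^sup>2 \<le> C"
    if h: "h \<noteq> 0" "norm h < min dN (min dm dS)" for h
  proof -
    have hV: "\<xi>0 + h \<in> V" and mu: "\<mu> (\<xi>0 + h) \<le> \<mu> \<xi>0 + 1" using dm(2)[of h] h pos by auto
    have "\<mu> \<xi>0 * norm h = norm (S' \<xi>0 h)" by (simp add: norm_deriv[OF \<xi>0V])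
    also have "\<dots> \<le> norm (S (\<xi>0 + h) - S \<xi>0) + norm (S (\<xi>0 + h) - S \<xi>0 - S' \<xi>0 h)"
      by (metis norm_minus_commute norm_triangle_sub add.commute)
    also have "norm (S (\<xi>0 + h) - S \<xi>0 - S' \<xi>0 h) \<le> \<mu> \<xi>0 / 2 * norm h" using dS(2)[of "\<xi>0 + h"] h by simp
    finally have low: "\<mu> \<xi>0 / 2 * norm h \<le> norm (S (\<xi>0 + h) - S \<xi>0)" by simp
    have lowpos: "\<mu> \<xi>0 / 2 * norm h > 0" using pos h by simp
    have k: "norm (cauchy_kernel \<psi> (S (\<xi>0 + h) - S \<xi>0)) * (norm h)\<^sup>2 \<le> inverse (4 * pi) * inverse ((\<mu> \<xi>0 / 2)\<^sup>2)"
    proof -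
      have "inverse (norm (S (\<xi>0 + h) - S \<xi>0)) ^ 2 \<le> inverse (\<mu> \<xi>0 / 2 * norm h) ^ 2"
        using low lowpos by (intro power_mono le_imp_inverse_le) auto
      then have "inverse (norm (S (\<xi>0 + h) - S \<xi>0)) ^ 2 * (norm h)\<^sup>2 \<le> inverse (\<mu> \<xi>0 / 2 * norm h) ^ 2 * (norm h)\<^sup>2"
        by (intro mult_right_mono) auto
      also have "\<dots> = inverse ((\<mu> \<xi>0 / 2)\<^sup>2)" using h pos by (simp add: power_mult_distrib power_inverse field_simps)
      finally show ?thesis
        unfolding norm_cauchy_kernel[OF struct] by (simp add: mult.assoc mult_left_mono)
    qed
    have e: "norm (emb \<psi> (\<mu> (\<xi>0 + h) *\<^sub>R S' (\<xi>0 + h) (axis i 1))) \<le> (\<mu> \<xi>0 + 1)\<^sup>2"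
      using mu mu_pos[OF hV] power_mono[OF mu, of 2]
      by (simp add: norm_emb[OF struct] norm_deriv[OF hV] power2_eq_square)
    have n: "norm (N (\<xi>0 + h)) \<le> norm (N \<xi>0) + 1" using dN(2) h by simp
    let ?k = "cauchy_kernel \<psi> (S (\<xi>0 + h) - S \<xi>0)" and ?e = "emb \<psi> (\<mu> (\<xi>0 + h) *\<^sub>R S' (\<xi>0 + h) (axis i 1))"
    have "norm (pulled_form (kernel_at (S \<xi>0)) i (\<xi>0 + h)) \<le> norm (cquat_of (?k \<odot> ?e)) * norm (N (\<xi>0 + h)) * B"
      unfolding pulled_form_def by (rule B)
    also have "\<dots> \<le> (norm ?k * norm ?e * B') * norm (N (\<xi>0 + h)) * B"
      using B'(1)[of "?k \<odot> ?e"] B(2) by (intro mult_right_mono) (auto simp: norm_qmult)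
    finally have "norm (pulled_form (kernel_at (S \<xi>0)) i (\<xi>0 + h)) * (norm h)\<^sup>2
        \<le> (norm ?k * norm ?e * B') * norm (N (\<xi>0 + h)) * B * (norm h)\<^sup>2"
      by (intro mult_right_mono) auto
    also have "\<dots> = (norm ?k * (norm h)\<^sup>2) * norm ?e * B' * norm (N (\<xi>0 + h)) * B" by (simp add: mult_ac)
    also have "\<dots> \<le> C"
    proof -
      have "u * v * B' * w * B \<le> u' * v' * B' * w' * B"
        if "u \<le> u'" "v \<le> v'" "w \<le> w'" "0 \<le> u" "0 \<le> v" "0 \<le> w" for u v w u' v' w' :: real
        using that B(2) B'(2) by (intro mult_mono mult_nonneg_nonneg) auto
      from this[OF k e n] show ?thesis unfolding C_def by simp
    qed
    finally show ?thesis .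
  qed
  moreover have "min dN (min dm dS) > 0" using dN dm dS by simp
  ultimately show thesis by (intro that) blast+
qed

text \<open>
In the limit \<open>S\<close> becomes its derivative \<open>A\<close> at \<open>\<xi>0\<close>.  The points \<open>\<plusminus>e\<^sub>i + t\<close> of opposite faces have the
same norm, so in the difference of the kernels at their images \<open>A t\<close> cancels and \<open>2 (conj (A e\<^sub>i))\<close>
is left.  Multiplied by \<open>\<mu> A e\<^sub>i\<close> this gives a real number: the density of the solid angle.
\<close>

lemma small_cube_flux:
  assumes \<xi>0: "\<xi>0 \<in> box a b"
  obtains r where "\<And>k. r k > 0" "r \<longlonglongrightarrow> 0" "\<And>k. cbox (\<xi>0 - vec (r k)) (\<xi>0 + vec (r k)) \<subseteq> box a b"
    "(\<lambda>k. box_flux (pulled_form (kernel_at (S \<xi>0))) (\<xi>0 - vec (r k)) (\<xi>0 + vec (r k))) \<longlonglongrightarrow> N \<xi>0"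
proof -
  have \<xi>0V: "\<xi>0 \<in> V" using \<xi>0 cbox_V box_subset_cbox by blast
  note pos = mu_pos[OF \<xi>0V]
  let ?W = "pulled_form (kernel_at (S \<xi>0))"
  have "\<forall>i. \<exists>\<delta> C. \<delta> > 0 \<and> (\<forall>h. h \<noteq> 0 \<longrightarrow> norm h < \<delta> \<longrightarrow> norm (?W i (\<xi>0 + h)) * (norm h)\<^sup>2 \<le> C)"
    using kernel_form_bound[OF \<xi>0] by metis
  then obtain \<delta>' C where \<delta>': "\<And>i. \<delta>' i > 0" and C: "\<And>i h. h \<noteq> 0 \<Longrightarrow> norm h < \<delta>' i \<Longrightarrow> norm (?W i (\<xi>0 + h)) * (norm h)\<^sup>2 \<le> C i"
    by metis
  obtain \<rho>0 where \<rho>0: "\<rho>0 > 0" "ball \<xi>0 \<rho>0 \<subseteq> box a b" using \<xi>0 open_box open_contains_ball by blast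
  define \<delta> where "\<delta> = min \<rho>0 (Min (range \<delta>'))"
  have \<delta>: "\<delta> > 0" "\<delta> \<le> \<rho>0" "\<And>i. \<delta> \<le> \<delta>' i" using \<rho>0 \<delta>' by (auto simp: \<delta>_def min_le_iff_disj)
  define r where "r k = (\<delta> / 2) * inverse (real (Suc k))" for k
  have r: "r k > 0" "r k \<le> \<delta> / 2" for k using \<delta>(1) by (auto simp: r_def field_simps)
  have r0: "r \<longlonglongrightarrow> 0"
    unfolding r_def using tendsto_mult_right_zero[OF LIMSEQ_inverse_real_of_nat] by simp
  have zbound: "norm (face_point i t w) < 2" "norm (face_point i t w) \<ge> 1" "face_point i t w \<noteq> 0"
    if "w \<in> cbox (-1, -1) (1, 1)" "t = 1 \<or> t = -1" for i t w
  proof -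
    have "\<bar>fst w\<bar> \<le> 1" "\<bar>snd w\<bar> \<le> 1" using that(1) by (cases w; auto simp: cbox_Pair_eq)+
    then have "(fst w)\<^sup>2 \<le> 1" "(snd w)\<^sup>2 \<le> 1" by (simp_all add: abs_square_le_1)
    then have "1 + (fst w)\<^sup>2 + (snd w)\<^sup>2 < 4" by simp
    then have "sqrt (1 + (fst w)\<^sup>2 + (snd w)\<^sup>2) < sqrt 4" by (rule real_sqrt_less_mono)
    then show "norm (face_point i t w) < 2" using that(2) by (auto simp: norm_face_point)
    show 1: "norm (face_point i t w) \<ge> 1" using that(2) by (auto simp: norm_face_point)
    then show "face_point i t w \<noteq> 0" by auto
  qed
  have sub: "cbox (\<xi>0 - vec (r k)) (\<xi>0 + vec (r k)) \<subseteq> box a b" for k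
  proof
    fix x assume x: "x \<in> cbox (\<xi>0 - vec (r k)) (\<xi>0 + vec (r k))"
    then have *: "\<bar>(x - \<xi>0) $ i\<bar> \<le> r k" for i by (auto simp: mem_box_cart abs_le_iff algebra_simps)
    have sq: "((x - \<xi>0) $ i)\<^sup>2 \<le> (r k)\<^sup>2" for i using power_mono[OF *[of i], of 2] by simp
    have "(norm (x - \<xi>0))\<^sup>2 \<le> 3 * (r k)\<^sup>2"
      unfolding power2_norm_eq_inner inner_real3 power2_eq_square[symmetric]
      using sq[of 0] sq[of 1] sq[of 2] by linarith
    also have "\<dots> < (2 * r k)\<^sup>2" using r(1)[of k] by (simp add: power_mult_distrib)
    finally have "norm (x - \<xi>0) < 2 * r k" using r(1)[of k] power_less_imp_less_base by fastforce
    then have "x \<in> ball \<xi>0 \<rho>0" using r(2)[of k] \<delta> by (simp add: dist_norm norm_minus_commute)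
    then show "x \<in> box a b" using \<rho>0 by blast
  qed
  have contW: "continuous_on (cbox (\<xi>0 - vec (r k)) (\<xi>0 + vec (r k)) - {\<xi>0}) (?W i)" for i k
  proof (rule continuous_kernel_form)
    show "cbox (\<xi>0 - vec (r k)) (\<xi>0 + vec (r k)) - {\<xi>0} \<subseteq> cbox a b"
      using sub[of k] box_subset_cbox[of a b] by blast
    show "S \<xi>0 \<notin> S ` (cbox (\<xi>0 - vec (r k)) (\<xi>0 + vec (r k)) - {\<xi>0})"
      by (rule S_notin_image[OF \<xi>0]) (use sub[of k] box_subset_cbox[of a b] in blast)
  qed
  define f where "f i k w = (r k)\<^sup>2 *\<^sub>R (?W i (\<xi>0 + r k *\<^sub>R face_point i 1 w) - ?W i (\<xi>0 + r k *\<^sub>R face_point i (-1) w))" for i k w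
  define g where "g w = (inverse (2 * pi) * inverse (sqrt (1 + (fst w)\<^sup>2 + (snd w)\<^sup>2)) ^ 3) *\<^sub>R N \<xi>0" for w :: "real \<times> real"
  have flux: "box_flux ?W (\<xi>0 - vec (r k)) (\<xi>0 + vec (r k)) = (\<Sum>i\<in>UNIV. integral (cbox (-1, -1) (1, 1)) (f i k))" for k
    unfolding f_def[abs_def] by (rule box_flux_cube(1)[OF r(1) contW])
  have int: "f i k integrable_on cbox (-1, -1) (1, 1)" for i k
    unfolding f_def[abs_def] by (rule box_flux_cube(2)[OF r(1) contW])
  have bound: "norm (f i k w) \<le> 2 * C i" if w: "w \<in> cbox (-1, -1) (1, 1)" for i k w
  proof -
    have 1: "(r k)\<^sup>2 * norm (?W i (\<xi>0 + r k *\<^sub>R face_point i t w)) \<le> C i" if t: "t = 1 \<or> t = -1" for t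
    proof -
      note z = zbound[OF w t, of i]
      have "norm (r k *\<^sub>R face_point i t w) < \<delta>' i"
      proof -
        have "norm (r k *\<^sub>R face_point i t w) = r k * norm (face_point i t w)" using r(1)[of k] by simp
        also have "\<dots> < r k * 2" by (rule mult_strict_left_mono[OF z(1) r(1)])
        also have "\<dots> \<le> \<delta>' i" using r(2)[of k] \<delta>(3)[of i] by linarith
        finally show ?thesis .
      qed
      from C[OF _ this] have "norm (?W i (\<xi>0 + r k *\<^sub>R face_point i t w)) * (norm (r k *\<^sub>R face_point i t w))\<^sup>2 \<le> C i"
        using z(3) r(1)[of k] by simp
      moreover have "(r k)\<^sup>2 \<le> (norm (r k *\<^sub>R face_point i t w))\<^sup>2"
        using z(2) r(1)[of k] by (intro power_mono) auto
      then have "(r k)\<^sup>2 * norm (?W i (\<xi>0 + r k *\<^sub>R face_point i t w))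
          \<le> norm (?W i (\<xi>0 + r k *\<^sub>R face_point i t w)) * (norm (r k *\<^sub>R face_point i t w))\<^sup>2"
        by (subst mult.commute) (rule mult_left_mono, auto)
      ultimately show ?thesis by (rule order_trans[rotated])
    qed
    have "norm (f i k w) \<le> (r k)\<^sup>2 * (norm (?W i (\<xi>0 + r k *\<^sub>R face_point i 1 w)) + norm (?W i (\<xi>0 + r k *\<^sub>R face_point i (-1) w)))"
      unfolding f_def norm_scaleR by (auto intro!: mult_left_mono norm_triangle_ineq4)
    also have "\<dots> \<le> 2 * C i" using 1[of 1] 1[of "-1"] by (simp add: distrib_left)
    finally show ?thesis .
  qed
  have lim: "(\<lambda>k. f i k w) \<longlonglongrightarrow> g w" if w: "w \<in> cbox (-1, -1) (1, 1)" for i w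
  proof -
    let ?z = "\<lambda>t. face_point i t w" and ?e = "emb \<psi> (S' \<xi>0 (axis i 1))"
    let ?L = "\<lambda>t. cquat_of (cauchy_kernel \<psi> (S' \<xi>0 (?z t)) \<odot> emb \<psi> (\<mu> \<xi>0 *\<^sub>R S' \<xi>0 (axis i 1))) \<odot> N \<xi>0"
    define s where "s = sqrt (1 + (fst w)\<^sup>2 + (snd w)\<^sup>2)"
    have s: "s > 0" by (simp add: s_def add_pos_nonneg)
    have "(\<lambda>k. f i k w) \<longlonglongrightarrow> ?L 1 - ?L (-1)"
      unfolding f_def scaleR_diff_right
      by (intro tendsto_diff kernel_form_limit \<xi>0 r r0 zbound(3)[OF w]) auto
    moreover have "?L 1 - ?L (-1) = g w"
    proof -
      have n: "norm (S' \<xi>0 (?z 1)) = \<mu> \<xi>0 * s" "norm (S' \<xi>0 (?z (-1))) = \<mu> \<xi>0 * s"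
        by (simp_all add: norm_deriv[OF \<xi>0V] norm_face_point s_def)
      have "?z 1 - ?z (-1) = 2 *\<^sub>R axis i 1" by (simp add: face_point_eq vec_eq_iff)
      then have d: "S' \<xi>0 (?z 1) - S' \<xi>0 (?z (-1)) = 2 *\<^sub>R S' \<xi>0 (axis i 1)"
        by (metis linear_deriv[OF \<xi>0V] linear_diff linear_scale)
      have "cauchy_kernel \<psi> (S' \<xi>0 (?z 1)) - cauchy_kernel \<psi> (S' \<xi>0 (?z (-1)))
         = (inverse (4 * pi) * inverse (\<mu> \<xi>0 * s) ^ 3) *\<^sub>R qcnj (emb \<psi> (S' \<xi>0 (?z 1) - S' \<xi>0 (?z (-1))))"
        unfolding cauchy_kernel_eq[OF struct] n by (simp add: emb_linear qcnj_linear scaleR_diff_right)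
      also have "\<dots> = (inverse (2 * pi) * inverse (\<mu> \<xi>0 * s) ^ 3) *\<^sub>R qcnj ?e"
        unfolding d by (simp add: emb_linear qcnj_linear)
      finally have "(cauchy_kernel \<psi> (S' \<xi>0 (?z 1)) - cauchy_kernel \<psi> (S' \<xi>0 (?z (-1)))) \<odot> emb \<psi> (\<mu> \<xi>0 *\<^sub>R S' \<xi>0 (axis i 1))
          = (inverse (2 * pi) * inverse (\<mu> \<xi>0 * s) ^ 3 * \<mu> \<xi>0 * (\<mu> \<xi>0)\<^sup>2) *\<^sub>R qone"
        by (simp add: emb_linear qmult_real.scaleR_left qmult_real.scaleR_right qcnj_qmult_self
            norm_emb[OF struct] norm_deriv[OF \<xi>0V] mult_ac)
      also have "inverse (2 * pi) * inverse (\<mu> \<xi>0 * s) ^ 3 * \<mu> \<xi>0 * (\<mu> \<xi>0)\<^sup>2 = inverse (2 * pi) * inverse s ^ 3"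
        using pos s by (simp add: field_simps eval_nat_numeral)
      finally have "cquat_of ((inverse (2 * pi) * inverse s ^ 3) *\<^sub>R qone) =
          cquat_of ((cauchy_kernel \<psi> (S' \<xi>0 (?z 1)) - cauchy_kernel \<psi> (S' \<xi>0 (?z (-1)))) \<odot> emb \<psi> (\<mu> \<xi>0 *\<^sub>R S' \<xi>0 (axis i 1)))"
        by (rule arg_cong[OF sym])
      then have "cquat_of ((inverse (2 * pi) * inverse s ^ 3) *\<^sub>R qone) \<odot> N \<xi>0 = ?L 1 - ?L (-1)"
        by (simp only: qmult_real.diff_left cquat_of_linear qmult_complex.diff_left)
      moreover have "cquat_of ((inverse (2 * pi) * inverse s ^ 3) *\<^sub>R qone) \<odot> N \<xi>0 = g w"
        by (simp add: g_def s_def cquat_of_linear qmult_complex.scaleR_left del: inverse_mult_distrib)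
      ultimately show ?thesis by simp
    qed
    ultimately show ?thesis by simp
  qed
  have "(\<lambda>k. integral (cbox (-1, -1) (1, 1)) (f i k)) \<longlonglongrightarrow> integral (cbox (-1, -1) (1, 1)) g" for i
    by (rule dominated_convergence(2)[OF int _ bound lim]) auto
  then have "(\<lambda>k. \<Sum>i\<in>(UNIV::3 set). integral (cbox (-1, -1) (1, 1)) (f i k))
      \<longlonglongrightarrow> (\<Sum>i\<in>(UNIV::3 set). integral (cbox (-1, -1) (1, 1)) g)"
    by (intro tendsto_sum)
  moreover have "(\<Sum>i\<in>(UNIV::3 set). integral (cbox (-1, -1) (1, 1)) g) = N \<xi>0"
  proof -
    have "(\<lambda>w. inverse (sqrt (1 + (fst w)\<^sup>2 + (snd w)\<^sup>2)) ^ 3) integrable_on cbox (-1, -1) (1::real, 1::real)"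
    proof (rule integrable_continuous)
      have "1 + (fst w)\<^sup>2 + (snd w)\<^sup>2 > 0" for w :: "real \<times> real"
        by (simp add: add_pos_nonneg)
      then have "1 + (fst w)\<^sup>2 + (snd w)\<^sup>2 \<noteq> 0" for w :: "real \<times> real"
        by (metis less_irrefl)
      then show "continuous_on (cbox (-1, -1) (1::real, 1::real)) (\<lambda>w. inverse (sqrt (1 + (fst w)\<^sup>2 + (snd w)\<^sup>2)) ^ 3)"
        by (intro continuous_intros) auto
    qed
    from has_integral_scaleR_left[OF has_integral_mult_right[OF integrable_integral[OF this]], of "inverse (2 * pi)" "N \<xi>0"]
    have "integral (cbox (-1, -1) (1, 1)) g = (inverse (2 * pi) * (2 * pi / 3)) *\<^sub>R N \<xi>0"
      unfolding integral_solid_angle_face g_def[symmetric] by (rule integral_unique)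
    then show ?thesis by simp
  qed
  ultimately have "(\<lambda>k. box_flux ?W (\<xi>0 - vec (r k)) (\<xi>0 + vec (r k))) \<longlonglongrightarrow> N \<xi>0"
    unfolding flux by simp
  from that[of r, OF r(1) r0 sub this] show thesis .
qed

theorem cauchy_formula:
  assumes \<xi>0: "\<xi>0 \<in> box a b"
  shows "box_flux (pulled_form (kernel_at (S \<xi>0))) a b = N \<xi>0"
proof -
  let ?W = "pulled_form (kernel_at (S \<xi>0))"
  obtain r where r: "\<And>k. r k > 0" "\<And>k. cbox (\<xi>0 - vec (r k)) (\<xi>0 + vec (r k)) \<subseteq> box a b"
    and lim: "(\<lambda>k. box_flux ?W (\<xi>0 - vec (r k)) (\<xi>0 + vec (r k))) \<longlonglongrightarrow> N \<xi>0"
    by (rule small_cube_flux[OF \<xi>0]) (rule that)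
  note notin = S_notin_image[OF \<xi>0]
  have eq: "box_flux ?W a b = box_flux ?W (\<xi>0 - vec (r k)) (\<xi>0 + vec (r k))" for k
  proof (rule box_flux_shrink)
    show "continuous_on (cbox a b - {\<xi>0}) (?W j)" for j
      by (rule continuous_kernel_form[OF _ notin]) auto
    show "box_flux ?W c' d' = 0" if "cbox c' d' \<subseteq> cbox a b - {\<xi>0}" "\<And>k. c'$k \<le> d'$k" for c' d'
      by (rule kernel_flux_zero[OF _ that(2) notin]) (use that(1) in auto)
    have "\<forall>i. (\<xi>0 - vec (r k))$i \<le> (\<xi>0 + vec (r k))$i" using r(1)[of k] by simp
    with r(2)[of k] have *: "a$i < (\<xi>0 - vec (r k))$i \<and> (\<xi>0 + vec (r k))$i < b$i" for i
      unfolding subset_interval_cart(2) by blast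
    show "a$i \<le> (\<xi>0 - vec (r k))$i" "(\<xi>0 - vec (r k))$i < \<xi>0$i" "\<xi>0$i < (\<xi>0 + vec (r k))$i"
      "(\<xi>0 + vec (r k))$i \<le> b$i" for i
      using *[of i] r(1)[of k] by auto
  qed
  have "(\<lambda>k::nat. box_flux ?W a b) \<longlonglongrightarrow> N \<xi>0" using lim unfolding eq[symmetric] .
  then show ?thesis by (simp add: LIMSEQ_const_iff)
qed

end

section \<open>Abel's integral equation\<close>

text \<open>
The power \<open>x\<^bsup>\<beta>-1\<^esup>\<close>, extended by zero, so that integrals over \<open>(0, w)\<close> become convolutions over the
real line and Fubini's theorem applies without case distinctions.
\<close>

definition abel_kernel :: "complex \<Rightarrow> real \<Rightarrow> complex" where
  "abel_kernel \<beta> x = (if x > 0 then exp ((\<beta> - 1) * of_real (ln x)) else 0)"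

lemma abel_kernel_powr: "x > 0 \<Longrightarrow> abel_kernel \<beta> x = of_real x powr (\<beta> - 1)"
  by (simp add: abel_kernel_def powr_def Ln_of_real)

lemma abel_kernel_nonpos [simp]: "x \<le> 0 \<Longrightarrow> abel_kernel \<beta> x = 0"
  by (simp add: abel_kernel_def)

lemma norm_abel_kernel: "norm (abel_kernel \<beta> x) = (if x > 0 then x powr (Re \<beta> - 1) else 0)"
  by (simp add: abel_kernel_def powr_def)

lemma measurable_abel_kernel [measurable]: "abel_kernel \<beta> \<in> borel_measurable borel"
  unfolding abel_kernel_def by measurable

lemma abel_kernel_mult: "c > 0 \<Longrightarrow> abel_kernel \<beta> (c * x) = abel_kernel \<beta> c * abel_kernel \<beta> x"
  by (auto simp: abel_kernel_def zero_less_mult_iff ln_mult distrib_left exp_add)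

lemma abel_kernel_dual: "c > 0 \<Longrightarrow> of_real c * (abel_kernel \<alpha> c * abel_kernel (1 - \<alpha>) c) = 1"
proof -
  assume c: "c > 0"
  have "of_real c = exp (complex_of_real (ln c))" using c by (simp add: exp_of_real)
  then show ?thesis
    using c by (simp add: abel_kernel_def flip: exp_add) (simp add: algebra_simps)
qed

lemma continuous_abel_kernel: "continuous_on {0<..} (abel_kernel \<beta>)"
proof -
  have "continuous_on {0<..} (\<lambda>x. exp ((\<beta> - 1) * complex_of_real (ln x)))"
    by (intro continuous_intros) auto
  then show ?thesis by (rule continuous_on_eq) (auto simp: abel_kernel_def)
qed

lemma set_integrable_lebesgue_lborel:
  fixes f :: "real \<Rightarrow> 'b::euclidean_space"
  assumes "set_borel_measurable borel S f"
  shows "set_integrable lborel S f \<longleftrightarrow> f absolutely_integrable_on S"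
  using integrable_completion[of "\<lambda>x. indicator S x *\<^sub>R f x" lborel] assms
  by (simp add: set_integrable_def set_borel_measurable_def)

lemma gamma_density:
  assumes "Re \<beta> > 0"
  shows "integrable lborel (\<lambda>x. abel_kernel \<beta> x * of_real (exp (- x)))"
    "(\<integral>x. abel_kernel \<beta> x * of_real (exp (- x)) \<partial>lborel) = Gamma \<beta>"
proof -
  let ?g = "\<lambda>x. abel_kernel \<beta> x * of_real (exp (- x))"
  let ?f = "\<lambda>t. complex_of_real t powr (\<beta> - 1) / of_real (exp t)"
  have eq: "indicator {0<..} x *\<^sub>R ?f x = ?g x" for x
    by (auto simp: abel_kernel_powr indicator_def exp_minus divide_inverse)
  have m: "set_borel_measurable borel {0<..} ?f"
    unfolding set_borel_measurable_def eq by measurable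
  have s: "set_integrable lborel {0<..} ?f"
    using absolutely_integrable_Gamma_integral'[OF assms] set_integrable_lebesgue_lborel[OF m] by simp
  then show "integrable lborel ?g" unfolding set_integrable_def eq .
  have "(\<integral>x. ?g x \<partial>lborel) = (LINT x:{0<..}|lborel. ?f x)"
    unfolding set_lebesgue_integral_def eq ..
  also have "\<dots> = integral {0<..} ?f" by (rule set_borel_integral_eq_integral(2)[OF s])
  also have "\<dots> = Gamma \<beta>" using Gamma_integral_complex'[OF assms] by (rule integral_unique)
  finally show "(\<integral>x. ?g x \<partial>lborel) = Gamma \<beta>" .
qed

text \<open>
Up to a constant the kernel is dominated by the integrand of Euler's integral for \<open>Gamma\<close>.
\<close>

lemma integrable_abel_kernel_bounded:
  assumes "Re \<beta> > 0"
  shows "integrable lborel (\<lambda>x. indicator {..<M} x *\<^sub>R abel_kernel \<beta> x)"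
proof (rule Bochner_Integration.integrable_bound)
  show "integrable lborel (\<lambda>x. exp M *\<^sub>R (abel_kernel \<beta> x * of_real (exp (- x))))"
    using gamma_density(1)[OF assms] by simp
  have "norm (abel_kernel \<beta> x) \<le> exp M * (norm (abel_kernel \<beta> x) * exp (- x))" if "x < M" for x
  proof -
    have "1 \<le> exp M * exp (- x)" using that by (simp flip: exp_add)
    then have "norm (abel_kernel \<beta> x) * 1 \<le> norm (abel_kernel \<beta> x) * (exp M * exp (- x))"
      by (intro mult_left_mono) auto
    then show ?thesis by (simp add: mult_ac)
  qed
  then show "AE x in lborel. norm (indicator {..<M} x *\<^sub>R abel_kernel \<beta> x)
      \<le> norm (exp M *\<^sub>R (abel_kernel \<beta> x * of_real (exp (- x))))"
    by (auto simp: indicator_def norm_mult)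
qed measurable

context
  fixes \<alpha> :: complex
  assumes \<alpha>: "0 < Re \<alpha>" "Re \<alpha> < 1"
begin

abbreviation "beta_density \<equiv> \<lambda>v w s. abel_kernel \<alpha> (w - s) * abel_kernel (1 - \<alpha>) (s - v)"

lemma beta_density_scale:
  assumes "v < w"
  shows "beta_density v w (v + (w - v) * x) = abel_kernel \<alpha> (w - v) * abel_kernel (1 - \<alpha>) (w - v) * beta_density 0 1 x"
proof -
  have "w - (v + (w - v) * x) = (w - v) * (1 - x)" "v + (w - v) * x - v = (w - v) * (x - 0)"
    by (simp_all add: algebra_simps)
  then show ?thesis using assms by (simp only: abel_kernel_mult) (simp add: abel_kernel_mult)
qed

lemma beta_density_outside: "\<not> v < w \<Longrightarrow> beta_density v w s = 0"
  by (cases "s \<le> v") auto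

text \<open>
The absolute value is the integrand of the real Beta integral, after an affine substitution.
\<close>

lemma integrable_beta_density:
  shows "integrable lborel (beta_density v w)"
proof (cases "v < w")
  case True
  have n: "norm (beta_density 0 1 x) = indicator {0..1} x *\<^sub>R (x powr ((1 - Re \<alpha>) - 1) * (1 - x) powr (Re \<alpha> - 1))" for x
    by (auto simp: norm_mult norm_abel_kernel indicator_def)
  have "(\<lambda>x. x powr ((1 - Re \<alpha>) - 1) * (1 - x) powr (Re \<alpha> - 1)) absolutely_integrable_on {0..1}"
    using has_integral_Beta_real[of "1 - Re \<alpha>" "Re \<alpha>"] \<alpha>
    by (intro nonnegative_absolutely_integrable_1) (auto simp: integrable_on_def)
  then have "integrable lborel (\<lambda>x. norm (beta_density 0 1 x))"
    using set_integrable_lebesgue_lborel[of "{0..1}" "\<lambda>x. x powr ((1 - Re \<alpha>) - 1) * (1 - x) powr (Re \<alpha> - 1)"]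
    unfolding set_integrable_def set_borel_measurable_def n[symmetric] by simp
  then have 1: "integrable lborel (beta_density 0 1)"
    by (rule Bochner_Integration.integrable_bound) auto
  have "integrable lborel (\<lambda>x. beta_density v w (v + (w - v) * x))"
    unfolding beta_density_scale[OF True] by (intro integrable_mult_right 1)
  then show ?thesis using True by (subst (asm) lborel_integrable_real_affine_iff) auto
next
  case False
  then have "beta_density v w = (\<lambda>_. 0)"
    by (intro ext) (rule beta_density_outside)
  then show ?thesis by (simp only:) simp
qed

lemma integral_beta_density_eq:
  assumes "v < w"
  shows "(\<integral>s. beta_density v w s \<partial>lborel) = (\<integral>s. beta_density 0 1 s \<partial>lborel)"
proof -
  have "(\<integral>s. beta_density v w s \<partial>lborel) = \<bar>w - v\<bar> *\<^sub>R (\<integral>x. beta_density v w (v + (w - v) * x) \<partial>lborel)"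
    using assms by (intro lborel_integral_real_affine) auto
  also have "\<dots> = of_real (w - v) * (abel_kernel \<alpha> (w - v) * abel_kernel (1 - \<alpha>) (w - v)) * (\<integral>s. beta_density 0 1 s \<partial>lborel)"
    unfolding beta_density_scale[OF assms] integral_mult_right_zero
    using assms by (simp add: scaleR_conv_of_real)
  finally show ?thesis using assms by (simp only: abel_kernel_dual) simp
qed

lemma integral_norm_beta_density_eq:
  assumes "v < w"
  shows "(\<integral>s. norm (beta_density v w s) \<partial>lborel) = (\<integral>s. norm (beta_density 0 1 s) \<partial>lborel)"
proof -
  have "(\<integral>s. norm (beta_density v w s) \<partial>lborel) = \<bar>w - v\<bar> *\<^sub>R (\<integral>x. norm (beta_density v w (v + (w - v) * x)) \<partial>lborel)"
    using assms by (intro lborel_integral_real_affine) auto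
  also have "\<dots> = norm (of_real (w - v) * (abel_kernel \<alpha> (w - v) * abel_kernel (1 - \<alpha>) (w - v))) * (\<integral>s. norm (beta_density 0 1 s) \<partial>lborel)"
    unfolding beta_density_scale[OF assms] norm_mult[of "abel_kernel \<alpha> (w - v) * abel_kernel (1 - \<alpha>) (w - v)"]
      integral_mult_right_zero
    using assms by (simp add: norm_mult del: of_real_diff)
  finally show ?thesis using assms by (simp only: abel_kernel_dual) simp
qed

text \<open>
The value is the Beta function at \<open>(\<alpha>, 1 - \<alpha>)\<close> for complex \<open>\<alpha>\<close>.  The convolution of the two Gamma
densities is \<open>e\<^sup>-\<^sup>t\<close> times the Beta integral over \<open>(0, t)\<close>, which is independent of \<open>t\<close>; on the
other hand its integral is the product of the integrals of the densities.
\<close>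

lemma integral_beta_density_unit: "(\<integral>s. beta_density 0 1 s \<partial>lborel) = Gamma \<alpha> * Gamma (1 - \<alpha>)"
proof -
  define b where "b = (\<integral>s. beta_density 0 1 s \<partial>lborel)"
  define g where "g \<beta> x = abel_kernel \<beta> x * complex_of_real (exp (- x))" for \<beta> x
  have g_meas [measurable]: "g \<beta> \<in> borel_measurable borel" for \<beta> unfolding g_def by measurable
  have g: "integrable lborel (g \<beta>)" "integral\<^sup>L lborel (g \<beta>) = Gamma \<beta>" if "Re \<beta> > 0" for \<beta>
    using gamma_density[OF that] by (simp_all add: g_def[abs_def])
  have shift: "integrable lborel (\<lambda>t. g \<alpha> (t - s))" "(\<integral>t. g \<alpha> (t - s) \<partial>lborel) = Gamma \<alpha>"
    "(\<integral>t. norm (g \<alpha> (t - s)) \<partial>lborel) = (\<integral>t. norm (g \<alpha> t) \<partial>lborel)" for s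
    using lborel_integrable_real_affine[OF g(1)[OF \<alpha>(1)], of 1 "- s"] g(2)[OF \<alpha>(1)]
      lborel_integral_real_affine[of 1 "g \<alpha>" "- s"] lborel_integral_real_affine[of 1 "\<lambda>t. norm (g \<alpha> t)" "- s"]
    by simp_all
  have r: "Re (1 - \<alpha>) > 0" using \<alpha> by simp
  let ?H = "\<lambda>s t. g \<alpha> (t - s) * g (1 - \<alpha>) s"
  have "integrable (lborel \<Otimes>\<^sub>M lborel) (\<lambda>(s, t). ?H s t)"
  proof (rule lborel_pair.Fubini_integrable)
    show "integrable lborel (\<lambda>s. \<integral>t. norm (case (s, t) of (s, t) \<Rightarrow> ?H s t) \<partial>lborel)"
      using g(1)[OF r] by (simp add: norm_mult shift(3))
    show "AE s in lborel. integrable lborel (\<lambda>t. case (s, t) of (s, t) \<Rightarrow> ?H s t)"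
      using shift(1) by simp
  qed measurable
  from lborel_pair.Fubini_integral[OF this]
  have "(\<integral>t. (\<integral>s. ?H s t \<partial>lborel) \<partial>lborel) = (\<integral>s. (\<integral>t. ?H s t \<partial>lborel) \<partial>lborel)" .
  also have "\<dots> = Gamma \<alpha> * Gamma (1 - \<alpha>)" by (simp add: shift(2) g(2)[OF r])
  finally have total: "(\<integral>t. (\<integral>s. ?H s t \<partial>lborel) \<partial>lborel) = Gamma \<alpha> * Gamma (1 - \<alpha>)" .
  have inner: "(\<integral>s. ?H s t \<partial>lborel) = b * g 1 t" for t
  proof -
    have "?H s t = beta_density 0 t s * of_real (exp (- t))" for s
      by (simp add: g_def flip: exp_of_real exp_add)
    then have eq: "(\<integral>s. ?H s t \<partial>lborel) = (\<integral>s. beta_density 0 t s \<partial>lborel) * of_real (exp (- t))" by simp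
    show ?thesis
    proof (cases "0 < t")
      case True
      then show ?thesis unfolding eq using integral_beta_density_eq[OF True]
        by (simp add: b_def g_def abel_kernel_def)
    next
      case False
      show ?thesis unfolding eq by (simp only: beta_density_outside[OF False]) (use False in \<open>simp add: g_def\<close>)
    qed
  qed
  show ?thesis using total g(2)[of 1] unfolding inner by (simp add: b_def)
qed

text \<open>
After exchanging the integrals the inner one is a complete Beta integral over \<open>(v, w)\<close>.
\<close>

lemma abel_inversion_integrable:
  assumes f: "integrable lborel f"
  shows "(\<integral>s. abel_kernel \<alpha> (w - s) * (\<integral>v. abel_kernel (1 - \<alpha>) (s - v) * f v \<partial>lborel) \<partial>lborel)
    = Gamma \<alpha> * Gamma (1 - \<alpha>) * (LINT v:{..<w}|lborel. f v)"
proof -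
  have [measurable]: "f \<in> borel_measurable borel" using borel_measurable_integrable[OF f] by simp
  let ?H = "\<lambda>v s. beta_density v w s * f v"
  have norm_int: "(\<integral>s. norm (?H v s) \<partial>lborel) = (\<integral>s. norm (beta_density 0 1 s) \<partial>lborel) * norm (indicator {..<w} v *\<^sub>R f v)" for v
  proof (cases "v < w")
    case True
    then show ?thesis using integral_norm_beta_density_eq[OF True] by (simp add: norm_mult indicator_def)
  next
    case False
    show ?thesis by (simp only: beta_density_outside[OF False]) (simp add: indicator_def False)
  qed
  have fw: "integrable lborel (\<lambda>v. indicator {..<w} v *\<^sub>R f v)"
    by (rule Bochner_Integration.integrable_bound[OF f]) (auto simp: indicator_def)
  have "integrable (lborel \<Otimes>\<^sub>M lborel) (\<lambda>(v, s). ?H v s)"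
  proof (rule lborel_pair.Fubini_integrable)
    show "integrable lborel (\<lambda>v. \<integral>s. norm (case (v, s) of (v, s) \<Rightarrow> ?H v s) \<partial>lborel)"
      unfolding prod.case norm_int by (intro integrable_mult_right integrable_norm fw)
    show "AE v in lborel. integrable lborel (\<lambda>s. case (v, s) of (v, s) \<Rightarrow> ?H v s)"
      using integrable_beta_density by simp
  qed measurable
  from lborel_pair.Fubini_integral[OF this]
  have swap: "(\<integral>s. (\<integral>v. ?H v s \<partial>lborel) \<partial>lborel) = (\<integral>v. (\<integral>s. ?H v s \<partial>lborel) \<partial>lborel)" .
  have inner: "(\<integral>s. ?H v s \<partial>lborel) = Gamma \<alpha> * Gamma (1 - \<alpha>) * (indicator {..<w} v *\<^sub>R f v)" for v
  proof (cases "v < w")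
    case True
    then show ?thesis using integral_beta_density_eq[OF True] integral_beta_density_unit by (simp add: indicator_def)
  next
    case False
    show ?thesis by (simp only: beta_density_outside[OF False]) (simp add: indicator_def False)
  qed
  show ?thesis using swap unfolding inner integral_mult_right_zero set_lebesgue_integral_def
    by (simp add: mult.assoc)
qed

text \<open>
Only the values of \<open>f\<close> below \<open>w\<close> matter, so that \<open>f\<close> may be cut off there.
\<close>

lemma abel_inversion:
  assumes f: "set_integrable lborel {..<w} f"
  shows "(\<integral>s. abel_kernel \<alpha> (w - s) * (\<integral>v. abel_kernel (1 - \<alpha>) (s - v) * f v \<partial>lborel) \<partial>lborel)
    = Gamma \<alpha> * Gamma (1 - \<alpha>) * (LINT v:{..<w}|lborel. f v)"
proof -
  let ?f = "\<lambda>v. indicator {..<w} v *\<^sub>R f v"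
  have eq: "abel_kernel \<alpha> (w - s) * (\<integral>v. abel_kernel (1 - \<alpha>) (s - v) * f v \<partial>lborel)
      = abel_kernel \<alpha> (w - s) * (\<integral>v. abel_kernel (1 - \<alpha>) (s - v) * ?f v \<partial>lborel)" for s
  proof (cases "s < w")
    case True
    then have "abel_kernel (1 - \<alpha>) (s - v) * f v = abel_kernel (1 - \<alpha>) (s - v) * ?f v" for v
      by (cases "v < w") (auto simp: indicator_def)
    then show ?thesis by simp
  qed simp
  have "(\<integral>s. abel_kernel \<alpha> (w - s) * (\<integral>v. abel_kernel (1 - \<alpha>) (s - v) * f v \<partial>lborel) \<partial>lborel)
     = (\<integral>s. abel_kernel \<alpha> (w - s) * (\<integral>v. abel_kernel (1 - \<alpha>) (s - v) * ?f v \<partial>lborel) \<partial>lborel)"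
    by (rule Bochner_Integration.integral_cong[OF refl eq])
  also have "\<dots> = Gamma \<alpha> * Gamma (1 - \<alpha>) * (LINT v:{..<w}|lborel. ?f v)"
    using f by (intro abel_inversion_integrable) (simp add: set_integrable_def)
  also have "(LINT v:{..<w}|lborel. ?f v) = (LINT v:{..<w}|lborel. f v)"
    by (intro set_lebesgue_integral_cong) auto
  finally show ?thesis .
qed

lemma Gamma_product_nonzero: "Gamma \<alpha> * Gamma (1 - \<alpha>) \<noteq> 0"
proof -
  have "z \<notin> \<int>\<^sub>\<le>\<^sub>0" if "Re z > 0" for z :: complex
    using that by (auto elim!: nonpos_Ints_cases')
  then show ?thesis using \<alpha> by (simp add: Gamma_eq_zero_iff)
qed

end

section \<open>Regularity of Abel convolutions\<close>

text \<open>
After reflection the kernel carries the argument \<open>s\<close>.  For \<open>s < w'\<close> the Lipschitz bound of \<open>g\<close> is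
integrated against the kernel; on the remaining interval \<open>[w', w)\<close> the kernel is at most its value
at \<open>m\<close>.
\<close>

lemma abel_convolution_lipschitz:
  fixes g :: "real \<Rightarrow> complex"
  assumes \<alpha>: "0 < Re \<alpha>" "Re \<alpha> < 1" and m: "0 < m"
    and cont: "continuous_on {0<..<L} g" and supp: "\<And>x. x \<notin> {0<..<L} \<Longrightarrow> g x = 0"
    and bound: "\<And>x. norm (g x) \<le> C"
    and lip: "\<And>x y. x \<in> {0<..<L} \<Longrightarrow> y \<in> {0<..<L} \<Longrightarrow> norm (g x - g y) \<le> \<Lambda> * \<bar>x - y\<bar>"
  shows "\<exists>B. \<forall>w w'. m \<le> w' \<longrightarrow> w' \<le> w \<longrightarrow> w < L \<longrightarrow>
    norm ((\<integral>s. abel_kernel \<alpha> (w - s) * g s \<partial>lborel) - (\<integral>s. abel_kernel \<alpha> (w' - s) * g s \<partial>lborel)) \<le> B * (w - w')"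
proof -
  let ?V = "\<lambda>w. \<integral>s. abel_kernel \<alpha> (w - s) * g s \<partial>lborel"
  have "g = (\<lambda>x. indicator {0<..<L} x *\<^sub>R g x)" using supp by (auto simp: indicator_def fun_eq_iff)
  moreover have "(\<lambda>x. indicator {0<..<L} x *\<^sub>R g x) \<in> borel_measurable borel"
    by (intro borel_measurable_continuous_on_indicator cont) auto
  ultimately have [measurable]: "g \<in> borel_measurable borel" by simp
  have C: "C \<ge> 0" using bound[of 0] norm_ge_zero order_trans by blast
  have V: "?V w = (\<integral>s. abel_kernel \<alpha> s * g (w - s) \<partial>lborel)" for w
    using lborel_integral_real_affine[of "-1" "\<lambda>s. abel_kernel \<alpha> (w - s) * g s" w] by simp
  define k where "k s = norm (indicator {..<L} s *\<^sub>R abel_kernel \<alpha> s)" for s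
  have k: "integrable lborel k"
    unfolding k_def[abs_def] by (intro integrable_norm integrable_abel_kernel_bounded \<alpha>)
  define I where "I = (\<integral>s. k s \<partial>lborel)"
  have zero: "abel_kernel \<alpha> s * g (w - s) = 0" if "w \<le> s" for s w using that supp by simp
  have int: "integrable lborel (\<lambda>s. abel_kernel \<alpha> s * g (w - s))" if "w < L" for w
  proof (rule Bochner_Integration.integrable_bound)
    show "integrable lborel (\<lambda>s. C * k s)" using k by simp
    have "norm (abel_kernel \<alpha> s * g (w - s)) \<le> norm (C * k s)" for s
    proof (cases "s < w")
      case True
      then have "k s = norm (abel_kernel \<alpha> s)" using that by (simp add: k_def)
      then show ?thesis
        using mult_left_mono[OF bound[of "w - s"] norm_ge_zero[of "abel_kernel \<alpha> s"]] C
        by (simp add: norm_mult mult.commute)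
    qed (simp add: zero)
    then show "AE s in lborel. norm (abel_kernel \<alpha> s * g (w - s)) \<le> norm (C * k s)" by simp
  qed measurable
  define B where "B = \<bar>\<Lambda>\<bar> * I + C * m powr (Re \<alpha> - 1)"
  have "norm (?V w - ?V w') \<le> B * (w - w')" if w: "m \<le> w'" "w' \<le> w" "w < L" for w w'
  proof -
    let ?b = "\<lambda>s. (\<bar>\<Lambda>\<bar> * (w - w')) * k s + (C * m powr (Re \<alpha> - 1)) * indicator {w'..<w} s"
    have pt: "norm (abel_kernel \<alpha> s * g (w - s) - abel_kernel \<alpha> s * g (w' - s)) \<le> ?b s" for s
    proof -
      have pos: "(\<bar>\<Lambda>\<bar> * (w - w')) * k s \<ge> 0" "(C * m powr (Re \<alpha> - 1)) * indicator {w'..<w} s \<ge> 0"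
        using w C by (auto simp: k_def)
      consider "s \<le> 0" | "w \<le> s" | "0 < s" "s < w'" | "w' \<le> s" "s < w" by linarith
      then show ?thesis
      proof cases
        case 1
        then show ?thesis using pos by simp
      next
        case 2
        have z: "abel_kernel \<alpha> s * g (w' - s) = 0" by (rule zero) (use 2 w in auto)
        show ?thesis unfolding zero[OF 2] z using add_nonneg_nonneg[OF pos] by simp
      next
        case 3
        have "norm (abel_kernel \<alpha> s * g (w - s) - abel_kernel \<alpha> s * g (w' - s)) = norm (abel_kernel \<alpha> s) * norm (g (w - s) - g (w' - s))"
          by (simp flip: norm_mult add: right_diff_distrib)
        also have "\<dots> \<le> norm (abel_kernel \<alpha> s) * (\<bar>\<Lambda>\<bar> * (w - w'))"
        proof (rule mult_left_mono)
          have "norm (g (w - s) - g (w' - s)) \<le> \<Lambda> * \<bar>(w - s) - (w' - s)\<bar>" by (rule lip) (use 3 w in auto)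
          also have "\<dots> \<le> \<bar>\<Lambda>\<bar> * (w - w')" using w by (simp add: mult_right_mono)
          finally show "norm (g (w - s) - g (w' - s)) \<le> \<bar>\<Lambda>\<bar> * (w - w')" .
        qed simp
        also have "norm (abel_kernel \<alpha> s) = k s" using 3 w by (simp add: k_def)
        finally show ?thesis using pos(2) by (simp add: mult.commute)
      next
        case 4
        have "s \<ge> m" using 4 w by simp
        then have "s powr (Re \<alpha> - 1) \<le> m powr (Re \<alpha> - 1)" using m \<alpha> by (intro powr_mono2') auto
        then have "norm (abel_kernel \<alpha> s) \<le> m powr (Re \<alpha> - 1)" using \<open>s \<ge> m\<close> m by (simp add: norm_abel_kernel)
        then have "norm (abel_kernel \<alpha> s) * norm (g (w - s)) \<le> m powr (Re \<alpha> - 1) * C"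
          using bound by (intro mult_mono) auto
        moreover have z: "abel_kernel \<alpha> s * g (w' - s) = 0" by (rule zero) (use 4 in auto)
        ultimately show ?thesis unfolding z using 4 pos(1) by (simp add: norm_mult mult.commute)
      qed
    qed
    have "?V w - ?V w' = (\<integral>s. abel_kernel \<alpha> s * g (w - s) - abel_kernel \<alpha> s * g (w' - s) \<partial>lborel)"
      unfolding V using int w by (subst Bochner_Integration.integral_diff) auto
    also have "norm \<dots> \<le> (\<integral>s. ?b s \<partial>lborel)"
      by (rule Bochner_Integration.integral_norm_bound_integral)
         (use int w k pt in \<open>auto intro!: Bochner_Integration.integrable_add Bochner_Integration.integrable_diff
            integrable_mult_right integrable_real_indicator\<close>)
    also have "\<dots> = (\<bar>\<Lambda>\<bar> * (w - w')) * I + (C * m powr (Re \<alpha> - 1)) * (w - w')"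
      using k w by (subst Bochner_Integration.integral_add) (auto simp: I_def)
    also have "\<dots> = B * (w - w')" by (simp add: B_def algebra_simps)
    finally show ?thesis .
  qed
  then show ?thesis by blast
qed

lemma lipschitz_imp_derivative_bound:
  fixes f :: "real \<Rightarrow> 'b::real_normed_vector"
  assumes d: "(f has_vector_derivative f') (at x)"
    and lip: "\<And>y. x < y \<Longrightarrow> y < x + \<delta> \<Longrightarrow> norm (f y - f x) \<le> B * (y - x)" and \<delta>: "\<delta> > 0"
  shows "norm f' \<le> B"
proof -
  define r where "r k = (\<delta> / 2) * inverse (real (Suc k))" for k
  have r: "r k > 0" "r k < \<delta>" for k
  proof -
    show "r k > 0" using \<delta> by (simp add: r_def)
    have "r k \<le> \<delta> / 2 * 1"
      unfolding r_def using \<delta> by (intro mult_left_mono) (auto simp: inverse_le_1_iff)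
    then show "r k < \<delta>" using \<delta> by simp
  qed
  have r0: "r \<longlonglongrightarrow> 0"
    unfolding r_def using tendsto_mult_right_zero[OF LIMSEQ_inverse_real_of_nat] by simp
  have "(\<lambda>k. (f (x + r k *\<^sub>R 1) - f x) /\<^sub>R r k) \<longlonglongrightarrow> 1 *\<^sub>R f'"
    by (rule directional_derivative_sequentially[OF d[unfolded has_vector_derivative_def] r(1) r0])
  then have "(\<lambda>k. norm ((f (x + r k) - f x) /\<^sub>R r k)) \<longlonglongrightarrow> norm f'"
    by (intro tendsto_norm) simp
  moreover have "norm ((f (x + r k) - f x) /\<^sub>R r k) \<le> B" for k
  proof -
    have "norm (f (x + r k) - f x) \<le> B * r k" using lip[of "x + r k"] r[of k] by simp
    then show ?thesis using r(1)[of k] by (simp add: divide_inverse_commute[symmetric] divide_le_eq)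
  qed
  ultimately show ?thesis by (intro LIMSEQ_le_const2) auto
qed

lemma primitive_has_vector_derivative:
  fixes f :: "real \<Rightarrow> complex"
  assumes cont_f: "continuous_on {0<..<L} f"
    and integrable_below: "\<And>w. w < L \<Longrightarrow> set_integrable lborel {..<w} f"
    and w: "w \<in> {0<..<L}"
  shows "((\<lambda>w. LINT v:{..<w}|lborel. f v) has_vector_derivative f w) (at w)"
proof -
  define p q where "p = w / 2" and "q = (w + L) / 2"
  have pq: "0 < p" "p < w" "w < q" "q < L" using w by (auto simp: p_def q_def)
  have cont: "continuous_on {p..q} f" by (rule continuous_on_subset[OF cont_f]) (use pq in auto)
  have split: "(LINT v:{..<u}|lborel. f v) = (LINT v:{..<p}|lborel. f v) + integral {p..u} f" if u: "u \<in> {p<..<q}" for u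
  proof -
    have int: "set_integrable lborel {..<u} f" by (rule integrable_below) (use u pq in auto)
    have "(LINT v:{..<u}|lborel. f v) = (LINT v:{..<p} \<union> {p..<u}|lborel. f v)"
      by (rule arg_cong[where f = "\<lambda>A. set_lebesgue_integral lborel A f"]) (use u in auto)
    also have "\<dots> = (LINT v:{..<p}|lborel. f v) + (LINT v:{p..<u}|lborel. f v)"
      by (rule set_integral_Un) (use u in \<open>auto intro!: set_integrable_subset[OF int]\<close>)
    also have "(LINT v:{p..<u}|lborel. f v) = integral {p..<u} f"
      by (rule set_borel_integral_eq_integral(2)) (use u in \<open>auto intro!: set_integrable_subset[OF int]\<close>)
    also have "\<dots> = integral {p..u} f"
      by (rule integral_spike_set) (auto intro: negligible_subset[of "{u}"])
    finally show ?thesis .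
  qed
  have "((\<lambda>u. integral {p..u} f) has_vector_derivative f w) (at w within {p..q})"
    by (rule integral_has_vector_derivative[OF cont]) (use pq in auto)
  then have "((\<lambda>u. integral {p..u} f) has_vector_derivative f w) (at w within {p<..<q})"
    by (rule has_vector_derivative_within_subset) auto
  moreover have "at w within {p<..<q} = at w" by (rule at_within_open) (use pq in auto)
  ultimately have "((\<lambda>u. integral {p..u} f) has_vector_derivative f w) (at w)" by (simp only:)
  from has_vector_derivative_add[OF has_vector_derivative_const this]
  have "((\<lambda>u. (LINT v:{..<p}|lborel. f v) + integral {p..u} f) has_vector_derivative f w) (at w)"
    by simp
  then show ?thesis
    by (rule has_vector_derivative_transform_within_open[of _ _ _ "{p<..<q}"]) (use pq split in auto)
qed

text \<open>
\<open>f\<close> is to be recovered from its fractional integral \<open>g\<close> of order \<open>1 - \<alpha>\<close> (without the factor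
\<open>1 / Gamma (1 - \<alpha>)\<close>) on an interval \<open>(0, L)\<close>, including information at the endpoint \<open>L\<close>.
\<close>

locale abel_pair =
  fixes \<alpha> :: complex and L :: real and f :: "real \<Rightarrow> complex"
  assumes \<alpha>: "0 < Re \<alpha>" "Re \<alpha> < 1" and L: "0 < L"
    and cont_f: "continuous_on {0<..<L} f" and supp_f: "\<And>x. x \<notin> {0<..<L} \<Longrightarrow> f x = 0"
    and int_f: "\<And>w. w \<in> {0<..<L} \<Longrightarrow> integrable lborel (\<lambda>v. abel_kernel (1 - \<alpha>) (w - v) * f v)"
begin

definition g :: "real \<Rightarrow> complex" where
  "g w = (\<integral>v. abel_kernel (1 - \<alpha>) (w - v) * f v \<partial>lborel)"

lemma measurable_f [measurable]: "f \<in> borel_measurable borel"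
proof -
  have "f = (\<lambda>x. indicator {0<..<L} x *\<^sub>R f x)" using supp_f by (auto simp: indicator_def fun_eq_iff)
  moreover have "(\<lambda>x. indicator {0<..<L} x *\<^sub>R f x) \<in> borel_measurable borel"
    by (intro borel_measurable_continuous_on_indicator cont_f) auto
  ultimately show ?thesis by simp
qed

lemma integrable_below:
  assumes w: "w < L"
  shows "set_integrable lborel {..<w} f"
proof (cases "0 < w")
  case True
  show ?thesis
    unfolding set_integrable_def
  proof (rule Bochner_Integration.integrable_bound)
    show "integrable lborel (\<lambda>v. (w powr Re \<alpha>) *\<^sub>R (abel_kernel (1 - \<alpha>) (w - v) * f v))"
      using int_f[of w] True w by simp
    have "norm (indicator {..<w} v *\<^sub>R f v) \<le> norm ((w powr Re \<alpha>) *\<^sub>R (abel_kernel (1 - \<alpha>) (w - v) * f v))" for v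
    proof (cases "0 < v \<and> v < w")
      case True
      have "(w - v) powr Re \<alpha> \<le> w powr Re \<alpha>" using True \<alpha> by (intro powr_mono2) auto
      then have "1 \<le> w powr Re \<alpha> * (w - v) powr (- Re \<alpha>)"
        using True by (simp add: powr_minus field_simps)
      then have "1 * norm (f v) \<le> (w powr Re \<alpha> * (w - v) powr (- Re \<alpha>)) * norm (f v)"
        by (intro mult_right_mono) auto
      then show ?thesis using True by (simp add: norm_mult norm_abel_kernel mult.assoc)
    next
      case False
      then show ?thesis using supp_f[of v] by (auto simp: indicator_def)
    qed
    then show "AE v in lborel. norm (indicator {..<w} v *\<^sub>R f v) \<le> norm ((w powr Re \<alpha>) *\<^sub>R (abel_kernel (1 - \<alpha>) (w - v) * f v))"
      by simp
  qed measurable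
next
  case False
  then have "(\<lambda>v. indicator {..<w} v *\<^sub>R f v) = (\<lambda>v. 0)" using supp_f by (auto simp: indicator_def fun_eq_iff)
  then show ?thesis unfolding set_integrable_def by simp
qed

lemma g_nonpos: "w \<le> 0 \<Longrightarrow> g w = 0"
proof -
  assume "w \<le> 0"
  then have z: "abel_kernel (1 - \<alpha>) (w - v) * f v = 0" for v
    using supp_f[of v] by (cases "v \<le> 0") auto
  show ?thesis unfolding g_def z by simp
qed

lemma inversion:
  assumes "w < L"
  shows "(\<integral>s. abel_kernel \<alpha> (w - s) * g s \<partial>lborel) = Gamma \<alpha> * Gamma (1 - \<alpha>) * (LINT v:{..<w}|lborel. f v)"
  unfolding g_def by (rule abel_inversion[OF \<alpha> integrable_below[OF assms]])

lemma primitive_derivative: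
  assumes w: "w \<in> {0<..<L}"
  shows "((\<lambda>w. LINT v:{..<w}|lborel. f v) has_vector_derivative f w) (at w)"
  by (rule primitive_has_vector_derivative[OF cont_f integrable_below w])

text \<open>
By Abel's inversion the primitive of \<open>f\<close> is a convolution of \<open>g\<close>, hence Lipschitz away from \<open>0\<close>, and
a Lipschitz constant of the primitive bounds \<open>f\<close>.
\<close>

lemma bounded_near_right_end:
  assumes cont_g: "continuous_on {0<..<L} g" and bound: "\<And>x. x \<in> {0<..<L} \<Longrightarrow> norm (g x) \<le> C"
    and lip: "\<And>x y. x \<in> {0<..<L} \<Longrightarrow> y \<in> {0<..<L} \<Longrightarrow> norm (g x - g y) \<le> \<Lambda> * \<bar>x - y\<bar>"
    and m: "0 < m"
  shows "\<exists>M. \<forall>x. m \<le> x \<longrightarrow> x < L \<longrightarrow> norm (f x) \<le> M"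
proof -
  define g1 where "g1 x = (if x \<in> {0<..<L} then g x else 0)" for x
  have C: "0 \<le> C" using order_trans[OF norm_ge_zero bound[of "L / 2"]] L by simp
  have cont1: "continuous_on {0<..<L} g1" by (rule continuous_on_eq[OF cont_g]) (simp add: g1_def)
  have "\<exists>B. \<forall>w w'. m \<le> w' \<longrightarrow> w' \<le> w \<longrightarrow> w < L \<longrightarrow>
      norm ((\<integral>s. abel_kernel \<alpha> (w - s) * g1 s \<partial>lborel) - (\<integral>s. abel_kernel \<alpha> (w' - s) * g1 s \<partial>lborel)) \<le> B * (w - w')"
  proof (rule abel_convolution_lipschitz[OF \<alpha> m cont1])
    show "g1 x = 0" if "x \<notin> {0<..<L}" for x using that by (auto simp: g1_def)
    show "norm (g1 x) \<le> C" for x using bound[of x] C by (simp add: g1_def)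
    show "norm (g1 x - g1 y) \<le> \<Lambda> * \<bar>x - y\<bar>" if "x \<in> {0<..<L}" "y \<in> {0<..<L}" for x y
      using lip[OF that] that by (simp add: g1_def)
  qed
  then obtain B where B: "\<And>w w'. m \<le> w' \<Longrightarrow> w' \<le> w \<Longrightarrow> w < L \<Longrightarrow>
      norm ((\<integral>s. abel_kernel \<alpha> (w - s) * g1 s \<partial>lborel) - (\<integral>s. abel_kernel \<alpha> (w' - s) * g1 s \<partial>lborel)) \<le> B * (w - w')"
    by blast
  define G where "G = Gamma \<alpha> * Gamma (1 - \<alpha>)"
  define P where "P w = (LINT v:{..<w}|lborel. f v)" for w
  have "(\<integral>s. abel_kernel \<alpha> (w - s) * g1 s \<partial>lborel) = G * P w" if "w < L" for w
  proof -
    have eq: "abel_kernel \<alpha> (w - s) * g1 s = abel_kernel \<alpha> (w - s) * g s" for s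
      using that g_nonpos[of s] by (cases "s < w") (auto simp: g1_def)
    show ?thesis unfolding eq inversion[OF that] by (simp add: G_def P_def)
  qed
  note eqV = this
  have lipP: "norm (G * P w - G * P w') \<le> B * (w - w')" if "m \<le> w'" "w' \<le> w" "w < L" for w w'
    using B[OF that] that unfolding eqV[OF that(3)] eqV[OF order.strict_trans1[OF that(2,3)]] by simp
  have "norm (f x) \<le> B / norm G" if x: "m \<le> x" "x < L" for x
  proof -
    have "(P has_vector_derivative f x) (at x)"
      unfolding P_def using primitive_derivative[of x] x m by simp
    then have "((\<lambda>w. G * P w) has_vector_derivative G * f x) (at x)"
      by (rule bounded_linear.has_vector_derivative[OF bounded_linear_mult_right])
    then have "norm (G * f x) \<le> B"
      by (rule lipschitz_imp_derivative_bound[where \<delta> = "L - x"]) (use x lipP in auto)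
    moreover have "norm G > 0" using Gamma_product_nonzero[OF \<alpha>] by (simp add: G_def)
    ultimately show ?thesis by (simp add: norm_mult field_simps)
  qed
  then show ?thesis by blast
qed

text \<open>
The integral is split at \<open>m\<close>.  Below \<open>m\<close> the kernel is bounded for \<open>w\<close> near \<open>L\<close> and \<open>f\<close> is integrable;
above \<open>m\<close>, after reflection, \<open>f\<close> is bounded and the kernel is integrable.  Both parts converge by
dominated convergence.
\<close>

lemma right_end:
  assumes m: "0 < m" "m < L" and M: "\<And>x. m \<le> x \<Longrightarrow> x < L \<Longrightarrow> norm (f x) \<le> M"
  shows "integrable lborel (\<lambda>v. abel_kernel (1 - \<alpha>) (L - v) * f v)" "(g \<longlongrightarrow> g L) (at_left L)"
proof -
  have r: "Re (1 - \<alpha>) > 0" using \<alpha> by simp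
  define f1 where "f1 v = indicator {..<m} v *\<^sub>R f v" for v
  define f2 where "f2 v = indicator {m..} v *\<^sub>R f v" for v
  have [measurable]: "f1 \<in> borel_measurable borel" "f2 \<in> borel_measurable borel"
    unfolding f1_def f2_def by measurable
  have f12: "f v = f1 v + f2 v" for v by (auto simp: f1_def f2_def indicator_def)
  have f1: "integrable lborel f1"
    using integrable_below[OF m(2)] by (simp add: f1_def[abs_def] set_integrable_def)
  define m' where "m' = (m + L) / 2"
  have m': "m < m'" "m' < L" using m by (auto simp: m'_def)
  define b1 where "b1 v = (m' - m) powr (- Re \<alpha>) * norm (f1 v)" for v
  have b1: "integrable lborel b1" unfolding b1_def[abs_def] using f1 by (intro integrable_mult_right integrable_norm)
  have M0: "M \<ge> 0" using M[of m] m norm_ge_zero order_trans by blast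
  define b2 where "b2 s = M * norm (indicator {..<L} s *\<^sub>R abel_kernel (1 - \<alpha>) s)" for s
  have b2: "integrable lborel b2" unfolding b2_def[abs_def]
    by (intro integrable_mult_right integrable_norm integrable_abel_kernel_bounded r)
  have bound1: "norm (abel_kernel (1 - \<alpha>) (w - v) * f1 v) \<le> b1 v" if "m' \<le> w" for w v
  proof (cases "v < m")
    case True
    have "(w - v) powr (- Re \<alpha>) \<le> (m' - m) powr (- Re \<alpha>)"
      using True that m' \<alpha> by (intro powr_mono2') auto
    then show ?thesis
      using True that m' by (simp add: norm_mult b1_def norm_abel_kernel mult_right_mono)
  qed (simp add: f1_def b1_def)
  have bound2: "norm (abel_kernel (1 - \<alpha>) s * f2 (w - s)) \<le> b2 s" if "w \<le> L" for w s
  proof (cases "0 < s \<and> m \<le> w - s")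
    case True
    then have "norm (f2 (w - s)) \<le> M" using M[of "w - s"] that by (simp add: f2_def)
    moreover have "s < L" using True that m by simp
    ultimately show ?thesis
      by (simp add: norm_mult b2_def mult_right_mono mult.commute)
  next
    case False
    then show ?thesis using M0 by (auto simp: f2_def b2_def indicator_def)
  qed
  have int1: "integrable lborel (\<lambda>v. abel_kernel (1 - \<alpha>) (w - v) * f1 v)" if "m' \<le> w" for w
    by (rule Bochner_Integration.integrable_bound[OF b1])
       (use bound1[OF that] in \<open>auto intro: order_trans[OF _ abs_ge_self]\<close>)
  have int2': "integrable lborel (\<lambda>s. abel_kernel (1 - \<alpha>) s * f2 (w - s))" if "w \<le> L" for w
    by (rule Bochner_Integration.integrable_bound[OF b2])
       (use bound2[OF that] in \<open>auto intro: order_trans[OF _ abs_ge_self]\<close>)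
  have int2: "integrable lborel (\<lambda>v. abel_kernel (1 - \<alpha>) (w - v) * f2 v)" if "w \<le> L" for w
    using lborel_integrable_real_affine[OF int2'[OF that], of "-1" w] by simp
  show "integrable lborel (\<lambda>v. abel_kernel (1 - \<alpha>) (L - v) * f v)"
    unfolding f12 distrib_left using int1[of L] int2[of L] m' by simp
  have g_split: "g w = (\<integral>v. abel_kernel (1 - \<alpha>) (w - v) * f1 v \<partial>lborel) + (\<integral>s. abel_kernel (1 - \<alpha>) s * f2 (w - s) \<partial>lborel)"
    if "m' \<le> w" "w \<le> L" for w
    unfolding g_def f12 distrib_left using int1[of w] int2[of w] that
      lborel_integral_real_affine[of "-1" "\<lambda>v. abel_kernel (1 - \<alpha>) (w - v) * f2 v" w] by simp
  show "(g \<longlongrightarrow> g L) (at_left L)"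
  proof (rule tendsto_at_left_sequentially[OF m'(2)])
    fix X assume X: "\<And>n. X n < L" "\<And>n. m' < X n" "X \<longlonglongrightarrow> L"
    have "(\<lambda>n. \<integral>v. abel_kernel (1 - \<alpha>) (X n - v) * f1 v \<partial>lborel) \<longlonglongrightarrow> (\<integral>v. abel_kernel (1 - \<alpha>) (L - v) * f1 v \<partial>lborel)"
    proof (rule integral_dominated_convergence[OF _ _ b1])
      show "AE v in lborel. (\<lambda>n. abel_kernel (1 - \<alpha>) (X n - v) * f1 v) \<longlonglongrightarrow> abel_kernel (1 - \<alpha>) (L - v) * f1 v"
      proof (intro AE_I2)
        fix v
        show "(\<lambda>n. abel_kernel (1 - \<alpha>) (X n - v) * f1 v) \<longlonglongrightarrow> abel_kernel (1 - \<alpha>) (L - v) * f1 v"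
        proof (cases "v < m")
          case True
          have "isCont (abel_kernel (1 - \<alpha>)) (L - v)"
            using continuous_abel_kernel True m by (simp add: continuous_on_eq_continuous_at)
          moreover have "(\<lambda>n. X n - v) \<longlonglongrightarrow> L - v" by (intro tendsto_intros X(3))
          ultimately have "(\<lambda>n. abel_kernel (1 - \<alpha>) (X n - v)) \<longlonglongrightarrow> abel_kernel (1 - \<alpha>) (L - v)"
            by (rule isCont_tendsto_compose)
          then show ?thesis by (intro tendsto_mult tendsto_const)
        qed (simp add: f1_def)
      qed
      show "AE v in lborel. norm (abel_kernel (1 - \<alpha>) (X n - v) * f1 v) \<le> b1 v" for n
        using bound1[of "X n"] X(2)[of n] by (intro AE_I2) simp
    qed measurable
    moreover have "(\<lambda>n. \<integral>s. abel_kernel (1 - \<alpha>) s * f2 (X n - s) \<partial>lborel) \<longlonglongrightarrow> (\<integral>s. abel_kernel (1 - \<alpha>) s * f2 (L - s) \<partial>lborel)"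
    proof (rule integral_dominated_convergence[OF _ _ b2])
      have "AE s in lborel. s \<noteq> L - m" by (rule AE_lborel_singleton)
      then show "AE s in lborel. (\<lambda>n. abel_kernel (1 - \<alpha>) s * f2 (X n - s)) \<longlonglongrightarrow> abel_kernel (1 - \<alpha>) s * f2 (L - s)"
      proof (rule AE_mp, intro AE_I2 impI)
        fix s assume s: "s \<noteq> L - m"
        have conv: "(\<lambda>n. X n - s) \<longlonglongrightarrow> L - s" by (intro tendsto_intros X(3))
        consider "s \<le> 0" | "0 < s" "s < L - m" | "L - m < s" using s by linarith
        then show "(\<lambda>n. abel_kernel (1 - \<alpha>) s * f2 (X n - s)) \<longlonglongrightarrow> abel_kernel (1 - \<alpha>) s * f2 (L - s)"
        proof cases
          case 2
          have "continuous_on {m<..<L} f2"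
            by (rule continuous_on_eq[OF continuous_on_subset[OF cont_f]]) (use m in \<open>auto simp: f2_def\<close>)
          then have "isCont f2 (L - s)" using 2 by (simp add: continuous_on_eq_continuous_at)
          from isCont_tendsto_compose[OF this conv] show ?thesis by (intro tendsto_mult tendsto_const)
        next
          case 3
          have "eventually (\<lambda>n. X n - s < m) sequentially" using conv 3 by (intro order_tendstoD(2)) auto
          then have "eventually (\<lambda>n. abel_kernel (1 - \<alpha>) s * f2 (X n - s) = abel_kernel (1 - \<alpha>) s * f2 (L - s)) sequentially"
            by eventually_elim (use 3 in \<open>simp add: f2_def\<close>)
          then show ?thesis by (rule tendsto_eventually)
        qed simp
      qed
      show "AE s in lborel. norm (abel_kernel (1 - \<alpha>) s * f2 (X n - s)) \<le> b2 s" for n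
        using bound2[of "X n"] X(1)[of n] by (intro AE_I2) simp
    qed measurable
    ultimately have "(\<lambda>n. (\<integral>v. abel_kernel (1 - \<alpha>) (X n - v) * f1 v \<partial>lborel) + (\<integral>s. abel_kernel (1 - \<alpha>) s * f2 (X n - s) \<partial>lborel))
       \<longlonglongrightarrow> g L"
      unfolding g_split[OF less_imp_le[OF m'(2)] order_refl] by (rule tendsto_add)
    moreover have "g (X n) = (\<integral>v. abel_kernel (1 - \<alpha>) (X n - v) * f1 v \<partial>lborel) + (\<integral>s. abel_kernel (1 - \<alpha>) s * f2 (X n - s) \<partial>lborel)" for n
      by (rule g_split[OF less_imp_le[OF X(2)] less_imp_le[OF X(1)]])
    ultimately show "(\<lambda>n. g (X n)) \<longlonglongrightarrow> g L" by presburger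
  qed
qed

end

section \<open>Proportional fractional integrals\<close>

lemma bounded_linear_axis: "bounded_linear (axis j :: complex \<Rightarrow> cquat)"
  by (rule linear_conv_bounded_linear[THEN iffD1]) (auto simp: linear_iff axis_def vec_eq_iff)

lemma vec_sum_axis: "(x :: cquat) = (\<Sum>j\<in>UNIV. axis j (x$j))"
  by (simp add: vec_eq_iff axis_def if_distrib cong: if_cong)

lemma integrable_vec_iff:
  fixes F :: "real \<Rightarrow> cquat"
  shows "integrable M F \<longleftrightarrow> (\<forall>j. integrable M (\<lambda>x. F x $ j))"
proof
  assume "integrable M F"
  then show "\<forall>j. integrable M (\<lambda>x. F x $ j)"
    by (auto intro: integrable_bounded_linear[OF bounded_linear_vec_nth])
next
  assume "\<forall>j. integrable M (\<lambda>x. F x $ j)"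
  then have "integrable M (\<lambda>x. \<Sum>j\<in>UNIV. axis j (F x $ j))"
    by (auto intro!: Bochner_Integration.integrable_sum integrable_bounded_linear[OF bounded_linear_axis])
  then show "integrable M F" by (simp only: vec_sum_axis[symmetric])
qed

lemma integrable_scaleR_iff:
  fixes f :: "real \<Rightarrow> complex"
  assumes "r \<noteq> 0"
  shows "integrable M (\<lambda>x. r *\<^sub>R f x) \<longleftrightarrow> integrable M f"
proof
  assume "integrable M (\<lambda>x. r *\<^sub>R f x)"
  from integrable_scaleR_right[OF this, of "inverse r"]
  show "integrable M f" using assms by (simp del: integrable_scaleR_right)
qed simp

lemma integral_vec_nth:
  fixes F :: "real \<Rightarrow> cquat"
  assumes "integrable M F"
  shows "(\<integral>x. F x \<partial>M) $ j = (\<integral>x. F x $ j \<partial>M)"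
  using integral_bounded_linear[OF bounded_linear_vec_nth assms] by simp

lemma has_vector_derivative_vecI:
  fixes f :: "real \<Rightarrow> cquat"
  assumes "\<And>j. ((\<lambda>t. f t $ j) has_vector_derivative d $ j) F"
  shows "(f has_vector_derivative d) F"
proof -
  have "((\<lambda>t. \<Sum>j\<in>UNIV. axis j (f t $ j)) has_vector_derivative (\<Sum>j\<in>UNIV. axis j (d $ j))) F"
    by (intro has_vector_derivative_sum bounded_linear.has_vector_derivative[OF bounded_linear_axis] assms)
  then show ?thesis by (simp only: vec_sum_axis[symmetric])
qed

lemma borel_measurable_vecI:
  fixes F :: "real \<Rightarrow> cquat"
  assumes "\<And>j. (\<lambda>x. F x $ j) \<in> borel_measurable M"
  shows "F \<in> borel_measurable M"
proof -
  have "(\<lambda>x. \<Sum>j\<in>UNIV. axis j (F x $ j)) \<in> borel_measurable M"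
    by (rule borel_measurable_sum)
       (rule measurable_compose[OF assms borel_measurable_continuous_onI[OF linear_continuous_on[OF bounded_linear_axis]]])
  then show ?thesis by (simp only: vec_sum_axis[symmetric])
qed

locale frac_slice =
  fixes a b \<rho> :: real and \<Phi> \<Phi>' :: "real \<Rightarrow> real"
  assumes ab: "a < b" and rho: "0 < \<rho>"
    and deriv_Phi: "\<And>t. t \<in> {a<..<b} \<Longrightarrow> (\<Phi> has_real_derivative \<Phi>' t) (at t)"
    and cont_Phi: "continuous_on {a..b} \<Phi>" and cont_Phi': "continuous_on {a..b} \<Phi>'"
    and pos_Phi': "\<And>t. t \<in> {a..b} \<Longrightarrow> \<Phi>' t > 0"
begin

definition c :: real where "c = (\<rho> - 1) / \<rho>"
definition q :: "real \<Rightarrow> real" where "q t = \<Phi> t - \<Phi> a"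
definition L :: real where "L = q b"
definition \<Psi> :: "real \<Rightarrow> real" where "\<Psi> = inv_into {a..b} q"

lemma deriv_q: "t \<in> {a<..<b} \<Longrightarrow> (q has_real_derivative \<Phi>' t) (at t)"
  unfolding q_def[abs_def] using deriv_Phi by (auto intro!: derivative_eq_intros)

lemma cont_q: "continuous_on {a..b} q"
  unfolding q_def[abs_def] by (intro continuous_intros cont_Phi)

lemma q_a [simp]: "q a = 0"
  by (simp add: q_def)

lemma expansion:
  obtains m where "m > 0" "\<And>s t. a \<le> s \<Longrightarrow> s \<le> t \<Longrightarrow> t \<le> b \<Longrightarrow> m * (t - s) \<le> q t - q s"
proof -
  have "\<exists>x\<in>{a..b}. \<forall>y\<in>{a..b}. \<Phi>' x \<le> \<Phi>' y"
    by (rule continuous_attains_inf) (use ab cont_Phi' in auto)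
  then obtain x where x: "x \<in> {a..b}" "\<And>y. y \<in> {a..b} \<Longrightarrow> \<Phi>' x \<le> \<Phi>' y" by blast
  have "\<Phi>' x * (t - s) \<le> q t - q s" if st: "a \<le> s" "s \<le> t" "t \<le> b" for s t
  proof (cases "s = t")
    case False
    then have "s < t" using st by simp
    moreover have "continuous_on {s..t} q" by (rule continuous_on_subset[OF cont_q]) (use st in auto)
    moreover have "q differentiable (at x)" if "s < x" "x < t" for x
      using deriv_q[of x] that st real_differentiable_def by fastforce
    ultimately have "\<exists>l z. s < z \<and> z < t \<and> DERIV q z :> l \<and> q t - q s = (t - s) * l"
      by (rule MVT)
    then obtain l z where z: "s < z" "z < t" "DERIV q z :> l" "q t - q s = (t - s) * l" by blast
    have "l = \<Phi>' z" using z deriv_q[of z] st by (intro DERIV_unique) auto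
    then have "\<Phi>' x \<le> l" using x(2)[of z] z st by auto
    then show ?thesis using z \<open>s < t\<close> by (simp add: mult.commute mult_left_mono)
  qed simp
  with pos_Phi'[OF x(1)] show thesis by (rule that)
qed

lemma q_less: "a \<le> s \<Longrightarrow> s < t \<Longrightarrow> t \<le> b \<Longrightarrow> q s < q t"
proof -
  assume st: "a \<le> s" "s < t" "t \<le> b"
  obtain m where m: "m > 0" "\<And>s t. a \<le> s \<Longrightarrow> s \<le> t \<Longrightarrow> t \<le> b \<Longrightarrow> m * (t - s) \<le> q t - q s"
    by (rule expansion) (rule that)
  have "m * (t - s) > 0" using m(1) st by simp
  then show ?thesis using m(2)[of s t] st by simp
qed

lemma q_less_iff: "s \<in> {a..b} \<Longrightarrow> t \<in> {a..b} \<Longrightarrow> q s < q t \<longleftrightarrow> s < t"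
  using q_less[of s t] q_less[of t s] by (cases s t rule: linorder_cases) auto

lemma inj_q: "inj_on q {a..b}"
proof (rule inj_onI)
  fix s t assume "s \<in> {a..b}" "t \<in> {a..b}" "q s = q t"
  then show "s = t" using q_less_iff[of s t] q_less_iff[of t s] by (cases s t rule: linorder_cases) auto
qed

lemma L_pos: "0 < L"
  using q_less[of a b] ab by (simp add: L_def)

lemma \<Psi>_q: "t \<in> {a..b} \<Longrightarrow> \<Psi> (q t) = t"
  unfolding \<Psi>_def by (rule inv_into_f_f[OF inj_q])

lemma q_surj: "t \<in> {a..b} \<Longrightarrow> w \<in> {0..q t} \<Longrightarrow> \<exists>s\<in>{a..t}. q s = w"
  using IVT'[of q a w t] continuous_on_subset[OF cont_q, of "{a..t}"] by auto

lemma q_\<Psi>: "w \<in> {0..L} \<Longrightarrow> q (\<Psi> w) = w \<and> \<Psi> w \<in> {a..b}"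
  using q_surj[of b w] ab \<Psi>_q by (force simp: L_def)

lemma \<Psi>_open: "w \<in> {0<..<L} \<Longrightarrow> \<Psi> w \<in> {a<..<b}"
proof -
  assume w: "w \<in> {0<..<L}"
  then have *: "q (\<Psi> w) = w" "\<Psi> w \<in> {a..b}" using q_\<Psi>[of w] by auto
  moreover have "\<Psi> w \<noteq> a" "\<Psi> w \<noteq> b" using * w by (auto simp: L_def)
  ultimately show ?thesis by auto
qed

lemma q_open: "t \<in> {a<..<b} \<Longrightarrow> q t \<in> {0<..<L}"
  using q_less[of a t] q_less[of t b] by (auto simp: L_def)

lemma q_image: "t \<in> {a<..b} \<Longrightarrow> q ` {a<..<t} = {0<..<q t}"
proof (intro set_eqI iffI)
  fix w assume t: "t \<in> {a<..b}"
  show "w \<in> {0<..<q t}" if "w \<in> q ` {a<..<t}"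
    using that t q_less[of a] q_less[of _ t] by force
  show "w \<in> q ` {a<..<t}" if w: "w \<in> {0<..<q t}"
  proof -
    obtain s where s: "s \<in> {a..t}" "q s = w" using q_surj[of t w] t w by auto
    moreover have "s \<noteq> a" "s \<noteq> t" using s w by auto
    ultimately show ?thesis by force
  qed
qed

lemma \<Psi>_lipschitz:
  obtains K where "K > 0" "\<And>v w. v \<in> {0..L} \<Longrightarrow> w \<in> {0..L} \<Longrightarrow> \<bar>\<Psi> v - \<Psi> w\<bar> \<le> K * \<bar>v - w\<bar>"
proof -
  obtain m where m: "m > 0" "\<And>s t. a \<le> s \<Longrightarrow> s \<le> t \<Longrightarrow> t \<le> b \<Longrightarrow> m * (t - s) \<le> q t - q s"
    by (rule expansion) (rule that)
  have "\<bar>\<Psi> v - \<Psi> w\<bar> \<le> inverse m * \<bar>v - w\<bar>" if "v \<in> {0..L}" "w \<in> {0..L}" for v w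
  proof -
    have *: "q (\<Psi> v) = v" "\<Psi> v \<in> {a..b}" "q (\<Psi> w) = w" "\<Psi> w \<in> {a..b}"
      using q_\<Psi>[OF that(1)] q_\<Psi>[OF that(2)] by auto
    have "m * \<bar>\<Psi> v - \<Psi> w\<bar> \<le> \<bar>v - w\<bar>"
      using m(2)[of "\<Psi> v" "\<Psi> w"] m(2)[of "\<Psi> w" "\<Psi> v"] *
      by (cases "\<Psi> v \<le> \<Psi> w") (auto simp: abs_if)
    then show ?thesis using m(1) by (simp add: field_simps)
  qed
  with m(1) show thesis by (intro that[of "inverse m"]) auto
qed

lemma cont_\<Psi>: "continuous_on {0<..<L} \<Psi>"
proof -
  obtain K where K: "K > 0" "\<And>v w. v \<in> {0..L} \<Longrightarrow> w \<in> {0..L} \<Longrightarrow> \<bar>\<Psi> v - \<Psi> w\<bar> \<le> K * \<bar>v - w\<bar>"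
    by (rule \<Psi>_lipschitz) (rule that)
  have "K-lipschitz_on {0<..<L} \<Psi>"
    by (rule lipschitz_onI) (use K in \<open>auto simp: dist_real_def\<close>)
  then show ?thesis by (rule lipschitz_on_continuous_on)
qed

text \<open>
A component of \<open>u\<close> in the variable \<open>w = \<Phi> t - \<Phi> a\<close>.  The weight splits the exponential factor
\<open>e\<^bsup>c (w - v)\<^esup>\<close> of the proportional integral, which leaves a pure Abel convolution.
\<close>

definition hat :: "(real \<Rightarrow> cquat) \<Rightarrow> 4 \<Rightarrow> real \<Rightarrow> complex" where
  "hat u j v = (if v \<in> {0<..<L} then exp (- c * v) *\<^sub>R (u (\<Psi> v) $ j) else 0)"

lemma cont_hat:
  assumes "continuous_on {a<..<b} u"
  shows "continuous_on {0<..<L} (hat u j)"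
proof -
  have "continuous_on {0<..<L} (\<lambda>v. exp (- c * v) *\<^sub>R (u (\<Psi> v) $ j))"
    by (intro continuous_intros continuous_on_compose2[OF assms cont_\<Psi>]) (use \<Psi>_open in auto)
  then show ?thesis by (rule continuous_on_eq) (simp add: hat_def)
qed

lemma measurable_hat:
  assumes "continuous_on {a<..<b} u"
  shows "hat u j \<in> borel_measurable borel"
proof -
  have "hat u j = (\<lambda>x. indicator {0<..<L} x *\<^sub>R hat u j x)" by (auto simp: indicator_def fun_eq_iff hat_def)
  moreover have "(\<lambda>x. indicator {0<..<L} x *\<^sub>R hat u j x) \<in> borel_measurable borel"
    by (intro borel_measurable_continuous_on_indicator cont_hat assms) auto
  ultimately show ?thesis by simp
qed

text \<open>
The substitution \<open>v = q \<tau>\<close> absorbs the factor \<open>\<Phi>'\<close> of the integrand.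
\<close>

lemma change_of_variable:
  assumes u: "continuous_on {a<..<b} u" and t: "t \<in> {a<..b}"
  shows "set_integrable lborel {a<..<t} (frac_integrand \<beta> \<rho> \<Phi> u t) \<longleftrightarrow>
      (\<forall>j. integrable lborel (\<lambda>v. abel_kernel \<beta> (q t - v) * hat u j v))"
    and "set_integrable lborel {a<..<t} (frac_integrand \<beta> \<rho> \<Phi> u t) \<Longrightarrow>
      (LINT \<tau>:{a<..<t}|lborel. frac_integrand \<beta> \<rho> \<Phi> u t \<tau>) $ j
        = exp (c * q t) * (\<integral>v. abel_kernel \<beta> (q t - v) * hat u j v \<partial>lborel)"
proof -
  define w where "w = q t"
  define F :: "real \<Rightarrow> cquat" where "F v = (\<chi> j. exp (c * w) *\<^sub>R (abel_kernel \<beta> (w - v) * hat u j v))" for v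
  let ?I = "frac_integrand \<beta> \<rho> \<Phi> u t"
  let ?S = "{a<..<t}"
  have S: "?S \<subseteq> {a<..<b}" using t by auto
  have wL: "w \<le> L" using t q_less[of t b] by (cases "t = b") (auto simp: w_def L_def)
  note [measurable] = measurable_hat[OF u]
  have F_meas [measurable]: "F \<in> borel_measurable borel"
    by (rule borel_measurable_vecI) (simp add: F_def)
  have supp: "indicator {0<..<w} v *\<^sub>R F v = F v" for v
    using wL by (auto simp: F_def vec_eq_iff indicator_def hat_def)
  have pull: "?I \<tau> = \<bar>\<Phi>' \<tau>\<bar> *\<^sub>R F (q \<tau>)" if \<tau>: "\<tau> \<in> ?S" for \<tau>
  proof -
    have 1: "q \<tau> \<in> {0<..<L}" using q_open \<tau> S by blast
    have 2: "w - q \<tau> > 0" using \<tau> t q_less[of \<tau> t] by (simp add: w_def)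
    have 3: "\<Phi> t - \<Phi> \<tau> = w - q \<tau>" by (simp add: w_def q_def)
    have 4: "\<Psi> (q \<tau>) = \<tau>" using \<Psi>_q \<tau> t by auto
    have 5: "deriv \<Phi> \<tau> = \<Phi>' \<tau>" using deriv_Phi[of \<tau>] \<tau> S by (intro DERIV_imp_deriv) auto
    have 6: "\<bar>\<Phi>' \<tau>\<bar> = \<Phi>' \<tau>" using pos_Phi'[of \<tau>] \<tau> t by auto
    have 7: "exp ((\<rho> - 1) / \<rho> * (\<Phi> t - \<Phi> \<tau>)) = exp (c * w) * exp (- c * q \<tau>)"
      unfolding 3 c_def by (simp flip: exp_add add: algebra_simps)
    show ?thesis
      unfolding frac_integrand_def 5 6 7 unfolding 3
      by (simp add: vec_eq_iff F_def hat_def 1[unfolded greaterThanLessThan_iff] 4 abel_kernel_powr[OF 2])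
         (simp add: scaleR_conv_of_real mult_ac)
  qed
  have S_meas: "?S \<in> sets lebesgue" by simp
  have der: "(q has_real_derivative \<Phi>' x) (at x within ?S)" if "x \<in> ?S" for x
    using deriv_q that S has_field_derivative_at_within by blast
  have inj: "inj_on q ?S" by (rule inj_on_subset[OF inj_q]) (use t in auto)
  note image = q_image[OF t, folded w_def]
  have int_w: "set_integrable lborel {0<..<w} F \<longleftrightarrow> integrable lborel F"
    by (simp add: set_integrable_def supp)
  have I_meas: "set_borel_measurable borel ?S ?I"
  proof -
    define q1 where "q1 \<tau> = indicator ?S \<tau> *\<^sub>R q \<tau>" for \<tau>
    define d1 where "d1 \<tau> = indicator ?S \<tau> *\<^sub>R \<bar>\<Phi>' \<tau>\<bar>" for \<tau>
    have [measurable]: "q1 \<in> borel_measurable borel" "d1 \<in> borel_measurable borel"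
      unfolding q1_def[abs_def] d1_def[abs_def]
      by (intro borel_measurable_continuous_on_indicator continuous_intros
            continuous_on_subset[OF cont_q] continuous_on_subset[OF cont_Phi']; use t in auto)+
    have "(\<lambda>\<tau>. d1 \<tau> *\<^sub>R F (q1 \<tau>)) \<in> borel_measurable borel" by measurable
    moreover have "indicator ?S \<tau> *\<^sub>R ?I \<tau> = d1 \<tau> *\<^sub>R F (q1 \<tau>)" for \<tau>
      using pull[of \<tau>] by (cases "\<tau> \<in> ?S") (simp_all add: q1_def d1_def)
    ultimately show ?thesis by (simp add: set_borel_measurable_def)
  qed
  have F_meas': "set_borel_measurable borel {0<..<w} F" unfolding set_borel_measurable_def supp by simp
  have "set_integrable lborel ?S ?I \<longleftrightarrow> ?I absolutely_integrable_on ?S"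
    by (rule set_integrable_lebesgue_lborel[OF I_meas])
  also have "\<dots> \<longleftrightarrow> (\<lambda>x. \<bar>\<Phi>' x\<bar> *\<^sub>R F (q x)) absolutely_integrable_on ?S"
    by (rule set_integrable_cong[OF refl refl pull])
  also have "\<dots> \<longleftrightarrow> F absolutely_integrable_on q ` ?S"
    by (rule absolutely_integrable_change_of_variables_real[OF S_meas der inj, symmetric])
  also have "\<dots> \<longleftrightarrow> integrable lborel F"
    unfolding image using set_integrable_lebesgue_lborel[OF F_meas'] int_w by blast
  finally have iff: "set_integrable lborel ?S ?I \<longleftrightarrow> integrable lborel F" .
  also have "\<dots> \<longleftrightarrow> (\<forall>j. integrable lborel (\<lambda>v. exp (c * w) *\<^sub>R (abel_kernel \<beta> (w - v) * hat u j v)))"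
    unfolding integrable_vec_iff by (simp add: F_def)
  also have "\<dots> \<longleftrightarrow> (\<forall>j. integrable lborel (\<lambda>v. abel_kernel \<beta> (w - v) * hat u j v))"
    by (simp add: integrable_scaleR_iff)
  finally show "set_integrable lborel ?S ?I \<longleftrightarrow> (\<forall>j. integrable lborel (\<lambda>v. abel_kernel \<beta> (q t - v) * hat u j v))"
    by (simp add: w_def)
  assume int: "set_integrable lborel ?S ?I"
  then have intF: "integrable lborel F" using iff by simp
  have absF: "F absolutely_integrable_on q ` ?S"
    unfolding image using set_integrable_lebesgue_lborel[OF F_meas'] int_w intF by blast
  have "(LINT \<tau>:?S|lborel. ?I \<tau>) = integral ?S ?I" by (rule set_borel_integral_eq_integral(2)[OF int])
  also have "\<dots> = integral ?S (\<lambda>x. \<bar>\<Phi>' x\<bar> *\<^sub>R F (q x))"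
    by (rule Henstock_Kurzweil_Integration.integral_cong[OF pull])
  also have "\<dots> = integral (q ` ?S) F"
    using has_absolute_integral_change_of_variables_real[OF S_meas der inj, of F "integral (q ` ?S) F"] absF by blast
  also have "\<dots> = (LINT v:{0<..<w}|lborel. F v)"
    unfolding image using set_borel_integral_eq_integral(2)[of "{0<..<w}" F] int_w intF by simp
  also have "\<dots> = (\<integral>v. F v \<partial>lborel)" by (simp add: set_lebesgue_integral_def supp)
  finally have "(LINT \<tau>:?S|lborel. ?I \<tau>) $ j = (\<integral>v. F v $ j \<partial>lborel)" by (simp add: integral_vec_nth[OF intF])
  also have "\<dots> = exp (c * w) * (\<integral>v. abel_kernel \<beta> (w - v) * hat u j v \<partial>lborel)"
    by (simp add: F_def scaleR_conv_of_real)
  finally show "(LINT \<tau>:?S|lborel. ?I \<tau>) $ j = exp (c * q t) * (\<integral>v. abel_kernel \<beta> (q t - v) * hat u j v \<partial>lborel)"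
    by (simp add: w_def)
qed

definition norming :: "complex \<Rightarrow> complex" where
  "norming \<beta> = 1 / (complex_of_real \<rho> powr \<beta> * Gamma \<beta>)"

lemma norming_dual:
  assumes "0 < Re \<alpha>" "Re \<alpha> < 1"
  shows "norming \<alpha> * norming (1 - \<alpha>) * (Gamma \<alpha> * Gamma (1 - \<alpha>)) = 1 / of_real \<rho>"
proof -
  have "complex_of_real \<rho> powr \<alpha> * complex_of_real \<rho> powr (1 - \<alpha>) = of_real \<rho>"
    using rho by (simp flip: powr_add)
  then show ?thesis using Gamma_product_nonzero[OF assms] rho
    by (simp add: norming_def field_simps)
qed

lemma frac_integral_nth:
  assumes u: "continuous_on {a<..<b} u" and t: "t \<in> {a<..b}"
    and int: "\<And>j. integrable lborel (\<lambda>v. abel_kernel \<beta> (q t - v) * hat u j v)"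
  shows "frac_integral \<beta> \<rho> \<Phi> a u t $ j
     = norming \<beta> * exp (c * q t) * (\<integral>v. abel_kernel \<beta> (q t - v) * hat u j v \<partial>lborel)"
  using change_of_variable[OF u t, of \<beta>] int t
  by (simp add: frac_integral_def frac_integral_formula_def norming_def)

end

locale frac_integral_slice = frac_slice +
  fixes \<alpha> :: complex and u :: "real \<Rightarrow> cquat"
  assumes \<alpha>: "0 < Re \<alpha>" "Re \<alpha> < 1"
    and cont_u: "continuous_on {a<..<b} u"
    and int_u: "\<And>t. t \<in> {a<..<b} \<Longrightarrow> set_integrable lborel {a<..<t} (frac_integrand (1 - \<alpha>) \<rho> \<Phi> u t)"
begin

definition G :: "real \<Rightarrow> cquat" where "G = frac_integral (1 - \<alpha>) \<rho> \<Phi> a u"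

lemma abel_pair_hat: "abel_pair \<alpha> L (hat u j)"
proof
  show "0 < L" by (rule L_pos)
  show "continuous_on {0<..<L} (hat u j)" by (rule cont_hat[OF cont_u])
  show "hat u j x = 0" if "x \<notin> {0<..<L}" for x using that by (auto simp: hat_def)
  show "integrable lborel (\<lambda>v. abel_kernel (1 - \<alpha>) (w - v) * hat u j v)" if w: "w \<in> {0<..<L}" for w
  proof -
    have *: "\<Psi> w \<in> {a<..<b}" "q (\<Psi> w) = w" using \<Psi>_open[OF w] q_\<Psi>[of w] w by auto
    then show ?thesis using change_of_variable(1)[OF cont_u, of "\<Psi> w" "1 - \<alpha>"] int_u[of "\<Psi> w"] by auto
  qed
qed (use \<alpha> in auto)

abbreviation "g j \<equiv> abel_pair.g \<alpha> (hat u j)"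

lemma G_nth:
  assumes t: "t \<in> {a<..<b}"
  shows "G t $ j = norming (1 - \<alpha>) * exp (c * q t) * g j (q t)"
proof -
  have "integrable lborel (\<lambda>v. abel_kernel (1 - \<alpha>) (q t - v) * hat u j v)" for j
    using abel_pair.int_f[OF abel_pair_hat q_open[OF t]] .
  from frac_integral_nth[OF cont_u _ this] show ?thesis
    using t by (simp add: G_def abel_pair.g_def[OF abel_pair_hat])
qed

lemma norming_nonzero: "norming (1 - \<alpha>) \<noteq> 0" "norming \<alpha> \<noteq> 0"
  using norming_dual[OF \<alpha>] rho by auto

lemma g_eq:
  assumes w: "w \<in> {0<..<L}"
  shows "g j w = exp (- c * w) * (G (\<Psi> w) $ j) / norming (1 - \<alpha>)"
proof -
  have "q (\<Psi> w) = w" using q_\<Psi>[of w] w by auto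
  then have G: "G (\<Psi> w) $ j = norming (1 - \<alpha>) * exp (c * w) * g j w"
    using G_nth[OF \<Psi>_open[OF w], of j] by simp
  have "complex_of_real (exp (- c * w)) * of_real (exp (c * w)) = 1"
    by (simp flip: of_real_mult exp_add)
  moreover have "A * (n * B * x) / n = x" if "A * B = 1" "n \<noteq> 0" for A B n x :: complex
  proof -
    have "A * (n * B * x) / n = (A * B) * x" using that(2) by (simp add: field_simps)
    then show ?thesis using that(1) by simp
  qed
  ultimately show ?thesis unfolding G using norming_nonzero(1) by metis
qed

end

context frac_integral_slice
begin

context
  fixes \<Lambda> :: real
  assumes lip_G: "\<And>s t. s \<in> {a<..<b} \<Longrightarrow> t \<in> {a<..<b} \<Longrightarrow> norm (G s - G t) \<le> \<Lambda> * \<bar>s - t\<bar>"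
begin

lemma G_lipschitz_on: "\<bar>\<Lambda>\<bar>-lipschitz_on {a<..<b} G"
proof (rule lipschitz_onI)
  fix s t assume "s \<in> {a<..<b}" "t \<in> {a<..<b}"
  then have "norm (G s - G t) \<le> \<Lambda> * \<bar>s - t\<bar>" by (rule lip_G)
  also have "\<dots> \<le> \<bar>\<Lambda>\<bar> * \<bar>s - t\<bar>" by (intro mult_right_mono) auto
  finally show "dist (G s) (G t) \<le> \<bar>\<Lambda>\<bar> * dist s t" by (simp add: dist_norm)
qed simp

lemma G_bounded: "\<exists>C. \<forall>t\<in>{a<..<b}. norm (G t) \<le> C"
proof -
  have "bounded (G ` {a<..<b})"
    by (rule bounded_uniformly_continuous_image[OF lipschitz_on_uniformly_continuous[OF G_lipschitz_on]]) simp
  then show ?thesis by (auto simp: bounded_iff)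
qed

lemma cont_G_open: "continuous_on {a<..<b} G"
  by (rule lipschitz_on_continuous_on[OF G_lipschitz_on])

text \<open>
\<open>g j\<close> is, up to a constant, a component of \<open>G\<close> in the variable \<open>w\<close> times the smooth weight \<open>e\<^sup>-\<^sup>c\<^sup>w\<close>,
and the substitution is Lipschitz because \<open>\<Phi>'\<close> is bounded below.
\<close>

lemma g_regular:
  shows "\<exists>C. \<forall>w\<in>{0<..<L}. norm (g j w) \<le> C"
    and "\<exists>M. \<forall>v\<in>{0<..<L}. \<forall>w\<in>{0<..<L}. norm (g j v - g j w) \<le> M * \<bar>v - w\<bar>"
proof -
  obtain C where C: "\<And>t. t \<in> {a<..<b} \<Longrightarrow> norm (G t) \<le> C" using G_bounded by blast
  obtain K where K: "K > 0" "\<And>v w. v \<in> {0..L} \<Longrightarrow> w \<in> {0..L} \<Longrightarrow> \<bar>\<Psi> v - \<Psi> w\<bar> \<le> K * \<bar>v - w\<bar>"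
    by (rule \<Psi>_lipschitz) (rule that)
  have "norm (G (\<Psi> (L/2))) \<le> C" using L_pos by (intro C \<Psi>_open) auto
  then have C0: "C \<ge> 0" using norm_ge_zero order_trans by blast
  define E where "E = exp (\<bar>c\<bar> * L)"
  define e where "e w = exp (- c * w)" for w
  define H where "H w = G (\<Psi> w) $ j" for w
  have g: "g j w = (e w * H w) / norming (1 - \<alpha>)" if "w \<in> {0<..<L}" for w
    using g_eq[OF that, of j] by (simp add: e_def H_def)
  have eE: "\<bar>e w\<bar> \<le> E" if "w \<in> {0<..<L}" for w
  proof -
    have "- c * w \<le> \<bar>c\<bar> * w" using that by (intro mult_right_mono) auto
    also have "\<dots> \<le> \<bar>c\<bar> * L" using that by (intro mult_left_mono) auto
    finally show ?thesis by (simp add: e_def E_def)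
  qed
  have elip: "\<bar>e v - e w\<bar> \<le> (\<bar>c\<bar> * E) * \<bar>v - w\<bar>" if "v \<in> {0<..<L}" "w \<in> {0<..<L}" for v w
  proof -
    have "norm (e v - e w) \<le> (\<bar>c\<bar> * E) * norm (v - w)"
    proof (rule field_differentiable_bound[of "{0<..<L}" e "\<lambda>w. - c * e w"])
      show "(e has_field_derivative - c * e z) (at z within {0<..<L})" for z
        unfolding e_def by (auto intro!: derivative_eq_intros)
      show "norm (- c * e z) \<le> \<bar>c\<bar> * E" if "z \<in> {0<..<L}" for z
        using eE[OF that] by (simp add: abs_mult mult_left_mono)
    qed (use that in auto)
    then show ?thesis by simp
  qed
  have HC: "norm (H w) \<le> C" if "w \<in> {0<..<L}" for w
    unfolding H_def using Finite_Cartesian_Product.norm_nth_le C[OF \<Psi>_open[OF that]] order_trans by blast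
  have Hlip: "norm (H v - H w) \<le> (\<bar>\<Lambda>\<bar> * K) * \<bar>v - w\<bar>" if vw: "v \<in> {0<..<L}" "w \<in> {0<..<L}" for v w
  proof -
    have "norm (H v - H w) \<le> norm (G (\<Psi> v) - G (\<Psi> w))"
      unfolding H_def using Finite_Cartesian_Product.norm_nth_le[of "G (\<Psi> v) - G (\<Psi> w)" j] by simp
    also have "\<dots> \<le> \<bar>\<Lambda>\<bar> * \<bar>\<Psi> v - \<Psi> w\<bar>"
      using lipschitz_onD[OF G_lipschitz_on \<Psi>_open[OF vw(1)] \<Psi>_open[OF vw(2)]] by (simp add: dist_norm)
    also have "\<dots> \<le> \<bar>\<Lambda>\<bar> * (K * \<bar>v - w\<bar>)" using K(2)[of v w] vw by (intro mult_left_mono) auto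
    finally show ?thesis by simp
  qed
  let ?n = "norm (norming (1 - \<alpha>))"
  have n: "?n > 0" using norming_nonzero by simp
  have "norm (g j w) \<le> E * C / ?n" if "w \<in> {0<..<L}" for w
    using g[OF that] n mult_mono[OF eE[OF that] HC[OF that]] by (simp add: norm_mult norm_divide E_def divide_right_mono)
  then show "\<exists>C. \<forall>w\<in>{0<..<L}. norm (g j w) \<le> C" by blast
  have "norm (g j v - g j w) \<le> ((E * (\<bar>\<Lambda>\<bar> * K) + (\<bar>c\<bar> * E) * C) / ?n) * \<bar>v - w\<bar>"
    if vw: "v \<in> {0<..<L}" "w \<in> {0<..<L}" for v w
  proof -
    have "e v * H v - e w * H w = e v * (H v - H w) + (e v - e w) * H w" by (simp add: algebra_simps)
    then have "norm (e v * H v - e w * H w) \<le> \<bar>e v\<bar> * norm (H v - H w) + \<bar>e v - e w\<bar> * norm (H w)"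
      by (metis norm_mult norm_of_real norm_triangle_ineq of_real_diff)
    also have "\<dots> \<le> E * ((\<bar>\<Lambda>\<bar> * K) * \<bar>v - w\<bar>) + ((\<bar>c\<bar> * E) * \<bar>v - w\<bar>) * C"
      by (intro add_mono mult_mono eE elip HC Hlip vw) (auto simp: E_def)
    also have "\<dots> = (E * (\<bar>\<Lambda>\<bar> * K) + (\<bar>c\<bar> * E) * C) * \<bar>v - w\<bar>" by (simp add: algebra_simps)
    finally have 1: "norm (e v * H v - e w * H w) \<le> (E * (\<bar>\<Lambda>\<bar> * K) + (\<bar>c\<bar> * E) * C) * \<bar>v - w\<bar>" .
    have "norm (g j v - g j w) = norm (e v * H v - e w * H w) / ?n"
      unfolding g[OF vw(1)] g[OF vw(2)] by (simp add: norm_divide flip: diff_divide_distrib)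
    also have "\<dots> \<le> ((E * (\<bar>\<Lambda>\<bar> * K) + (\<bar>c\<bar> * E) * C) * \<bar>v - w\<bar>) / ?n" using 1 n by (intro divide_right_mono) auto
    finally show ?thesis by simp
  qed
  then show "\<exists>M. \<forall>v\<in>{0<..<L}. \<forall>w\<in>{0<..<L}. norm (g j v - g j w) \<le> M * \<bar>v - w\<bar>" by blast
qed

lemma cont_g: "continuous_on {0<..<L} (g j)"
proof -
  obtain M where M: "\<And>v w. v \<in> {0<..<L} \<Longrightarrow> w \<in> {0<..<L} \<Longrightarrow> norm (g j v - g j w) \<le> M * \<bar>v - w\<bar>"
    using g_regular(2)[of j] by blast
  have "\<bar>M\<bar>-lipschitz_on {0<..<L} (g j)"
  proof (rule lipschitz_onI)
    fix v w assume "v \<in> {0<..<L}" "w \<in> {0<..<L}"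
    then have "norm (g j v - g j w) \<le> M * \<bar>v - w\<bar>" by (rule M)
    also have "\<dots> \<le> \<bar>M\<bar> * \<bar>v - w\<bar>" by (intro mult_right_mono) auto
    finally show "dist (g j v) (g j w) \<le> \<bar>M\<bar> * dist v w" by (simp add: dist_norm)
  qed simp
  then show ?thesis by (rule lipschitz_on_continuous_on)
qed

lemma g_right_end:
  "integrable lborel (\<lambda>v. abel_kernel (1 - \<alpha>) (L - v) * hat u j v)" "(g j \<longlongrightarrow> g j L) (at_left L)"
proof -
  interpret ap: abel_pair \<alpha> L "hat u j" by (rule abel_pair_hat)
  obtain C where C: "\<And>w. w \<in> {0<..<L} \<Longrightarrow> norm (g j w) \<le> C" using g_regular(1)[of j] by blast
  obtain M where M: "\<And>v w. v \<in> {0<..<L} \<Longrightarrow> w \<in> {0<..<L} \<Longrightarrow> norm (g j v - g j w) \<le> M * \<bar>v - w\<bar>"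
    using g_regular(2)[of j] by blast
  have m: "0 < L / 2" "L / 2 < L" using L_pos by auto
  have "\<exists>B. \<forall>x. L / 2 \<le> x \<longrightarrow> x < L \<longrightarrow> norm (hat u j x) \<le> B"
    by (rule ap.bounded_near_right_end[OF cont_g C M m(1)])
  then obtain B where B: "\<And>x. L / 2 \<le> x \<Longrightarrow> x < L \<Longrightarrow> norm (hat u j x) \<le> B" by blast
  show "integrable lborel (\<lambda>v. abel_kernel (1 - \<alpha>) (L - v) * hat u j v)" by (rule ap.right_end(1)[OF m B])
  show "(g j \<longlongrightarrow> g j L) (at_left L)" by (rule ap.right_end(2)[OF m B])
qed

text \<open>
\<open>G b\<close> is an integral over the whole interval; that it exists and continues \<open>G\<close> is the content of
\<open>abel_pair.right_end\<close>.
\<close>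

lemma G_left_limit: "(G \<longlongrightarrow> G b) (at_left b)"
proof (rule vec_tendstoI)
  fix j
  have Gb: "G b $ j = norming (1 - \<alpha>) * exp (c * q b) * g j (q b)"
    using frac_integral_nth[OF cont_u _ g_right_end(1)[unfolded L_def]] ab
    by (simp add: G_def abel_pair.g_def[OF abel_pair_hat])
  have ev: "eventually (\<lambda>t. t \<in> {a<..<b}) (at_left b)"
    using eventually_at_left_real[OF ab] .
  have "continuous (at b within {a..b}) q" using cont_q ab by (simp add: continuous_on_eq_continuous_within)
  then have "(q \<longlongrightarrow> q b) (at b within {a..b})" by (simp add: continuous_within)
  then have ql: "(q \<longlongrightarrow> q b) (at_left b)" using ab by (simp add: at_within_Icc_at_left)
  have "filterlim q (at_left L) (at_left b)"
    unfolding filterlim_at L_def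
  proof
    show "eventually (\<lambda>t. q t \<in> {..<q b} \<and> q t \<noteq> q b) (at_left b)"
      using ev
    proof eventually_elim
      case (elim t)
      then show ?case using q_open[of t] by (auto simp: L_def)
    qed
  qed (rule ql)
  from filterlim_compose[OF g_right_end(2) this]
  have "((\<lambda>t. g j (q t)) \<longlongrightarrow> g j (q b)) (at_left b)" by (simp add: L_def)
  then have "((\<lambda>t. norming (1 - \<alpha>) * exp (c * q t) * g j (q t)) \<longlongrightarrow> G b $ j) (at_left b)"
    unfolding Gb by (intro tendsto_intros ql)
  then show "((\<lambda>t. G t $ j) \<longlongrightarrow> G b $ j) (at_left b)"
  proof (rule Lim_transform_eventually)
    show "eventually (\<lambda>t. norming (1 - \<alpha>) * exp (c * q t) * g j (q t) = G t $ j) (at_left b)"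
      using ev by eventually_elim (simp add: G_nth)
  qed
qed

text \<open>
A Lipschitz function extends continuously to the closed interval.  The extension agrees with \<open>G\<close> at
\<open>a\<close>, where \<open>G\<close> is defined as a limit, and at \<open>b\<close> by \<open>G_left_limit\<close>.
\<close>

lemma continuous_G: "continuous_on {a..b} G"
proof -
  have "uniformly_continuous_on {a<..<b} G"
    by (rule lipschitz_on_uniformly_continuous[OF G_lipschitz_on])
  then obtain E where E: "uniformly_continuous_on (closure {a<..<b}) E" "\<And>t. t \<in> {a<..<b} \<Longrightarrow> G t = E t"
    by (rule uniformly_continuous_on_extension_on_closure) (rule that)
  have cl: "closure {a<..<b} = {a..b}" using ab by simp
  have cE: "continuous_on {a..b} E" using E(1) uniformly_continuous_imp_continuous unfolding cl by blast
  have lim: "(E \<longlongrightarrow> E a) (at_right a)" "(E \<longlongrightarrow> E b) (at_left b)"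
    using cE ab by (auto simp: continuous_on_def at_within_Icc_at_right[symmetric] at_within_Icc_at_left[symmetric])
  have evl: "eventually (\<lambda>t. t \<in> {a<..<b}) (at_left b)" and evr: "eventually (\<lambda>t. t \<in> {a<..<b}) (at_right a)"
    using eventually_at_left_real[OF ab] eventually_at_right_real[OF ab] .
  have "(G \<longlongrightarrow> E b) (at_left b)"
    by (rule Lim_transform_eventually[OF lim(2)]) (use evl E(2) in \<open>auto elim: eventually_mono\<close>)
  then have b: "G b = E b" using G_left_limit by (intro tendsto_unique[OF trivial_limit_at_left_real])
  have "(frac_integral_formula (1 - \<alpha>) \<rho> \<Phi> a u \<longlongrightarrow> E a) (at_right a)"
  proof (rule Lim_transform_eventually[OF lim(1)])
    show "eventually (\<lambda>t. E t = frac_integral_formula (1 - \<alpha>) \<rho> \<Phi> a u t) (at_right a)"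
      using evr by eventually_elim (use E(2) in \<open>auto simp: G_def frac_integral_def\<close>)
  qed
  then have a: "G a = E a"
    by (simp add: G_def frac_integral_def tendsto_Lim)
  have "E t = G t" if "t \<in> {a..b}" for t
    using a b E(2)[of t] that by (cases "t = a"; cases "t = b") auto
  then show ?thesis by (rule continuous_on_eq[OF cE])
qed

lemma integrable_hat_G:
  assumes w: "w < L"
  shows "integrable lborel (\<lambda>v. abel_kernel \<alpha> (w - v) * hat G j v)"
proof -
  obtain C where C: "\<And>w. w \<in> {0<..<L} \<Longrightarrow> norm (g j w) \<le> C" using g_regular(1)[of j] by blast
  note [measurable] = measurable_hat[OF cont_G_open]
  have k: "integrable lborel (\<lambda>s. indicator {..<L} s *\<^sub>R abel_kernel \<alpha> s)"
    by (rule integrable_abel_kernel_bounded[OF \<alpha>(1)])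
  have k': "integrable lborel (\<lambda>v. indicator {..<L} (w - v) *\<^sub>R abel_kernel \<alpha> (w - v))"
    using lborel_integrable_real_affine[OF k, of "-1" w] by simp
  let ?n = "norm (norming (1 - \<alpha>))"
  have hat: "hat G j v = norming (1 - \<alpha>) * g j v" if "v \<in> {0<..<L}" for v
    using g_eq[OF that, of j] that norming_nonzero by (simp add: hat_def scaleR_conv_of_real)
  show ?thesis
  proof (rule Bochner_Integration.integrable_bound)
    show "integrable lborel (\<lambda>v. (?n * C) *\<^sub>R norm (indicator {..<L} (w - v) *\<^sub>R abel_kernel \<alpha> (w - v)))"
      using k' by (intro integrable_scaleR_right integrable_norm)
    have "norm (abel_kernel \<alpha> (w - v) * hat G j v) \<le> norm ((?n * C) *\<^sub>R norm (indicator {..<L} (w - v) *\<^sub>R abel_kernel \<alpha> (w - v)))" for v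
    proof (cases "v \<in> {0<..<L}")
      case True
      have "norm (abel_kernel \<alpha> (w - v) * hat G j v) \<le> norm (abel_kernel \<alpha> (w - v)) * (?n * C)"
        unfolding hat[OF True] norm_mult using C[OF True] by (intro mult_left_mono) auto
      also have "\<dots> \<le> norm (abel_kernel \<alpha> (w - v)) * \<bar>?n * C\<bar>" by (intro mult_left_mono) auto
      finally show ?thesis using True w by (simp add: mult.commute)
    qed (auto simp: hat_def)
    then show "AE v in lborel. norm (abel_kernel \<alpha> (w - v) * hat G j v) \<le> norm ((?n * C) *\<^sub>R norm (indicator {..<L} (w - v) *\<^sub>R abel_kernel \<alpha> (w - v)))"
      by simp
  qed measurable
qed

lemma convolution_hat_G:
  assumes w: "w < L"
  shows "(\<integral>v. abel_kernel \<alpha> (w - v) * hat G j v \<partial>lborel)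
    = norming (1 - \<alpha>) * (Gamma \<alpha> * Gamma (1 - \<alpha>)) * (LINT v:{..<w}|lborel. hat u j v)"
proof -
  have eq: "abel_kernel \<alpha> (w - v) * hat G j v = norming (1 - \<alpha>) * (abel_kernel \<alpha> (w - v) * g j v)" for v
  proof -
    consider "v \<le> 0" | "v \<in> {0<..<L}" | "L \<le> v" by force
    then show ?thesis
    proof cases
      case 1
      then show ?thesis using abel_pair.g_nonpos[OF abel_pair_hat, of v] by (simp add: hat_def)
    next
      case 2
      then show ?thesis using g_eq[OF 2, of j] norming_nonzero by (simp add: hat_def scaleR_conv_of_real)
    next
      case 3
      then show ?thesis using w by simp
    qed
  qed
  show ?thesis unfolding eq integral_mult_right_zero abel_pair.inversion[OF abel_pair_hat w] by (simp add: mult.assoc)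
qed

end

text \<open>
In the mixed terms of the formula a fractional derivative acts on a constant.  The fractional integral
of a constant is differentiable, being a multiple of a primitive of \<open>s\<^bsup>\<alpha>-1\<^esup> e\<^bsup>c s\<^esup>\<close> in the variable \<open>w\<close>;
therefore these terms are additive in the constant.
\<close>

lemma integrable_hat_const:
  assumes w: "w < L"
  shows "integrable lborel (\<lambda>v. abel_kernel \<alpha> (w - v) * hat (\<lambda>_. d) j v)"
proof -
  note [measurable] = measurable_hat[OF continuous_on_const, of d]
  have k: "integrable lborel (\<lambda>s. indicator {..<L} s *\<^sub>R abel_kernel \<alpha> s)"
    by (rule integrable_abel_kernel_bounded[OF \<alpha>(1)])
  have k': "integrable lborel (\<lambda>v. indicator {..<L} (w - v) *\<^sub>R abel_kernel \<alpha> (w - v))"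
    using lborel_integrable_real_affine[OF k, of "-1" w] by simp
  have "continuous_on {0..L} (\<lambda>v. exp (- c * v))" by (intro continuous_intros)
  then have "bounded ((\<lambda>v. exp (- c * v)) ` {0..L})" by (intro compact_imp_bounded compact_continuous_image) auto
  then obtain B where "\<forall>x\<in>(\<lambda>v. exp (- c * v)) ` {0..L}. norm x \<le> B" unfolding bounded_iff by blast
  then have B: "\<And>v. v \<in> {0..L} \<Longrightarrow> exp (- c * v) \<le> B" by auto
  show ?thesis
  proof (rule Bochner_Integration.integrable_bound)
    show "integrable lborel (\<lambda>v. (B * norm (d $ j)) *\<^sub>R norm (indicator {..<L} (w - v) *\<^sub>R abel_kernel \<alpha> (w - v)))"
      using k' by (intro integrable_scaleR_right integrable_norm)
    have "norm (abel_kernel \<alpha> (w - v) * hat (\<lambda>_. d) j v) \<le> norm ((B * norm (d $ j)) *\<^sub>R norm (indicator {..<L} (w - v) *\<^sub>R abel_kernel \<alpha> (w - v)))" for v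
    proof (cases "v \<in> {0<..<L}")
      case True
      have "norm (hat (\<lambda>_. d) j v) \<le> B * norm (d $ j)"
        using B[of v] True by (simp add: hat_def mult_right_mono)
      also have "\<dots> \<le> \<bar>B * norm (d $ j)\<bar>" by simp
      finally have "norm (abel_kernel \<alpha> (w - v)) * norm (hat (\<lambda>_. d) j v) \<le> norm (abel_kernel \<alpha> (w - v)) * \<bar>B * norm (d $ j)\<bar>"
        by (intro mult_left_mono) auto
      then show ?thesis using True w by (simp add: norm_mult abs_mult mult_ac)
    qed (auto simp: hat_def)
    then show "AE v in lborel. norm (abel_kernel \<alpha> (w - v) * hat (\<lambda>_. d) j v) \<le> norm ((B * norm (d $ j)) *\<^sub>R norm (indicator {..<L} (w - v) *\<^sub>R abel_kernel \<alpha> (w - v)))"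
      by simp
  qed measurable
qed

lemma frac_integral_const_nth:
  assumes t: "t \<in> {a<..<b}"
  shows "frac_integral \<alpha> \<rho> \<Phi> a (\<lambda>_. d) t $ j
    = norming \<alpha> * (LINT s:{..<q t}|lborel. abel_kernel \<alpha> s * of_real (exp (c * s))) * (d $ j)"
proof -
  have w: "q t < L" "0 < q t" using q_open[OF t] by auto
  have "frac_integral \<alpha> \<rho> \<Phi> a (\<lambda>_. d) t $ j = norming \<alpha> * exp (c * q t) * (\<integral>v. abel_kernel \<alpha> (q t - v) * hat (\<lambda>_. d) j v \<partial>lborel)"
    by (rule frac_integral_nth[OF continuous_on_const _ integrable_hat_const[OF w(1)]]) (use t in auto)
  also have "(\<integral>v. abel_kernel \<alpha> (q t - v) * hat (\<lambda>_. d) j v \<partial>lborel) = (\<integral>s. abel_kernel \<alpha> s * hat (\<lambda>_. d) j (q t - s) \<partial>lborel)"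
    using lborel_integral_real_affine[of "-1" "\<lambda>v. abel_kernel \<alpha> (q t - v) * hat (\<lambda>_. d) j v" "q t"] by simp
  also have "\<dots> = (\<integral>s. (exp (- c * q t) * d $ j) * (indicator {..<q t} s *\<^sub>R (abel_kernel \<alpha> s * of_real (exp (c * s)))) \<partial>lborel)"
  proof (rule Bochner_Integration.integral_cong[OF refl])
    fix s
    show "abel_kernel \<alpha> s * hat (\<lambda>_. d) j (q t - s) = (exp (- c * q t) * d $ j) * (indicator {..<q t} s *\<^sub>R (abel_kernel \<alpha> s * of_real (exp (c * s))))"
    proof (cases "0 < s \<and> s < q t")
      case True
      then have "hat (\<lambda>_. d) j (q t - s) = of_real (exp (- c * (q t - s))) * d $ j"
        using w by (simp add: hat_def scaleR_conv_of_real)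
      also have "exp (- c * (q t - s)) = exp (- c * q t) * exp (c * s)"
        by (simp flip: exp_add add: algebra_simps)
      finally show ?thesis using True by (simp add: mult_ac)
    next
      case False
      then show ?thesis by (auto simp: hat_def indicator_def)
    qed
  qed
  also have "\<dots> = (exp (- c * q t) * d $ j) * (LINT s:{..<q t}|lborel. abel_kernel \<alpha> s * of_real (exp (c * s)))"
    unfolding integral_mult_right_zero set_lebesgue_integral_def ..
  finally have "frac_integral \<alpha> \<rho> \<Phi> a (\<lambda>_. d) t $ j = (complex_of_real (exp (c * q t)) * of_real (exp (- c * q t)))
     * (norming \<alpha> * (LINT s:{..<q t}|lborel. abel_kernel \<alpha> s * of_real (exp (c * s))) * (d $ j))"
    by (simp only: mult_ac)
  also have "complex_of_real (exp (c * q t)) * of_real (exp (- c * q t)) = 1"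
    by (simp flip: of_real_mult exp_add)
  finally show ?thesis by simp
qed

lemma frac_integral_const_differentiable:
  assumes t: "t \<in> {a<..<b}"
  shows "\<exists>D. (frac_integral \<alpha> \<rho> \<Phi> a (\<lambda>_. d) has_vector_derivative D) (at t)"
proof -
  define k where "k s = abel_kernel \<alpha> s * complex_of_real (exp (c * s))" for s
  define I where "I w = (LINT s:{..<w}|lborel. k s)" for w
  have [measurable]: "k \<in> borel_measurable borel" unfolding k_def by measurable
  have cont: "continuous_on {0<..<L} k"
    unfolding k_def by (intro continuous_intros continuous_on_subset[OF continuous_abel_kernel]) auto
  have int: "set_integrable lborel {..<w} k" if "w < L" for w
    unfolding set_integrable_def
  proof (rule Bochner_Integration.integrable_bound)
    show "integrable lborel (\<lambda>s. exp (\<bar>c\<bar> * L) *\<^sub>R (indicator {..<L} s *\<^sub>R abel_kernel \<alpha> s))"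
      by (intro integrable_scaleR_right integrable_abel_kernel_bounded[OF \<alpha>(1)])
    have "norm (indicator {..<w} s *\<^sub>R k s) \<le> norm (exp (\<bar>c\<bar> * L) *\<^sub>R (indicator {..<L} s *\<^sub>R abel_kernel \<alpha> s))" for s
    proof (cases "0 < s \<and> s < w")
      case True
      have "c * s \<le> \<bar>c\<bar> * s" using True by (intro mult_right_mono) auto
      also have "\<dots> \<le> \<bar>c\<bar> * L" using True that by (intro mult_left_mono) auto
      finally have "exp (c * s) \<le> exp (\<bar>c\<bar> * L)" by simp
      then have "exp (c * s) * norm (abel_kernel \<alpha> s) \<le> exp (\<bar>c\<bar> * L) * norm (abel_kernel \<alpha> s)"
        by (intro mult_right_mono) auto
      then show ?thesis using True that by (simp add: k_def norm_mult mult.commute)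
    next
      case False
      then show ?thesis by (auto simp: k_def indicator_def)
    qed
    then show "AE s in lborel. norm (indicator {..<w} s *\<^sub>R k s) \<le> norm (exp (\<bar>c\<bar> * L) *\<^sub>R (indicator {..<L} s *\<^sub>R abel_kernel \<alpha> s))"
      by simp
  qed measurable
  have "(I has_vector_derivative k (q t)) (at (q t))"
    unfolding I_def by (rule primitive_has_vector_derivative[OF cont int q_open[OF t]])
  from vector_diff_chain_at[OF deriv_q[OF t, unfolded has_real_derivative_iff_has_vector_derivative] this]
  have dI: "((\<lambda>t. I (q t)) has_vector_derivative \<Phi>' t *\<^sub>R k (q t)) (at t)" by (simp add: o_def)
  define D where "D = (\<chi> j. (norming \<alpha> * d $ j) * (\<Phi>' t *\<^sub>R k (q t)))"
  have "(frac_integral \<alpha> \<rho> \<Phi> a (\<lambda>_. d) has_vector_derivative D) (at t)"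
  proof (rule has_vector_derivative_vecI)
    fix j
    have "((\<lambda>t. (norming \<alpha> * d $ j) * I (q t)) has_vector_derivative D $ j) (at t)"
      using bounded_linear.has_vector_derivative[OF bounded_linear_mult_right dI] by (simp add: D_def)
    then show "((\<lambda>t. frac_integral \<alpha> \<rho> \<Phi> a (\<lambda>_. d) t $ j) has_vector_derivative D $ j) (at t)"
      by (rule has_vector_derivative_transform_within_open[of _ _ _ "{a<..<b}"])
         (use t in \<open>auto simp: frac_integral_const_nth I_def k_def mult_ac\<close>)
  qed
  then show ?thesis by blast
qed

lemma frac_integral_const_add:
  assumes t: "t \<in> {a<..<b}"
  shows "frac_integral \<alpha> \<rho> \<Phi> a (\<lambda>_. d + e) t = frac_integral \<alpha> \<rho> \<Phi> a (\<lambda>_. d) t + frac_integral \<alpha> \<rho> \<Phi> a (\<lambda>_. e) t"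
  by (simp add: vec_eq_iff frac_integral_const_nth[OF t] algebra_simps)

lemma frac_deriv_const_add:
  assumes t: "t \<in> {a<..<b}"
  shows "frac_deriv (1 - \<alpha>) \<rho> \<Phi> a (\<lambda>_. d + e) t = frac_deriv (1 - \<alpha>) \<rho> \<Phi> a (\<lambda>_. d) t + frac_deriv (1 - \<alpha>) \<rho> \<Phi> a (\<lambda>_. e) t"
proof -
  obtain D E where D: "(frac_integral \<alpha> \<rho> \<Phi> a (\<lambda>_. d) has_vector_derivative D) (at t)"
    and E: "(frac_integral \<alpha> \<rho> \<Phi> a (\<lambda>_. e) has_vector_derivative E) (at t)"
    using frac_integral_const_differentiable[OF t] by metis
  have "(frac_integral \<alpha> \<rho> \<Phi> a (\<lambda>_. d + e) has_vector_derivative D + E) (at t)"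
    by (rule has_vector_derivative_transform_within_open[OF has_vector_derivative_add[OF D E], of "{a<..<b}"])
       (use t frac_integral_const_add in auto)
  then show ?thesis
    using D E by (simp add: frac_deriv_def Let_def vector_derivative_at frac_integral_const_add[OF t] scaleR_right_distrib)
qed

text \<open>
By Abel's inversion the fractional integral of \<open>G\<close> is
\<open>A t = \<rho>\<^sup>-\<^sup>1 e\<^bsup>c q(t)\<^esup> \<integral> e\<^bsup>- c v\<^esup> u dv\<close> over \<open>(0, q(t))\<close>, in the variable \<open>v\<close>.  The operator
\<open>(1 - \<rho>) + (\<rho> / \<Phi>') d/dt\<close> annihilates \<open>e\<^bsup>c q(t)\<^esup>\<close>, because \<open>1 - \<rho> + \<rho> c = 0\<close>, and so
only the derivative of the integral remains.
\<close>

lemma frac_deriv_G: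
  assumes lip_G: "\<And>s t. s \<in> {a<..<b} \<Longrightarrow> t \<in> {a<..<b} \<Longrightarrow> norm (G s - G t) \<le> \<Lambda> * \<bar>s - t\<bar>"
    and t: "t \<in> {a<..<b}"
  shows "frac_deriv (1 - \<alpha>) \<rho> \<Phi> a (\<lambda>\<tau>. G \<tau> + d) t = u t + frac_deriv (1 - \<alpha>) \<rho> \<Phi> a (\<lambda>_. d) t"
proof -
  note lip = lip_G
  define A :: "real \<Rightarrow> cquat" where "A t = (\<chi> j. (exp (c * q t) / of_real \<rho>) * (LINT v:{..<q t}|lborel. hat u j v))" for t
  have split: "frac_integral \<alpha> \<rho> \<Phi> a (\<lambda>\<tau>. G \<tau> + d) s = A s + frac_integral \<alpha> \<rho> \<Phi> a (\<lambda>_. d) s"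
    if s: "s \<in> {a<..<b}" for s
  proof -
    have w: "q s < L" using q_open[OF s] by simp
    have cont: "continuous_on {a<..<b} (\<lambda>\<tau>. G \<tau> + d)" by (intro continuous_intros cont_G_open[OF lip])
    have hat: "hat (\<lambda>\<tau>. G \<tau> + d) j v = hat G j v + hat (\<lambda>_. d) j v" for j v
      by (simp add: hat_def scaleR_right_distrib)
    have int1: "integrable lborel (\<lambda>v. abel_kernel \<alpha> (q s - v) * hat G j v)" for j
      by (rule integrable_hat_G[OF lip w])
    have conv: "(\<integral>v. abel_kernel \<alpha> (q s - v) * hat G j v \<partial>lborel)
        = norming (1 - \<alpha>) * (Gamma \<alpha> * Gamma (1 - \<alpha>)) * (LINT v:{..<q s}|lborel. hat u j v)" for j
      by (rule convolution_hat_G[OF lip w])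
    note int2 = integrable_hat_const[OF w, of d]
    have "frac_integral \<alpha> \<rho> \<Phi> a (\<lambda>\<tau>. G \<tau> + d) s $ j = A s $ j + frac_integral \<alpha> \<rho> \<Phi> a (\<lambda>_. d) s $ j" for j
    proof -
      have "frac_integral \<alpha> \<rho> \<Phi> a (\<lambda>\<tau>. G \<tau> + d) s $ j
          = norming \<alpha> * exp (c * q s) * (\<integral>v. abel_kernel \<alpha> (q s - v) * hat (\<lambda>\<tau>. G \<tau> + d) j v \<partial>lborel)"
        by (rule frac_integral_nth[OF cont]) (use s int1 int2 in \<open>auto simp: hat distrib_left\<close>)
      also have "(\<integral>v. abel_kernel \<alpha> (q s - v) * hat (\<lambda>\<tau>. G \<tau> + d) j v \<partial>lborel)
          = norming (1 - \<alpha>) * (Gamma \<alpha> * Gamma (1 - \<alpha>)) * (LINT v:{..<q s}|lborel. hat u j v)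
            + (\<integral>v. abel_kernel \<alpha> (q s - v) * hat (\<lambda>_. d) j v \<partial>lborel)"
        unfolding hat distrib_left Bochner_Integration.integral_add[OF int1 int2] conv ..
      finally have "frac_integral \<alpha> \<rho> \<Phi> a (\<lambda>\<tau>. G \<tau> + d) s $ j
        = (norming \<alpha> * norming (1 - \<alpha>) * (Gamma \<alpha> * Gamma (1 - \<alpha>))) * exp (c * q s) * (LINT v:{..<q s}|lborel. hat u j v)
         + norming \<alpha> * exp (c * q s) * (\<integral>v. abel_kernel \<alpha> (q s - v) * hat (\<lambda>_. d) j v \<partial>lborel)"
        by (simp only: distrib_left mult_ac)
      also have "norming \<alpha> * exp (c * q s) * (\<integral>v. abel_kernel \<alpha> (q s - v) * hat (\<lambda>_. d) j v \<partial>lborel)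
          = frac_integral \<alpha> \<rho> \<Phi> a (\<lambda>_. d) s $ j"
        by (rule frac_integral_nth[OF continuous_on_const _ int2, symmetric]) (use s in auto)
      finally show ?thesis unfolding norming_dual[OF \<alpha>] by (simp add: A_def)
    qed
    then show ?thesis by (simp add: vec_eq_iff)
  qed
  obtain D where D: "(frac_integral \<alpha> \<rho> \<Phi> a (\<lambda>_. d) has_vector_derivative D) (at t)"
    using frac_integral_const_differentiable[OF t] by blast
  have dA: "(A has_vector_derivative \<Phi>' t *\<^sub>R (c *\<^sub>R A t + inverse \<rho> *\<^sub>R u t)) (at t)"
  proof (rule has_vector_derivative_vecI)
    fix j
    define Q where "Q w = (LINT v:{..<w}|lborel. hat u j v)" for w
    define e where "e w = complex_of_real (exp (c * w) / \<rho>)" for w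
    have "(Q has_vector_derivative hat u j (q t)) (at (q t))"
      unfolding Q_def by (rule abel_pair.primitive_derivative[OF abel_pair_hat q_open[OF t]])
    moreover have "(e has_vector_derivative of_real c * e (q t)) (at (q t))"
    proof -
      have "((\<lambda>w. exp (c * w) / \<rho>) has_real_derivative c * (exp (c * q t) / \<rho>)) (at (q t))"
        using rho by (auto intro!: derivative_eq_intros)
      then have "((\<lambda>w. complex_of_real (exp (c * w) / \<rho>)) has_vector_derivative complex_of_real (c * (exp (c * q t) / \<rho>))) (at (q t))"
        by (rule has_vector_derivative_of_real)
      then show ?thesis by (simp add: e_def[abs_def])
    qed
    ultimately have "((\<lambda>w. e w * Q w) has_vector_derivative e (q t) * hat u j (q t) + of_real c * e (q t) * Q (q t)) (at (q t))"
      by (intro has_vector_derivative_mult)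
    from vector_diff_chain_at[OF deriv_q[OF t, unfolded has_real_derivative_iff_has_vector_derivative] this]
    have 1: "((\<lambda>t. e (q t) * Q (q t)) has_vector_derivative \<Phi>' t *\<^sub>R (e (q t) * hat u j (q t) + of_real c * e (q t) * Q (q t))) (at t)"
      by (simp add: o_def)
    have A: "A s $ j = e (q s) * Q (q s)" for s by (simp add: A_def e_def Q_def)
    have "complex_of_real (exp (c * q t)) * of_real (exp (- c * q t)) = 1"
      by (simp flip: of_real_mult exp_add)
    then have "e (q t) * hat u j (q t) = inverse \<rho> *\<^sub>R (u t $ j)"
      using q_open[OF t] \<Psi>_q[of t] t rho
      by (simp add: e_def hat_def scaleR_conv_of_real divide_inverse)
    with 1 show "((\<lambda>t. A t $ j) has_vector_derivative (\<Phi>' t *\<^sub>R (c *\<^sub>R A t + inverse \<rho> *\<^sub>R u t)) $ j) (at t)"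
      by (simp add: A scaleR_conv_of_real[of c "x :: complex" for x] mult.assoc add.commute)
  qed
  define Y where "Y = \<Phi>' t *\<^sub>R (c *\<^sub>R A t + inverse \<rho> *\<^sub>R u t)"
  have v: "(frac_integral \<alpha> \<rho> \<Phi> a (\<lambda>\<tau>. G \<tau> + d) has_vector_derivative Y + D) (at t)"
    unfolding Y_def
    by (rule has_vector_derivative_transform_within_open[OF has_vector_derivative_add[OF dA D], of "{a<..<b}"])
       (use t split in auto)
  have d\<Phi>: "deriv \<Phi> t = \<Phi>' t" using deriv_Phi[OF t] by (rule DERIV_imp_deriv)
  have p: "\<Phi>' t > 0" using t by (intro pos_Phi') auto
  have Y: "(1 - \<rho>) *\<^sub>R A t + (\<rho> / \<Phi>' t) *\<^sub>R Y = u t"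
  proof -
    have "\<rho> * c = \<rho> - 1" using rho by (simp add: c_def)
    then have "(1 - \<rho>) *\<^sub>R A t + (\<rho> * c) *\<^sub>R A t = 0" by (simp flip: scaleR_left_distrib)
    then show ?thesis using p rho by (simp add: Y_def scaleR_right_distrib add.assoc[symmetric])
  qed
  define X where "X = frac_integral \<alpha> \<rho> \<Phi> a (\<lambda>_. d) t"
  have "frac_deriv (1 - \<alpha>) \<rho> \<Phi> a (\<lambda>\<tau>. G \<tau> + d) t = (1 - \<rho>) *\<^sub>R (A t + X) + (\<rho> / \<Phi>' t) *\<^sub>R (Y + D)"
    using v by (simp only: frac_deriv_def Let_def diff_diff_eq2 add_diff_cancel_left' vector_derivative_at split[OF t] d\<Phi> X_def)
  also have "\<dots> = ((1 - \<rho>) *\<^sub>R A t + (\<rho> / \<Phi>' t) *\<^sub>R Y) + ((1 - \<rho>) *\<^sub>R X + (\<rho> / \<Phi>' t) *\<^sub>R D)"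
    by (simp only: scaleR_right_distrib ac_simps)
  also have "(1 - \<rho>) *\<^sub>R X + (\<rho> / \<Phi>' t) *\<^sub>R D = frac_deriv (1 - \<alpha>) \<rho> \<Phi> a (\<lambda>_. d) t"
    using D by (simp only: frac_deriv_def Let_def diff_diff_eq2 add_diff_cancel_left' vector_derivative_at d\<Phi> X_def)
  finally show ?thesis unfolding Y .
qed

end

section \<open>Linear differential equations up to the boundary\<close>

text \<open>
Gronwall's argument for \<open>n = 1 + |G|\<^sup>2\<close>: from \<open>|n'| \<le> 4 K n\<close> it follows that \<open>n\<close> is bounded, hence so
is \<open>G'\<close>.
\<close>

lemma gronwall_lipschitz:
  fixes G G' :: "real \<Rightarrow> 'b::euclidean_space"
  assumes ab: "a < b"
    and deriv: "\<And>t. t \<in> {a<..<b} \<Longrightarrow> (G has_vector_derivative G' t) (at t)"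
    and le: "\<And>t. t \<in> {a<..<b} \<Longrightarrow> norm (G' t) \<le> K * (norm (G t) + 1)"
  shows "\<exists>M. \<forall>s\<in>{a<..<b}. \<forall>t\<in>{a<..<b}. norm (G s - G t) \<le> M * \<bar>s - t\<bar>"
proof -
  define n where "n t = 1 + G t \<bullet> G t" for t
  define n' where "n' t = 2 * (G t \<bullet> G' t)" for t
  define m where "m = (a + b) / 2"
  have m: "a < m" "m < b" using ab by (auto simp: m_def)
  have "0 \<le> K * (norm (G m) + 1)" using le[of m] m order_trans[OF norm_ge_zero] by simp
  moreover have "norm (G m) + 1 > 0" by (simp add: add_nonneg_pos)
  ultimately have K: "K \<ge> 0" using mult_neg_pos[of K "norm (G m) + 1"] by linarith
  have quadratic: "2 * x * (x + 1) \<le> 4 * (1 + x\<^sup>2)" "2 * x \<le> 1 + x\<^sup>2" for x :: real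
  proof -
    have "0 \<le> (x - 1)\<^sup>2" by simp
    then show 1: "2 * x \<le> 1 + x\<^sup>2" by (simp add: power2_eq_square algebra_simps)
    have 2: "2 * x * (x + 1) = 2 * x\<^sup>2 + 2 * x" by (simp add: power2_eq_square algebra_simps)
    define y where "y = x\<^sup>2"
    have "0 \<le> y" "2 * x \<le> 1 + y" using 1 by (simp_all add: y_def)
    then have "2 * y + 2 * x \<le> 4 * (1 + y)" by (simp add: algebra_simps)
    then show "2 * x * (x + 1) \<le> 4 * (1 + x\<^sup>2)" unfolding 2 y_def .
  qed
  have n_ge: "n t \<ge> 1" for t by (simp add: n_def)
  have dn: "(n has_real_derivative n' t) (at t)" if "t \<in> {a<..<b}" for t
  proof -
    have "((\<lambda>t. G t \<bullet> G t) has_vector_derivative G t \<bullet> G' t + G' t \<bullet> G t) (at t)"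
      by (rule bounded_bilinear.has_vector_derivative[OF bounded_bilinear_inner deriv[OF that] deriv[OF that]])
    then have "((\<lambda>t. G t \<bullet> G t) has_real_derivative n' t) (at t)"
      by (simp add: has_real_derivative_iff_has_vector_derivative n'_def inner_commute)
    then show ?thesis unfolding n_def[abs_def] by (auto intro!: derivative_eq_intros)
  qed
  have n'_le: "\<bar>n' t\<bar> \<le> 4 * K * n t" if "t \<in> {a<..<b}" for t
  proof -
    let ?x = "norm (G t)"
    have "\<bar>n' t\<bar> \<le> 2 * (?x * norm (G' t))"
      unfolding n'_def using Cauchy_Schwarz_ineq2[of "G t" "G' t"] by simp
    also have "\<dots> \<le> 2 * (?x * (K * (?x + 1)))" using le[OF that] by (intro mult_left_mono) auto
    also have "\<dots> = K * (2 * ?x * (?x + 1))" by (simp add: algebra_simps)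
    also have "2 * ?x * (?x + 1) \<le> 4 * (1 + ?x\<^sup>2)"
      by (rule quadratic(1))
    also have "K * (4 * (1 + ?x\<^sup>2)) = 4 * K * n t" by (simp add: n_def power2_norm_eq_inner)
    finally show ?thesis using K by (simp add: mult_left_mono)
  qed
  have n_bound: "n t \<le> n m * exp (4 * K * (b - a))" if t: "t \<in> {a<..<b}" for t
  proof (cases "m \<le> t")
    case True
    have "n t * exp (- (4 * K) * t) \<le> n m * exp (- (4 * K) * m)"
    proof (rule DERIV_nonpos_imp_nonincreasing[OF True])
      fix x assume x: "m \<le> x" "x \<le> t"
      have "((\<lambda>t. n t * exp (- (4 * K) * t)) has_real_derivative (n' x - 4 * K * n x) * exp (- (4 * K) * x)) (at x)"
        using x t m by (auto intro!: derivative_eq_intros dn simp: algebra_simps)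
      moreover have "(n' x - 4 * K * n x) * exp (- (4 * K) * x) \<le> 0"
        using n'_le[of x] x t m by (intro mult_nonpos_nonneg) auto
      ultimately show "\<exists>y. ((\<lambda>t. n t * exp (- (4 * K) * t)) has_real_derivative y) (at x) \<and> y \<le> 0" by blast
    qed
    then have "n t \<le> n m * exp (4 * K * (t - m))"
      by (simp add: exp_minus exp_diff field_simps)
    also have "\<dots> \<le> n m * exp (4 * K * (b - a))"
      using t m K n_ge[of m] by (intro mult_left_mono) (auto intro!: mult_left_mono)
    finally show ?thesis .
  next
    case False
    then have tm: "t \<le> m" by simp
    have "n t * exp ((4 * K) * t) \<le> n m * exp ((4 * K) * m)"
    proof (rule DERIV_nonneg_imp_nondecreasing[OF tm])
      fix x assume x: "t \<le> x" "x \<le> m"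
      have "((\<lambda>t. n t * exp ((4 * K) * t)) has_real_derivative (n' x + 4 * K * n x) * exp ((4 * K) * x)) (at x)"
        using x t m by (auto intro!: derivative_eq_intros dn simp: algebra_simps)
      moreover have "(n' x + 4 * K * n x) * exp ((4 * K) * x) \<ge> 0"
        using n'_le[of x] x t m by (intro mult_nonneg_nonneg) auto
      ultimately show "\<exists>y. ((\<lambda>t. n t * exp ((4 * K) * t)) has_real_derivative y) (at x) \<and> y \<ge> 0" by blast
    qed
    then have "n t \<le> n m * exp (4 * K * (m - t))"
      by (simp add: exp_minus exp_diff field_simps)
    also have "\<dots> \<le> n m * exp (4 * K * (b - a))"
      using t m K n_ge[of m] by (intro mult_left_mono) (auto intro!: mult_left_mono)
    finally show ?thesis .
  qed
  define M where "M = K * (n m * exp (4 * K * (b - a)) + 1)"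
  have G'_le: "norm (G' t) \<le> M" if t: "t \<in> {a<..<b}" for t
  proof -
    have "norm (G t) \<le> n t"
    proof -
      define x where "x = norm (G t)"
      have "0 \<le> x" "2 * x \<le> 1 + x\<^sup>2" using quadratic(2)[of x] by (simp_all add: x_def)
      then have "x \<le> 1 + x\<^sup>2" by simp
      then show ?thesis unfolding n_def x_def power2_norm_eq_inner .
    qed
    then have "norm (G t) + 1 \<le> n m * exp (4 * K * (b - a)) + 1" using n_bound[OF t] by simp
    then have "K * (norm (G t) + 1) \<le> M" unfolding M_def using K by (intro mult_left_mono)
    then show ?thesis using le[OF t] by simp
  qed
  have "norm (G s - G t) \<le> M * norm (s - t)" if "s \<in> {a<..<b}" "t \<in> {a<..<b}" for s t
  proof (rule differentiable_bound[of "{a<..<b}" G "\<lambda>x h. h *\<^sub>R G' x"])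
    show "(G has_derivative (\<lambda>h. h *\<^sub>R G' x)) (at x within {a<..<b})" if "x \<in> {a<..<b}" for x
      using deriv[OF that] unfolding has_vector_derivative_def by (rule has_derivative_at_withinI)
    show "onorm (\<lambda>h. h *\<^sub>R G' x) \<le> M" if "x \<in> {a<..<b}" for x
      by (rule onorm_le) (use mult_left_mono[OF G'_le[OF that] abs_ge_zero] in \<open>simp add: mult.commute\<close>)
  qed (use that in auto)
  then show ?thesis by (auto intro!: exI[of _ M])
qed

lemma primitive_up_to_boundary:
  fixes G g :: "real \<Rightarrow> 'b::euclidean_space"
  assumes ab: "a \<le> b" and G: "continuous_on {a..b} G" and g: "continuous_on {a..b} g"
    and deriv: "\<And>t. t \<in> {a<..<b} \<Longrightarrow> (G has_vector_derivative g t) (at t)"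
    and t: "t \<in> {a..b}"
  shows "(G has_vector_derivative g t) (at t within {a..b})"
proof -
  have eq: "G s = G a + integral {a..s} g" if s: "s \<in> {a..b}" for s
  proof -
    have "(g has_integral (G s - G a)) {a..s}"
      by (rule fundamental_theorem_of_calculus_interior)
         (use s deriv in \<open>auto intro: continuous_on_subset[OF G]\<close>)
    then show ?thesis by (simp add: integral_unique)
  qed
  have "((\<lambda>s. G a + integral {a..s} g) has_vector_derivative 0 + g t) (at t within {a..b})"
    by (intro has_vector_derivative_add has_vector_derivative_const integral_has_vector_derivative g t)
  then have "((\<lambda>s. G a + integral {a..s} g) has_vector_derivative g t) (at t within {a..b})" by simp
  then show ?thesis
    by (rule has_vector_derivative_transform[OF t, rotated]) (rule eq)
qed

section \<open>Locality of fractional derivatives\<close>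

lemma frac_deriv_cong:
  assumes t: "t \<in> {a<..<b}" and eq: "\<And>s. s \<in> {a<..<b} \<Longrightarrow> u s = v s"
  shows "frac_deriv \<beta> \<rho> \<Phi> a u t = frac_deriv \<beta> \<rho> \<Phi> a v t"
proof -
  have int: "frac_integral (1 - \<beta>) \<rho> \<Phi> a u s = frac_integral (1 - \<beta>) \<rho> \<Phi> a v s" if s: "s \<in> {a<..<b}" for s
  proof -
    have "(LINT \<tau>:{a<..<s}|lborel. frac_integrand (1 - \<beta>) \<rho> \<Phi> u s \<tau>) = (LINT \<tau>:{a<..<s}|lborel. frac_integrand (1 - \<beta>) \<rho> \<Phi> v s \<tau>)"
      by (rule set_lebesgue_integral_cong) (use s eq in \<open>auto simp: frac_integrand_def\<close>)
    then show ?thesis using s by (simp add: frac_integral_def frac_integral_formula_def)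
  qed
  have "eventually (\<lambda>s. s \<in> {a<..<b}) (nhds t)" by (rule eventually_nhds_in_open) (use t in auto)
  then have "eventually (\<lambda>s. s \<in> UNIV \<longrightarrow> frac_integral (1 - \<beta>) \<rho> \<Phi> a u s = frac_integral (1 - \<beta>) \<rho> \<Phi> a v s) (nhds t)"
    by eventually_elim (use int in auto)
  then have "vector_derivative (frac_integral (1 - \<beta>) \<rho> \<Phi> a u) (at t) = vector_derivative (frac_integral (1 - \<beta>) \<rho> \<Phi> a v) (at t)"
    by (intro vector_derivative_cong_eq) auto
  then show ?thesis by (simp add: frac_deriv_def Let_def int[OF t])
qed

section \<open>The boundary integral as a flux\<close>

context monogenic_pullback
begin

text \<open>
\<open>A\<close> is the part of the closed box where the integrand is continuous: all of it, or its complement of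
an interior point, in both cases containing the faces.
\<close>

lemma boundary_integral_flux:
  assumes \<Theta>: "\<And>\<xi> \<eta>. \<xi> \<in> cbox a b \<Longrightarrow> \<Theta> (S \<xi>) \<eta> = r *\<^sub>R (cquat_of (\<kappa> (S \<xi>) \<odot> \<eta>) \<odot> N \<xi>)"
    and cont: "\<And>i. continuous_on A (pulled_form \<kappa> i)"
    and faces: "\<And>i w t. w \<in> face_rect a b i \<Longrightarrow> t = a$i \<or> t = b$i \<Longrightarrow> face_point i t w \<in> A \<and> face_point i t w \<in> cbox a b"
  shows "boundary_integrable \<psi> a b S \<Theta>" "boundary_integral \<psi> a b S \<Theta> = r *\<^sub>R box_flux (pulled_form \<kappa>) a b"
proof -
  have pull: "boundary_pullback \<psi> S \<Theta> i \<xi> = r *\<^sub>R pulled_form \<kappa> i \<xi>" if \<xi>: "\<xi> \<in> cbox a b" for i \<xi>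
  proof -
    have \<xi>V: "\<xi> \<in> V" using \<xi> cbox_V by auto
    have "frechet_derivative S (at \<xi>) = S' \<xi>" using frechet_derivative_at[OF deriv[OF \<xi>V]] by simp
    then show ?thesis
      by (simp add: boundary_pullback_def Let_def sgn_det_area_form[OF \<xi>V] \<Theta>[OF \<xi>] pulled_form_def)
  qed
  have cont': "continuous_on (face_rect a b i) (\<lambda>w. boundary_pullback \<psi> S \<Theta> i (face_point i t w))"
    if t: "t = a$i \<or> t = b$i" for i t
  proof -
    have "continuous_on (face_rect a b i) (\<lambda>w. r *\<^sub>R pulled_form \<kappa> i (face_point i t w))"
      by (intro continuous_intros continuous_on_face[OF cont]) (use faces t in auto)
    then show ?thesis by (rule continuous_on_eq) (use pull faces t in auto)
  qed
  have compact: "compact (face_rect a b i)" for i by (simp add: face_rect_cbox)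
  have int: "set_integrable lborel (face_rect a b i) (\<lambda>w. boundary_pullback \<psi> S \<Theta> i (face_point i t w))"
    if t: "t = a$i \<or> t = b$i" for i t
    unfolding set_integrable_def by (rule borel_integrable_compact[OF compact cont'[OF t]])
  then show "boundary_integrable \<psi> a b S \<Theta>" by (auto simp: boundary_integrable_def)
  have val: "(LINT w:face_rect a b i|lborel. boundary_pullback \<psi> S \<Theta> i (face_point i t w))
     = r *\<^sub>R integral (face_rect a b i) (\<lambda>w. pulled_form \<kappa> i (face_point i t w))"
    if t: "t = a$i \<or> t = b$i" for i t
  proof -
    have "(LINT w:face_rect a b i|lborel. boundary_pullback \<psi> S \<Theta> i (face_point i t w))
        = integral (face_rect a b i) (\<lambda>w. boundary_pullback \<psi> S \<Theta> i (face_point i t w))"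
      by (rule set_borel_integral_eq_integral(2)[OF int[OF t]])
    also have "\<dots> = integral (face_rect a b i) (\<lambda>w. r *\<^sub>R pulled_form \<kappa> i (face_point i t w))"
      by (rule Henstock_Kurzweil_Integration.integral_cong) (use pull faces t in auto)
    finally show ?thesis by simp
  qed
  show "boundary_integral \<psi> a b S \<Theta> = r *\<^sub>R box_flux (pulled_form \<kappa>) a b"
    unfolding boundary_integral_def box_flux_def scaleR_sum_right
    by (intro sum.cong refl) (simp add: val scaleR_diff_right)
qed

end

section \<open>Coordinate slices\<close>

lemma C1_onE:
  assumes "C1_on A f"
  obtains f' where "\<And>x. x \<in> A \<Longrightarrow> (f has_derivative blinfun_apply (f' x)) (at x within A)" "continuous_on A f'"
  using assms by (auto simp: C1_on_def)

lemma upd_in_cbox: "\<xi> \<in> cbox a b \<Longrightarrow> t \<in> {a$i..b$i} \<Longrightarrow> upd \<xi> i t \<in> cbox a b"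
  by (auto simp: mem_box_cart upd_def)

lemma upd_in_box: "\<xi> \<in> box a b \<Longrightarrow> t \<in> {a$i<..<b$i} \<Longrightarrow> upd \<xi> i t \<in> box a b"
  by (auto simp: mem_box_cart upd_def)

lemma continuous_upd [continuous_intros]: "continuous_on A (\<lambda>t. upd \<xi> i t)"
  unfolding upd_eq by (intro continuous_intros)

lemma C1_slice:
  assumes f: "\<And>x. x \<in> cbox a b \<Longrightarrow> (f has_derivative f' x) (at x within cbox a b)"
    and \<xi>: "\<xi> \<in> cbox a b" and t: "t \<in> {a$i..b$i}"
  shows "((\<lambda>s. f (upd \<xi> i s)) has_vector_derivative f' (upd \<xi> i t) (axis i 1)) (at t within {a$i..b$i})"
proof -
  have "((\<lambda>s. f (upd (upd \<xi> i t) i s)) has_vector_derivative f' (upd \<xi> i t) (axis i 1)) (at (upd \<xi> i t $ i) within {a$i..b$i})"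
    by (rule has_derivative_imp_partial[OF f]) (use \<xi> t upd_in_cbox in auto)
  then show ?thesis by simp
qed

lemma frac_slice_of_box:
  assumes ab: "\<And>k. a$k < b$k" and \<zeta>: "\<zeta> \<in> box a b" and s: "0 < s"
    and \<phi>: "\<And>x. x \<in> cbox a b \<Longrightarrow> (\<phi> has_derivative blinfun_apply (\<phi>' x)) (at x within cbox a b)"
    and cont: "continuous_on (cbox a b) \<phi>'"
    and pos: "\<And>t. t \<in> {a$i..b$i} \<Longrightarrow> vector_derivative (phi_slice \<phi> \<zeta> i) (at t within {a$i..b$i}) > 0"
  shows "frac_slice (a$i) (b$i) s (phi_slice \<phi> \<zeta> i) (\<lambda>t. \<phi>' (upd \<zeta> i t) (axis i 1))"
proof
  have \<zeta>': "\<zeta> \<in> cbox a b" using \<zeta> box_subset_cbox by blast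
  show "a$i < b$i" by (rule ab)
  show "0 < s" by (rule s)
  have d: "(phi_slice \<phi> \<zeta> i has_vector_derivative \<phi>' (upd \<zeta> i t) (axis i 1)) (at t within {a$i..b$i})"
    if "t \<in> {a$i..b$i}" for t
    unfolding phi_slice_def[abs_def] by (rule C1_slice[OF \<phi> \<zeta>' that])
  show "(phi_slice \<phi> \<zeta> i has_real_derivative \<phi>' (upd \<zeta> i t) (axis i 1)) (at t)" if "t \<in> {a$i<..<b$i}" for t
    using d[of t] that by (simp add: has_real_derivative_iff_has_vector_derivative at_within_Icc_at)
  show "continuous_on {a$i..b$i} (phi_slice \<phi> \<zeta> i)"
    by (rule continuous_on_vector_derivative[OF d])
  show "continuous_on {a$i..b$i} (\<lambda>t. \<phi>' (upd \<zeta> i t) (axis i 1))"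
    by (intro continuous_intros continuous_on_compose2[OF cont]) (use upd_in_cbox[OF \<zeta>'] in auto)
  show "\<phi>' (upd \<zeta> i t) (axis i 1) > 0" if "t \<in> {a$i..b$i}" for t
    using pos[OF that] vector_derivative_within_cbox[OF ab[of i], unfolded cbox_interval, OF that d[OF that]] by simp
qed

section \<open>The Cauchy-Riemann system in the coordinates of the box\<close>

context conformal_chart
begin

text \<open>
The equation is the trace of a bilinear map at \<open>S \<xi>\<close>; in the frame \<open>S' e\<^sub>i\<close> the derivatives become
partial derivatives with respect to the coordinates of the box, by the chain rule.
\<close>

lemma pulled_back_CR:
  assumes struct: "structural_set \<psi>" and \<xi>: "\<xi> \<in> V"
    and TS: "\<And>\<xi>. \<xi> \<in> V \<Longrightarrow> T (S \<xi>) = \<xi>"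
    and F: "(F has_derivative F') (at (S \<xi>))"
    and \<Lambda>: "(\<Lambda> has_derivative \<Lambda>') (at \<xi>)"
    and eq: "cquat_of (CR_real \<psi> (\<lambda>x. \<Lambda> (T x)) (S \<xi>)) \<odot> F (S \<xi>) + CR \<psi> F (S \<xi>) = 0"
  shows "(\<Sum>i\<in>UNIV. cquat_of (emb \<psi> (S' \<xi> (axis i 1))) \<odot> (\<Lambda>' (axis i 1) *\<^sub>R F (S \<xi>) + F' (S' \<xi> (axis i 1)))) = 0"
proof -
  obtain T'' where T'': "(T has_derivative T'') (at (S \<xi>))" "\<And>h. T'' (S' \<xi> h) = h"
    using inverse_has_derivative[of T, OF TS \<xi>] by metis
  have linF: "linear F'" using F has_derivative_linear by blast
  have \<Lambda>T: "((\<lambda>x. \<Lambda> (T x)) has_derivative (\<lambda>h. \<Lambda>' (T'' h))) (at (S \<xi>))"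
    by (rule has_derivative_compose[OF T''(1)]) (simp add: TS[OF \<xi>] \<Lambda>)
  then have lin\<Lambda>: "linear (\<lambda>h. \<Lambda>' (T'' h))" using has_derivative_linear by blast
  have "deriv (\<lambda>t. \<Lambda> (T (upd (S \<xi>) k t))) (S \<xi> $ k) = \<Lambda>' (T'' (axis k 1))" for k
    using has_derivative_imp_partial[of "\<lambda>x. \<Lambda> (T x)" _ "S \<xi>" UNIV k UNIV] \<Lambda>T
    by (intro DERIV_imp_deriv) (simp add: has_real_derivative_iff_has_vector_derivative)
  then have CRr: "CR_real \<psi> (\<lambda>x. \<Lambda> (T x)) (S \<xi>) = (\<Sum>k\<in>UNIV. \<Lambda>' (T'' (axis k 1)) *\<^sub>R emb \<psi> (axis k 1))"
    by (simp add: CR_real_def emb_axis)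
  have "vector_derivative (\<lambda>t. F (upd (S \<xi>) k t)) (at (S \<xi> $ k)) = F' (axis k 1)" for k
    using has_derivative_imp_partial[of F F' "S \<xi>" UNIV k UNIV] F by (intro vector_derivative_at) simp
  then have CRc: "CR \<psi> F (S \<xi>) = (\<Sum>k\<in>UNIV. cquat_of (emb \<psi> (axis k 1)) \<odot> F' (axis k 1))"
    by (simp add: CR_def emb_axis)
  define b where "b x y = cquat_of (emb \<psi> x) \<odot> (\<Lambda>' (T'' y) *\<^sub>R F (S \<xi>) + F' y)" for x y
  have "(\<Sum>i\<in>UNIV. b (S' \<xi> (axis i 1)) (S' \<xi> (axis i 1))) = (\<mu> \<xi>)\<^sup>2 *\<^sub>R (\<Sum>i\<in>UNIV. b (axis i 1) (axis i 1))"
  proof (rule sum_bilinear_deriv[where b = b, OF _ _ \<xi>])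
    show "linear (\<lambda>x. b x y)" for y
      unfolding b_def by (auto simp: linear_iff emb_linear cquat_of_linear qmult_complex.add_left qmult_complex.scaleR_left)
    show "linear (b x)" for x
      unfolding b_def by (auto simp: linear_iff linear_add[OF lin\<Lambda>] linear_scale[OF lin\<Lambda>] linear_add[OF linF] linear_scale[OF linF]
        qmult_complex.add_right qmult_complex.scaleR_right scaleR_left_distrib scaleR_right_distrib)
  qed
  also have "(\<Sum>i\<in>UNIV. b (axis i 1) (axis i 1)) = cquat_of (CR_real \<psi> (\<lambda>x. \<Lambda> (T x)) (S \<xi>)) \<odot> F (S \<xi>) + CR \<psi> F (S \<xi>)"
    unfolding CRr CRc b_def
    by (simp add: qmult_complex.add_right sum.distrib cquat_of_linear qmult_complex.sum_left
        qmult_complex.scaleR_left qmult_complex.scaleR_right)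
  also have "\<dots> = 0" by (rule eq)
  finally show ?thesis by (simp add: b_def T''(2))
qed

end

text \<open>
The coordinates other than the \<open>i\<close>-th are kept at those of \<open>\<zeta>\<close>, and the equation is solved for the
\<open>i\<close>-th derivative by multiplication with the inverse \<open>Q\<close> of \<open>S' e\<^sub>i\<close>.  What remains depends on
\<open>G i\<close> affinely, with coefficients made of the derivatives of \<open>\<Lambda>\<close> and \<open>S\<close>, which are continuous on the
closed interval, and of constants.
\<close>

lemma (in conformal_chart) slice_ode:
  assumes struct: "structural_set \<psi>" and cbV: "cbox a b \<subseteq> V"
    and ab: "\<And>k. a$k < b$k" and \<zeta>: "\<zeta> \<in> box a b"
    and D\<Lambda>: "\<And>k. continuous_on (cbox a b) (D\<Lambda> k)"
    and CR: "\<And>\<xi>. \<xi> \<in> box a b \<Longrightarrow> (\<Sum>k\<in>UNIV. cquat_of (emb \<psi> (S' \<xi> (axis k 1)))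
        \<odot> (D\<Lambda> k \<xi> *\<^sub>R (\<Sum>j\<in>UNIV. G j (\<xi>$j)) + DG k (\<xi>$k))) = 0"
  obtains A B where "continuous_on {a$i..b$i} A" "continuous_on {a$i..b$i} B"
    "\<And>t. t \<in> {a$i<..<b$i} \<Longrightarrow> DG i t = A t \<odot> G i t + B t"
proof -
  have \<zeta>': "\<zeta> \<in> cbox a b" using \<zeta> box_subset_cbox by blast
  define X where "X k t = emb \<psi> (S' (upd \<zeta> i t) (axis k 1))" for k t
  define Q where "Q t = inverse ((\<mu> (upd \<zeta> i t))\<^sup>2) *\<^sub>R qcnj (X i t)" for t
  define D where "D k t = D\<Lambda> k (upd \<zeta> i t)" for k t
  define A where "A t = - (\<Sum>k\<in>UNIV. D k t *\<^sub>R cquat_of (Q t \<odot> X k t))" for t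
  define c where "c = (\<Sum>j\<in>UNIV - {i}. G j (\<zeta>$j))"
  define B where "B t = A t \<odot> c - (\<Sum>k\<in>UNIV - {i}. cquat_of (Q t \<odot> X k t) \<odot> DG k (\<zeta>$k))" for t
  let ?I = "{a$i..b$i}"
  have updV: "upd \<zeta> i t \<in> V" if "t \<in> ?I" for t using upd_in_cbox[OF \<zeta>' that] cbV by blast
  have cX: "continuous_on ?I (X k)" for k
    unfolding X_def[abs_def]
    by (intro bounded_linear.continuous_on[OF bounded_linear_emb] continuous_on_compose2[OF cont_deriv] continuous_upd)
       (use updV in auto)
  have "continuous_on ?I (\<lambda>t. qcnj (emb \<psi> (S' (upd \<zeta> i t) (axis i 1))))"
    by (intro bounded_linear.continuous_on[OF bounded_linear_qcnj_emb] continuous_on_compose2[OF cont_deriv] continuous_upd)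
       (use updV in auto)
  moreover have "\<mu> (upd \<zeta> i t) \<noteq> 0" if "t \<in> ?I" for t using mu_pos[OF updV[OF that]] by simp
  ultimately have cQ: "continuous_on ?I Q"
    unfolding Q_def X_def
    by (intro continuous_intros continuous_on_compose2[OF cont_mu]) (use updV in auto)
  have cD: "continuous_on ?I (D k)" for k
    unfolding D_def[abs_def] by (rule continuous_on_compose2[OF D\<Lambda>]) (use upd_in_cbox[OF \<zeta>'] in \<open>auto intro!: continuous_upd\<close>)
  have cQX: "continuous_on ?I (\<lambda>t. cquat_of (Q t \<odot> X k t))" for k
    by (intro bounded_linear.continuous_on[OF bounded_linear_cquat_of] qmult_real.continuous_on cQ cX)
  have cA: "continuous_on ?I A" unfolding A_def[abs_def] by (intro continuous_intros cD cQX)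
  have cB: "continuous_on ?I B" unfolding B_def[abs_def]
    by (intro continuous_intros qmult_complex.continuous_on cA cQX)
  have "DG i t = A t \<odot> G i t + B t" if t: "t \<in> {a$i<..<b$i}" for t
  proof -
    have t': "t \<in> ?I" using t by auto
    have QX: "Q t \<odot> X i t = qone"
      using mu_pos[OF updV[OF t']]
      by (simp add: Q_def X_def qmult_real.scaleR_left qcnj_qmult_self norm_emb[OF struct] norm_deriv[OF updV[OF t']])
    have sumG: "(\<Sum>j\<in>UNIV. G j (upd \<zeta> i t $ j)) = G i t + c"
    proof -
      have "(\<Sum>j\<in>UNIV - {i}. G j (upd \<zeta> i t $ j)) = c" unfolding c_def by (rule sum.cong) auto
      then show ?thesis by (simp add: sum.remove[of UNIV i])
    qed
    have "0 = cquat_of (Q t) \<odot> (\<Sum>k\<in>UNIV. cquat_of (X k t) \<odot> (D k t *\<^sub>R (G i t + c) + DG k (upd \<zeta> i t $ k)))"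
      using CR[OF upd_in_box[OF \<zeta> t]] unfolding sumG X_def D_def by (simp add: qmult_complex.zero_right)
    also have "\<dots> = (\<Sum>k\<in>UNIV. D k t *\<^sub>R (cquat_of (Q t \<odot> X k t) \<odot> (G i t + c)))
        + (\<Sum>k\<in>UNIV. cquat_of (Q t \<odot> X k t) \<odot> DG k (upd \<zeta> i t $ k))"
      by (simp only: qmult_complex.sum_right cquat_of_qmult qmult_assoc qmult_complex.add_right
          qmult_complex.scaleR_right sum.distrib)
    also have "(\<Sum>k\<in>UNIV. D k t *\<^sub>R (cquat_of (Q t \<odot> X k t) \<odot> (G i t + c))) = - (A t \<odot> (G i t + c))"
      by (simp add: A_def qmult_complex.minus_left qmult_complex.sum_left qmult_complex.scaleR_left)
    also have "(\<Sum>k\<in>UNIV. cquat_of (Q t \<odot> X k t) \<odot> DG k (upd \<zeta> i t $ k))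
        = DG i t + (\<Sum>k\<in>UNIV - {i}. cquat_of (Q t \<odot> X k t) \<odot> DG k (\<zeta>$k))"
    proof -
      have "(\<Sum>k\<in>UNIV - {i}. cquat_of (Q t \<odot> X k t) \<odot> DG k (upd \<zeta> i t $ k)) = (\<Sum>k\<in>UNIV - {i}. cquat_of (Q t \<odot> X k t) \<odot> DG k (\<zeta>$k))"
        by (rule sum.cong) auto
      then show ?thesis by (simp add: sum.remove[of UNIV i] QX)
    qed
    finally show ?thesis by (simp add: B_def qmult_complex.add_right algebra_simps)
  qed
  from that[OF cA cB this] show thesis .
qed

lemma linear_ode_lipschitz:
  fixes G DG A B :: "real \<Rightarrow> cquat"
  assumes ab: "a < b" and A: "continuous_on {a..b} A" and B: "continuous_on {a..b} B"
    and ode: "\<And>t. t \<in> {a<..<b} \<Longrightarrow> DG t = A t \<odot> G t + B t"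
    and deriv: "\<And>t. t \<in> {a<..<b} \<Longrightarrow> (G has_vector_derivative DG t) (at t)"
  shows "\<exists>M. \<forall>s\<in>{a<..<b}. \<forall>t\<in>{a<..<b}. norm (G s - G t) \<le> M * \<bar>s - t\<bar>"
proof -
  have "bounded (A ` {a..b})" "bounded (B ` {a..b})"
    using A B by (intro compact_imp_bounded compact_continuous_image; simp)+
  then obtain KA KB where KA: "\<And>t. t \<in> {a..b} \<Longrightarrow> norm (A t) \<le> KA" and KB: "\<And>t. t \<in> {a..b} \<Longrightarrow> norm (B t) \<le> KB"
    unfolding bounded_iff by blast
  obtain C where C: "\<And>x y :: cquat. norm (x \<odot> y) \<le> norm x * norm y * C" "C > 0"
    using qmult_complex.pos_bounded by blast
  define K where "K = max (KA * C) KB"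
  have "norm (DG t) \<le> K * (norm (G t) + 1)" if t: "t \<in> {a<..<b}" for t
  proof -
    have "norm (DG t) \<le> norm (A t \<odot> G t) + norm (B t)" unfolding ode[OF t] by (rule norm_triangle_ineq)
    also have "\<dots> \<le> norm (A t) * norm (G t) * C + KB" using C(1)[of "A t" "G t"] KB[of t] t by auto
    also have "norm (A t) * norm (G t) * C \<le> KA * norm (G t) * C"
      using KA[of t] t C(2) by (intro mult_right_mono) auto
    also have "KA * norm (G t) * C = (KA * C) * norm (G t)" by simp
    also have "\<dots> \<le> K * norm (G t)" unfolding K_def by (intro mult_right_mono) auto
    finally have "norm (DG t) \<le> K * norm (G t) + KB" by simp
    also have "KB \<le> K" by (simp add: K_def)
    finally show ?thesis by (simp add: algebra_simps)
  qed
  from gronwall_lipschitz[OF ab deriv this] show ?thesis by blast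
qed

section \<open>The Cauchy type theorem and formula\<close>

theorem corollary21:
  fixes \<psi> :: "3 \<Rightarrow> quat" and \<psi>3 p q r s :: quat
    and a b \<sigma> y :: "real^3" and \<alpha> :: "complex^3"
    and \<phi> :: "real^3 \<Rightarrow> real" and lam :: "3 \<Rightarrow> real^3 \<Rightarrow> real"
    and \<Xi> :: "(real^3) set" and h :: "real^3 \<Rightarrow> quat"
  defines "T \<equiv> mobius \<psi> p q r s" and "T' \<equiv> mobius_inv \<psi> p q r s"
  defines "\<Lambda> \<equiv> \<lambda>\<xi>. \<Sum>k\<in>UNIV. lam k \<xi>"
  defines "F \<equiv> \<lambda>\<tau>. total_frac_integral a (1 - \<alpha>) \<sigma> \<phi> (h \<circ> T') (T \<tau>) (T y)"
  assumes psi: "structural_set \<psi>" "completes_basis \<psi> \<psi>3"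
    and mob: "mobius_data \<psi> \<psi>3 p q r s"
    and ab: "\<And>k. a$k < b$k"
    and Xi: "\<Xi> \<subseteq> mobius_dom \<psi> r s" "T ` \<Xi> = box a b" "bounded \<Xi>"
    and y: "y \<in> \<Xi>"
    and sigma: "\<And>k. 0 < \<sigma>$k \<and> \<sigma>$k < 1"
    and alpha: "\<And>k. 0 < Re (\<alpha>$k) \<and> Re (\<alpha>$k) < 1"
    and phi: "C1_on (cbox a b) \<phi>"
      "\<And>i t. t \<in> {a$i..b$i} \<Longrightarrow>
         vector_derivative (phi_slice \<phi> (T y) i) (at t within {a$i..b$i}) > 0"
    and lam: "\<And>k. C1_on (cbox a b) (lam k)"
      "\<And>\<xi>. \<xi> \<in> box a b \<Longrightarrow>
         CR_real \<psi> \<Lambda> \<xi> = D_phi \<phi> \<xi> (T y) *\<^sub>R (qinv (emb \<psi> \<sigma>) \<odot> (qone - emb \<psi> \<sigma>))"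
    and h: "h \<in> frac_hyperholomorphic \<psi> \<psi>3 a b \<alpha> \<sigma> \<phi> lam T T' \<Xi> y"
  shows
    "boundary_integrable \<psi> a b T' (\<lambda>x \<eta>. exp (\<Lambda> (T x)) *\<^sub>R (cquat_of \<eta> \<odot> F x)) \<and>
     boundary_integral \<psi> a b T' (\<lambda>x \<eta>. exp (\<Lambda> (T x)) *\<^sub>R (cquat_of \<eta> \<odot> F x)) = 0 \<and>
     (\<forall>x\<in>\<Xi>.
        boundary_integrable \<psi> a b T'
          (\<lambda>\<tau> \<eta>. exp (\<Lambda> (T \<tau>) - \<Lambda> (T x)) *\<^sub>R
                   (cquat_of (cauchy_kernel \<psi> (\<tau> - x) \<odot> \<eta>) \<odot> F \<tau>)) \<and>
        total_frac_deriv a (1 - \<alpha>) \<sigma> \<phi> (T y)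
          (\<lambda>\<xi>. boundary_integral \<psi> a b T'
             (\<lambda>\<tau> \<eta>. exp (\<Lambda> (T \<tau>) - \<Lambda> \<xi>) *\<^sub>R
                      (cquat_of (cauchy_kernel \<psi> (\<tau> - T' \<xi>) \<odot> \<eta>) \<odot> F \<tau>))) (T x)
        = (\<Sum>i\<in>UNIV. cquat_of ((h \<circ> T') (upd (T y) i (T x $ i)))) +
          (\<Sum>i\<in>UNIV. \<Sum>j\<in>UNIV - {i}.
             partial_frac_deriv a (1 - \<alpha>) \<sigma> \<phi> (T y) j
               (\<lambda>\<xi>. partial_frac_integral a (1 - \<alpha>) \<sigma> \<phi> (T y) i (h \<circ> T') (\<xi>$i)) (T x))) \<and>
     (\<forall>x. x \<notin> closure \<Xi> \<longrightarrow> (\<forall>c.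
        boundary_integrable \<psi> a b T'
          (\<lambda>\<tau> \<eta>. exp (\<Lambda> (T \<tau>) - c) *\<^sub>R
                   (cquat_of (cauchy_kernel \<psi> (\<tau> - x) \<odot> \<eta>) \<odot> F \<tau>)) \<and>
        boundary_integral \<psi> a b T'
          (\<lambda>\<tau> \<eta>. exp (\<Lambda> (T \<tau>) - c) *\<^sub>R
                   (cquat_of (cauchy_kernel \<psi> (\<tau> - x) \<odot> \<eta>) \<odot> F \<tau>)) = 0))"
proof -
  define g where "g = h \<circ> T'"
  define \<zeta> where "\<zeta> = T y"
  have \<zeta>: "\<zeta> \<in> box a b" using y Xi(2) by (auto simp: \<zeta>_def)
  have box_cbox: "\<xi> \<in> cbox a b" if "\<xi> \<in> box a b" for \<xi> using that box_subset_cbox by blast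
  obtain V S' \<mu> P where chart: "conformal_chart V T' S' \<mu> P" and cbV: "cbox a b \<subseteq> V"
    and TT': "\<And>\<xi>. \<xi> \<in> V \<Longrightarrow> T (T' \<xi>) = \<xi>" and T'box: "T' ` box a b = \<Xi>"
    and T'T: "\<And>x. x \<in> \<Xi> \<Longrightarrow> T' (T x) = x"
    using mobius_conformal_chart[OF psi mob ab Xi[unfolded T_def]] unfolding T_def[symmetric] T'_def[symmetric] by metis
  interpret ch: conformal_chart V T' S' \<mu> P by (rule chart)

  obtain \<phi>' where \<phi>': "\<And>x. x \<in> cbox a b \<Longrightarrow> (\<phi> has_derivative blinfun_apply (\<phi>' x)) (at x within cbox a b)"
    and c\<phi>': "continuous_on (cbox a b) \<phi>'"
    using C1_onE[OF phi(1)] by metis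
  have "\<forall>k. \<exists>l'. (\<forall>x\<in>cbox a b. (lam k has_derivative blinfun_apply (l' x)) (at x within cbox a b)) \<and> continuous_on (cbox a b) l'"
    using lam(1) by (simp add: C1_on_def)
  then obtain lam' where lam': "\<And>k x. x \<in> cbox a b \<Longrightarrow> (lam k has_derivative blinfun_apply (lam' k x)) (at x within cbox a b)"
    and clam': "\<And>k. continuous_on (cbox a b) (lam' k)"
    by metis
  define \<Lambda>' where "\<Lambda>' \<xi> v = (\<Sum>k\<in>UNIV. blinfun_apply (lam' k \<xi>) v)" for \<xi> v
  define D\<Lambda> where "D\<Lambda> i \<xi> = \<Lambda>' \<xi> (axis i 1)" for i \<xi>
  have d\<Lambda>: "(\<Lambda> has_derivative \<Lambda>' \<xi>) (at \<xi> within cbox a b)" if "\<xi> \<in> cbox a b" for \<xi>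
    unfolding \<Lambda>_def \<Lambda>'_def by (intro has_derivative_sum lam' that)
  have at_box: "at \<xi> within cbox a b = at \<xi>" if "\<xi> \<in> box a b" for \<xi>
    by (rule at_within_interior) (use that in \<open>simp add: interior_cbox\<close>)
  have cD\<Lambda>: "continuous_on (cbox a b) (D\<Lambda> i)" for i
    unfolding D\<Lambda>_def[abs_def] \<Lambda>'_def by (intro continuous_intros clam')
  have c\<Lambda>: "continuous_on (cbox a b) \<Lambda>"
    by (rule has_derivative_continuous_on[OF d\<Lambda>])

  define u where "u i \<tau> = cquat_of (g (upd \<zeta> i \<tau>))" for i \<tau>
  define Gi where "Gi i = frac_integral (1 - \<alpha>$i) (\<sigma>$i) (phi_slice \<phi> \<zeta> i) (a$i) (u i)" for i
  define N0 where "N0 \<xi> = (\<Sum>i\<in>UNIV. Gi i (\<xi>$i))" for \<xi> :: "real^3"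
  have h_C1: "C1_on (box a b) g" and h_def: "frac_CR_defined a b \<alpha> \<sigma> \<phi> T \<Xi> g y"
    and h_CR: "\<And>x. x \<in> \<Xi> \<Longrightarrow> frac_CR \<psi> a \<alpha> \<sigma> \<phi> lam T g x y = 0"
    using h by (auto simp: frac_hyperholomorphic_def g_def)
  have partial: "partial_frac_integral a (1 - \<alpha>) \<sigma> \<phi> \<zeta> i g t = Gi i t" for i t
    by (simp add: partial_frac_integral_def Gi_def u_def[abs_def])
  have F: "F x = N0 (T x)" for x
    by (simp add: F_def total_frac_integral_def N0_def partial flip: g_def \<zeta>_def)
  have F': "F (T' \<xi>) = N0 \<xi>" if "\<xi> \<in> V" for \<xi> by (simp add: F TT'[OF that])
  have cont_g: "continuous_on (box a b) g"
    using h_C1 unfolding C1_on_def by (auto intro: has_derivative_continuous_on)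
  have slice: "frac_integral_slice (a$i) (b$i) (\<sigma>$i) (phi_slice \<phi> \<zeta> i) (\<lambda>t. \<phi>' (upd \<zeta> i t) (axis i 1)) (\<alpha>$i) (u i)" for i
  proof -
    interpret frac_slice "a$i" "b$i" "\<sigma>$i" "phi_slice \<phi> \<zeta> i" "\<lambda>t. \<phi>' (upd \<zeta> i t) (axis i 1)"
      by (rule frac_slice_of_box[OF ab \<zeta> _ \<phi>' c\<phi>']) (use sigma[of i] phi(2)[of _ i] in \<open>auto simp: \<zeta>_def\<close>)
    show ?thesis
    proof
      show "0 < Re (\<alpha>$i)" "Re (\<alpha>$i) < 1" using alpha[of i] by auto
      show "continuous_on {a$i<..<b$i} (u i)"
        unfolding u_def[abs_def]
        by (intro bounded_linear.continuous_on[OF bounded_linear_cquat_of] continuous_on_compose2[OF cont_g] continuous_upd)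
           (use upd_in_box[OF \<zeta>] in auto)
      show "set_integrable lborel {a$i<..<t} (frac_integrand (1 - \<alpha>$i) (\<sigma>$i) (phi_slice \<phi> \<zeta> i) (u i) t)"
        if "t \<in> {a$i<..<b$i}" for t
        using h_def that unfolding frac_CR_defined_def u_def[abs_def] \<zeta>_def by blast
    qed
  qed
  have Gi: "Gi i = frac_integral_slice.G (a$i) (\<sigma>$i) (phi_slice \<phi> \<zeta> i) (\<alpha>$i) (u i)" for i
    by (simp add: Gi_def frac_integral_slice.G_def[OF slice])

  \<comment> \<open>Along a coordinate line \<open>N0\<close> differs from \<open>Gi i\<close> by a constant, so differentiability passes
    from \<open>F\<close> to the one-variable functions.\<close>
  define DG where "DG i t = vector_derivative (Gi i) (at t)" for i t
  define F1 where "F1 \<xi> = frechet_derivative F (at (T' \<xi>))" for \<xi>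
  have dF: "(F has_derivative F1 \<xi>) (at (T' \<xi>))" if "\<xi> \<in> box a b" for \<xi>
  proof -
    have "T' \<xi> \<in> \<Xi>" using that T'box by blast
    then have "F differentiable (at (T' \<xi>))"
      using h_def unfolding frac_CR_defined_def F_def g_def by blast
    then show ?thesis unfolding F1_def by (rule frechet_derivative_works[THEN iffD1])
  qed
  have line: "N0 (upd \<xi> i t) = Gi i t + (N0 \<xi> - Gi i (\<xi>$i))" for \<xi> i t
  proof -
    have "(\<Sum>j\<in>UNIV - {i}. Gi j (upd \<xi> i t $ j)) = (\<Sum>j\<in>UNIV - {i}. Gi j (\<xi>$j))" by (rule sum.cong) auto
    then show ?thesis by (simp add: N0_def sum.remove[of UNIV i])
  qed
  have dN0: "(N0 has_derivative (\<lambda>v. F1 \<xi> (S' \<xi> v))) (at \<xi>)" if \<xi>: "\<xi> \<in> box a b" for \<xi>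
  proof -
    have \<xi>V: "\<xi> \<in> V" using \<xi> box_cbox cbV by blast
    have "((\<lambda>\<xi>. F (T' \<xi>)) has_derivative (\<lambda>v. F1 \<xi> (S' \<xi> v))) (at \<xi>)"
      by (rule has_derivative_compose[OF ch.deriv[OF \<xi>V] dF[OF \<xi>]])
    then show ?thesis
      by (rule has_derivative_transform_within_open[OF _ ch.open_V \<xi>V]) (rule F')
  qed
  have dG': "(Gi i has_vector_derivative F1 \<xi> (S' \<xi> (axis i 1))) (at (\<xi>$i))" if \<xi>: "\<xi> \<in> box a b" for \<xi> i
  proof -
    have "((\<lambda>t. N0 (upd \<xi> i t)) has_vector_derivative F1 \<xi> (S' \<xi> (axis i 1))) (at (\<xi>$i))"
      using has_derivative_imp_partial[of N0 "\<lambda>v. F1 \<xi> (S' \<xi> v)" \<xi> UNIV i UNIV] dN0[OF \<xi>] by simp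
    then have "((\<lambda>t. N0 (upd \<xi> i t) - (N0 \<xi> - Gi i (\<xi>$i))) has_vector_derivative F1 \<xi> (S' \<xi> (axis i 1)) - 0) (at (\<xi>$i))"
      by (rule has_vector_derivative_diff) (rule has_vector_derivative_const)
    then show ?thesis by (simp add: line)
  qed
  have DG: "F1 \<xi> (S' \<xi> (axis i 1)) = DG i (\<xi>$i)" if \<xi>: "\<xi> \<in> box a b" for \<xi> i
    unfolding DG_def by (rule vector_derivative_at[OF dG'[OF \<xi>], symmetric])
  have dG: "(Gi i has_vector_derivative DG i t) (at t)" if t: "t \<in> {a$i<..<b$i}" for i t
    using dG'[OF upd_in_box[OF \<zeta> t], of i] DG[OF upd_in_box[OF \<zeta> t], of i] by simp
  have CR: "(\<Sum>k\<in>UNIV. cquat_of (emb \<psi> (S' \<xi> (axis k 1))) \<odot> (D\<Lambda> k \<xi> *\<^sub>R N0 \<xi> + DG k (\<xi>$k))) = 0"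
    if \<xi>: "\<xi> \<in> box a b" for \<xi>
  proof -
    have \<xi>V: "\<xi> \<in> V" using \<xi> box_cbox cbV by blast
    have "T' \<xi> \<in> \<Xi>" using \<xi> T'box by blast
    then have "cquat_of (CR_real \<psi> (\<lambda>x. \<Lambda> (T x)) (T' \<xi>)) \<odot> F (T' \<xi>) + CR \<psi> F (T' \<xi>) = 0"
      using h_CR unfolding frac_CR_def F_def \<Lambda>_def g_def by blast
    from ch.pulled_back_CR[OF psi(1) \<xi>V TT' dF[OF \<xi>] d\<Lambda>[OF box_cbox[OF \<xi>], unfolded at_box[OF \<xi>]] this]
    show ?thesis by (simp add: D\<Lambda>_def F'[OF \<xi>V] DG[OF \<xi>])
  qed

  \<comment> \<open>The linear equation bounds the derivative of \<open>Gi i\<close>.  This makes the values of \<open>Gi i\<close> at the ends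
    its limits, and then the right hand side of the equation extends the derivative.\<close>
  have "\<exists>G'. continuous_on {a$i..b$i} (Gi i) \<and> continuous_on {a$i..b$i} G' \<and> (\<forall>t\<in>{a$i<..<b$i}. G' t = DG i t) \<and>
      (\<exists>M. \<forall>s\<in>{a$i<..<b$i}. \<forall>t\<in>{a$i<..<b$i}. norm (Gi i s - Gi i t) \<le> M * \<bar>s - t\<bar>)" for i
  proof -
    obtain A B where A: "continuous_on {a$i..b$i} A" and B: "continuous_on {a$i..b$i} B"
      and ode: "\<And>t. t \<in> {a$i<..<b$i} \<Longrightarrow> DG i t = A t \<odot> Gi i t + B t"
      by (rule ch.slice_ode[where G = Gi and DG = DG and i = i, OF psi(1) cbV ab \<zeta> cD\<Lambda>])
         (rule CR[unfolded N0_def], assumption, rule that)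
    have M: "\<exists>M. \<forall>s\<in>{a$i<..<b$i}. \<forall>t\<in>{a$i<..<b$i}. norm (Gi i s - Gi i t) \<le> M * \<bar>s - t\<bar>"
      by (rule linear_ode_lipschitz[OF ab A B ode dG])
    then obtain M where "\<And>s t. s \<in> {a$i<..<b$i} \<Longrightarrow> t \<in> {a$i<..<b$i} \<Longrightarrow> norm (Gi i s - Gi i t) \<le> M * \<bar>s - t\<bar>" by blast
    then have c: "continuous_on {a$i..b$i} (Gi i)"
      unfolding Gi by (rule frac_integral_slice.continuous_G[OF slice])
    have "continuous_on {a$i..b$i} (\<lambda>t. A t \<odot> Gi i t + B t)"
      by (intro continuous_on_add qmult_complex.continuous_on A B c)
    with c M ode show ?thesis by (intro exI[of _ "\<lambda>t. A t \<odot> Gi i t + B t"]) auto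
  qed
  then obtain G' where cG: "\<And>i. continuous_on {a$i..b$i} (Gi i)" and cG': "\<And>i. continuous_on {a$i..b$i} (G' i)"
    and G': "\<And>i t. t \<in> {a$i<..<b$i} \<Longrightarrow> G' i t = DG i t"
    and lipG: "\<And>i. \<exists>M. \<forall>s\<in>{a$i<..<b$i}. \<forall>t\<in>{a$i<..<b$i}. norm (Gi i s - Gi i t) \<le> M * \<bar>s - t\<bar>"
    by metis
  have dGe: "(Gi i has_vector_derivative G' i t) (at t within {a$i..b$i})" if "t \<in> {a$i..b$i}" for i t
    by (rule primitive_up_to_boundary[OF less_imp_le[OF ab] cG cG' _ that]) (use dG G' in auto)
  define N where "N \<xi> = exp (\<Lambda> \<xi>) *\<^sub>R N0 \<xi>" for \<xi>
  define DN where "DN i \<xi> = exp (\<Lambda> \<xi>) *\<^sub>R (D\<Lambda> i \<xi> *\<^sub>R N0 \<xi> + G' i (\<xi>$i))" for i \<xi>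
  have coord: "\<xi>$i \<in> {a$i..b$i}" if "\<xi> \<in> cbox a b" for \<xi> i using that by (auto simp: mem_box_cart)
  have cN0: "continuous_on (cbox a b) N0"
    unfolding N0_def[abs_def] by (intro continuous_intros continuous_on_compose2[OF cG]) (use coord in auto)
  have cGx: "continuous_on (cbox a b) (\<lambda>\<xi>. G' i (\<xi>$i))" for i
    by (intro continuous_on_compose2[OF cG'] continuous_intros) (use coord in auto)
  interpret mp: monogenic_pullback V T' S' \<mu> P \<psi> a b N DN
  proof
    show "structural_set \<psi>" by (rule psi(1))
    show "cbox a b \<subseteq> V" by (rule cbV)
    show "continuous_on (cbox a b) N" unfolding N_def[abs_def] by (intro continuous_intros c\<Lambda> cN0)
    show cDN: "continuous_on (cbox a b) (DN i)" for i
      unfolding DN_def[abs_def] by (intro continuous_intros c\<Lambda> cN0 cD\<Lambda> cGx)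
    show "inj_on T' (cbox a b)" by (rule inj_on_inverseI[of _ T]) (use TT' cbV in auto)
    show "((\<lambda>t. N (upd \<xi> i t)) has_vector_derivative DN i \<xi>) (at (\<xi>$i) within {a$i..b$i})"
      if \<xi>: "\<xi> \<in> cbox a b" for i \<xi>
    proof -
      have "((\<lambda>t. \<Lambda> (upd \<xi> i t)) has_vector_derivative D\<Lambda> i \<xi>) (at (\<xi>$i) within {a$i..b$i})"
        unfolding D\<Lambda>_def by (rule has_derivative_imp_partial[OF d\<Lambda>[OF \<xi>]]) (use upd_in_cbox[OF \<xi>] in auto)
      then have "((\<lambda>t. exp (\<Lambda> (upd \<xi> i t))) has_field_derivative exp (\<Lambda> (upd \<xi> i (\<xi>$i))) * D\<Lambda> i \<xi>) (at (\<xi>$i) within {a$i..b$i})"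
        by (intro DERIV_chain2[OF DERIV_exp]) (simp add: has_real_derivative_iff_has_vector_derivative)
      moreover have "((\<lambda>t. N0 (upd \<xi> i t)) has_vector_derivative G' i (\<xi>$i) + 0) (at (\<xi>$i) within {a$i..b$i})"
        unfolding line by (intro has_vector_derivative_add dGe coord \<xi> has_vector_derivative_const)
      ultimately have "((\<lambda>t. exp (\<Lambda> (upd \<xi> i t)) *\<^sub>R N0 (upd \<xi> i t)) has_vector_derivative
          exp (\<Lambda> (upd \<xi> i (\<xi>$i))) *\<^sub>R (G' i (\<xi>$i) + 0) + (exp (\<Lambda> (upd \<xi> i (\<xi>$i))) * D\<Lambda> i \<xi>) *\<^sub>R N0 (upd \<xi> i (\<xi>$i))) (at (\<xi>$i) within {a$i..b$i})"
        by (rule has_vector_derivative_scaleR)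
      then show ?thesis by (simp add: N_def[abs_def] DN_def scaleR_right_distrib add.commute)
    qed
    show "(\<Sum>i\<in>UNIV. cquat_of (emb \<psi> (S' \<xi> (axis i 1))) \<odot> DN i \<xi>) = 0" if \<xi>: "\<xi> \<in> cbox a b" for \<xi>
    proof (rule continuous_constant_on_closure[of "box a b"])
      have "box a b \<noteq> {}" using \<zeta> by blast
      then have cl: "closure (box a b) = cbox a b" by (rule closure_box)
      have "continuous_on (cbox a b) (\<lambda>\<xi>. S' \<xi> v)" for v by (rule continuous_on_subset[OF ch.cont_deriv cbV])
      then show "continuous_on (closure (box a b)) (\<lambda>\<xi>. \<Sum>i\<in>UNIV. cquat_of (emb \<psi> (S' \<xi> (axis i 1))) \<odot> DN i \<xi>)"
        unfolding cl
        by (intro continuous_on_sum qmult_complex.continuous_on cDN bounded_linear.continuous_on[OF bounded_linear_cquat_of]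
            bounded_linear.continuous_on[OF bounded_linear_emb])
      show "\<xi> \<in> closure (box a b)" using \<xi> cl by simp
      show "(\<Sum>i\<in>UNIV. cquat_of (emb \<psi> (S' \<eta> (axis i 1))) \<odot> DN i \<eta>) = 0" if \<eta>: "\<eta> \<in> box a b" for \<eta>
      proof -
        have "\<eta>$i \<in> {a$i<..<b$i}" for i using \<eta> by (auto simp: mem_box_cart)
        then have "(\<Sum>i\<in>UNIV. cquat_of (emb \<psi> (S' \<eta> (axis i 1))) \<odot> DN i \<eta>)
          = exp (\<Lambda> \<eta>) *\<^sub>R (\<Sum>k\<in>UNIV. cquat_of (emb \<psi> (S' \<eta> (axis k 1))) \<odot> (D\<Lambda> k \<eta> *\<^sub>R N0 \<eta> + DG k (\<eta>$k)))"
          by (simp only: DN_def G' qmult_complex.scaleR_right scaleR_sum_right)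
        then show ?thesis using CR[OF \<eta>] by simp
      qed
    qed
  qed

  \<comment> \<open>The factor \<open>exp (- c)\<close> that does not depend on the integration variable is kept apart, since
    \<open>N\<close> contains \<open>exp \<circ> \<Lambda>\<close>.\<close>
  have face: "face_point i t w \<in> cbox a b" "\<And>\<xi>. \<xi> \<in> box a b \<Longrightarrow> face_point i t w \<noteq> \<xi>"
    if w: "w \<in> face_rect a b i" and t: "t = a$i \<or> t = b$i" for i t w
  proof -
    show "face_point i t w \<in> cbox a b" using w t ab[of i] by (auto simp: face_point_in_cbox)
    fix \<xi> assume "\<xi> \<in> box a b"
    then have "a$i < \<xi>$i \<and> \<xi>$i < b$i" by (simp add: mem_box_cart)
    then have "\<xi>$i \<noteq> t" using t by auto
    then show "face_point i t w \<noteq> \<xi>" by auto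
  qed
  have inV: "\<xi> \<in> V" if "\<xi> \<in> cbox a b" for \<xi> using that cbV by blast
  have integrand: "exp (\<Lambda> (T (T' \<xi>)) - c) *\<^sub>R (q \<odot> F (T' \<xi>)) = exp (- c) *\<^sub>R (q \<odot> N \<xi>)" if "\<xi> \<in> cbox a b" for c q \<xi>
    by (simp add: TT'[OF inV[OF that]] F'[OF inV[OF that]] N_def qmult_complex.scaleR_right exp_diff exp_minus divide_inverse mult.commute)

  have part1: "boundary_integrable \<psi> a b T' (\<lambda>x \<eta>. exp (\<Lambda> (T x)) *\<^sub>R (cquat_of \<eta> \<odot> F x))"
    "boundary_integral \<psi> a b T' (\<lambda>x \<eta>. exp (\<Lambda> (T x)) *\<^sub>R (cquat_of \<eta> \<odot> F x)) = 0"
  proof -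
    have \<Theta>: "exp (\<Lambda> (T (T' \<xi>))) *\<^sub>R (cquat_of \<eta> \<odot> F (T' \<xi>)) = 1 *\<^sub>R (cquat_of (qone \<odot> \<eta>) \<odot> N \<xi>)"
      if "\<xi> \<in> cbox a b" for \<xi> \<eta> using integrand[OF that, of 0] by simp
    have cont: "continuous_on (cbox a b) (mp.pulled_form (\<lambda>_. qone) i)" for i
      by (rule mp.continuous_pulled_form) auto
    have zero: "box_flux (mp.pulled_form (\<lambda>_. qone)) a b = 0"
      by (rule mp.pulled_form_flux_zero[where \<kappa>' = "\<lambda>_ _. 0"])
         (use less_imp_le[OF ab] in \<open>auto simp: qmult_real.zero_left\<close>)
    show "boundary_integrable \<psi> a b T' (\<lambda>x \<eta>. exp (\<Lambda> (T x)) *\<^sub>R (cquat_of \<eta> \<odot> F x))"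
      by (rule mp.boundary_integral_flux(1)[where \<kappa> = "\<lambda>_. qone" and r = 1, OF \<Theta> cont]) (use face in auto)
    have "boundary_integral \<psi> a b T' (\<lambda>x \<eta>. exp (\<Lambda> (T x)) *\<^sub>R (cquat_of \<eta> \<odot> F x)) = 1 *\<^sub>R box_flux (mp.pulled_form (\<lambda>_. qone)) a b"
      by (rule mp.boundary_integral_flux(2)[where \<kappa> = "\<lambda>_. qone" and r = 1, OF \<Theta> cont]) (use face in auto)
    then show "boundary_integral \<psi> a b T' (\<lambda>x \<eta>. exp (\<Lambda> (T x)) *\<^sub>R (cquat_of \<eta> \<odot> F x)) = 0" by (simp add: zero)
  qed

  have kernel_value: "exp (\<Lambda> (T (T' \<xi>)) - c) *\<^sub>R (cquat_of (cauchy_kernel \<psi> (T' \<xi> - x) \<odot> \<eta>) \<odot> F (T' \<xi>))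
      = exp (- c) *\<^sub>R (cquat_of (mp.kernel_at x (T' \<xi>) \<odot> \<eta>) \<odot> N \<xi>)" if "\<xi> \<in> cbox a b" for x c \<xi> \<eta>
    by (rule integrand[OF that])

  have interior: "boundary_integrable \<psi> a b T'
        (\<lambda>\<tau> \<eta>. exp (\<Lambda> (T \<tau>) - \<Lambda> \<xi>0) *\<^sub>R (cquat_of (cauchy_kernel \<psi> (\<tau> - T' \<xi>0) \<odot> \<eta>) \<odot> F \<tau>))"
      "boundary_integral \<psi> a b T'
        (\<lambda>\<tau> \<eta>. exp (\<Lambda> (T \<tau>) - \<Lambda> \<xi>0) *\<^sub>R (cquat_of (cauchy_kernel \<psi> (\<tau> - T' \<xi>0) \<odot> \<eta>) \<odot> F \<tau>)) = N0 \<xi>0"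
    if \<xi>0: "\<xi>0 \<in> box a b" for \<xi>0
  proof -
    have cont: "continuous_on (cbox a b - {\<xi>0}) (mp.pulled_form (mp.kernel_at (T' \<xi>0)) i)" for i
      by (rule mp.continuous_kernel_form[OF _ mp.S_notin_image[OF \<xi>0]]) auto
    show "boundary_integrable \<psi> a b T'
        (\<lambda>\<tau> \<eta>. exp (\<Lambda> (T \<tau>) - \<Lambda> \<xi>0) *\<^sub>R (cquat_of (cauchy_kernel \<psi> (\<tau> - T' \<xi>0) \<odot> \<eta>) \<odot> F \<tau>))"
      by (rule mp.boundary_integral_flux(1)[where \<kappa> = "mp.kernel_at (T' \<xi>0)" and r = "exp (- \<Lambda> \<xi>0)", OF kernel_value cont])
         (use face \<xi>0 in auto)
    have "boundary_integral \<psi> a b T'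
        (\<lambda>\<tau> \<eta>. exp (\<Lambda> (T \<tau>) - \<Lambda> \<xi>0) *\<^sub>R (cquat_of (cauchy_kernel \<psi> (\<tau> - T' \<xi>0) \<odot> \<eta>) \<odot> F \<tau>))
        = exp (- \<Lambda> \<xi>0) *\<^sub>R box_flux (mp.pulled_form (mp.kernel_at (T' \<xi>0))) a b"
      by (rule mp.boundary_integral_flux(2)[where \<kappa> = "mp.kernel_at (T' \<xi>0)" and r = "exp (- \<Lambda> \<xi>0)", OF kernel_value cont])
         (use face \<xi>0 in auto)
    also have "\<dots> = exp (- \<Lambda> \<xi>0) *\<^sub>R N \<xi>0" by (simp only: mp.cauchy_formula[OF \<xi>0])
    also have "\<dots> = N0 \<xi>0" by (simp add: N_def flip: exp_add)
    finally show "boundary_integral \<psi> a b T'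
        (\<lambda>\<tau> \<eta>. exp (\<Lambda> (T \<tau>) - \<Lambda> \<xi>0) *\<^sub>R (cquat_of (cauchy_kernel \<psi> (\<tau> - T' \<xi>0) \<odot> \<eta>) \<odot> F \<tau>)) = N0 \<xi>0" .
  qed

  have exterior: "boundary_integrable \<psi> a b T'
        (\<lambda>\<tau> \<eta>. exp (\<Lambda> (T \<tau>) - c) *\<^sub>R (cquat_of (cauchy_kernel \<psi> (\<tau> - x) \<odot> \<eta>) \<odot> F \<tau>))"
      "boundary_integral \<psi> a b T'
        (\<lambda>\<tau> \<eta>. exp (\<Lambda> (T \<tau>) - c) *\<^sub>R (cquat_of (cauchy_kernel \<psi> (\<tau> - x) \<odot> \<eta>) \<odot> F \<tau>)) = 0"
    if x: "x \<notin> closure \<Xi>" for x c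
  proof -
    have "box a b \<noteq> {}" using \<zeta> by blast
    then have cl: "closure (box a b) = cbox a b" by (rule closure_box)
    have "T' ` closure (box a b) \<subseteq> closure \<Xi>"
    proof (rule image_closure_subset)
      show "continuous_on (closure (box a b)) T'" unfolding cl by (rule continuous_on_subset[OF ch.continuous_S cbV])
      show "T' ` box a b \<subseteq> closure \<Xi>" unfolding T'box by (rule closure_subset)
    qed simp
    then have x': "x \<notin> T' ` cbox a b" using x cl by auto
    have cont: "continuous_on (cbox a b) (mp.pulled_form (mp.kernel_at x) i)" for i
      by (rule mp.continuous_kernel_form[OF _ x']) auto
    show "boundary_integrable \<psi> a b T'
        (\<lambda>\<tau> \<eta>. exp (\<Lambda> (T \<tau>) - c) *\<^sub>R (cquat_of (cauchy_kernel \<psi> (\<tau> - x) \<odot> \<eta>) \<odot> F \<tau>))"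
      by (rule mp.boundary_integral_flux(1)[where \<kappa> = "mp.kernel_at x" and r = "exp (- c)", OF kernel_value cont])
         (use face in auto)
    have "boundary_integral \<psi> a b T'
        (\<lambda>\<tau> \<eta>. exp (\<Lambda> (T \<tau>) - c) *\<^sub>R (cquat_of (cauchy_kernel \<psi> (\<tau> - x) \<odot> \<eta>) \<odot> F \<tau>))
        = exp (- c) *\<^sub>R box_flux (mp.pulled_form (mp.kernel_at x)) a b"
      by (rule mp.boundary_integral_flux(2)[where \<kappa> = "mp.kernel_at x" and r = "exp (- c)", OF kernel_value cont])
         (use face in auto)
    also have "box_flux (mp.pulled_form (mp.kernel_at x)) a b = 0"
      by (rule mp.kernel_flux_zero[OF order_refl less_imp_le[OF ab] x'])
    finally show "boundary_integral \<psi> a b T'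
        (\<lambda>\<tau> \<eta>. exp (\<Lambda> (T \<tau>) - c) *\<^sub>R (cquat_of (cauchy_kernel \<psi> (\<tau> - x) \<odot> \<eta>) \<odot> F \<tau>)) = 0" by simp
  qed

  \<comment> \<open>As a function of the \<open>j\<close>-th coordinate the Cauchy integral is \<open>Gi j\<close> plus a constant; \<open>FD j\<close> inverts
    the fractional integral \<open>Gi j\<close>, and the constant yields the two mixed terms.\<close>
  have derivative: "total_frac_deriv a (1 - \<alpha>) \<sigma> \<phi> \<zeta> H \<xi> =
      (\<Sum>i\<in>UNIV. cquat_of (g (upd \<zeta> i (\<xi>$i)))) +
      (\<Sum>i\<in>UNIV. \<Sum>j\<in>UNIV - {i}. partial_frac_deriv a (1 - \<alpha>) \<sigma> \<phi> \<zeta> j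
         (\<lambda>\<xi>. partial_frac_integral a (1 - \<alpha>) \<sigma> \<phi> \<zeta> i g (\<xi>$i)) \<xi>)"
    if H: "\<And>\<eta>. \<eta> \<in> box a b \<Longrightarrow> H \<eta> = N0 \<eta>" and \<xi>: "\<xi> \<in> box a b" for H \<xi>
  proof -
    define FD where "FD j w = frac_deriv (1 - \<alpha>$j) (\<sigma>$j) (phi_slice \<phi> \<zeta> j) (a$j) w (\<xi>$j)" for j w
    have \<xi>j: "\<xi>$j \<in> {a$j<..<b$j}" for j using \<xi> by (auto simp: mem_box_cart)
    have diag: "partial_frac_deriv a (1 - \<alpha>) \<sigma> \<phi> \<zeta> j H \<xi> = u j (\<xi>$j) + (FD j (\<lambda>_. Gi k (\<xi>$k)) + FD j (\<lambda>_. Gi l (\<xi>$l)))"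
      if jkl: "\<And>f :: 3 \<Rightarrow> cquat. sum f UNIV = f j + (f k + f l)" for j k l
    proof -
      define d where "d = Gi k (\<xi>$k) + Gi l (\<xi>$l)"
      obtain M where M: "\<And>s t. s \<in> {a$j<..<b$j} \<Longrightarrow> t \<in> {a$j<..<b$j} \<Longrightarrow> norm (Gi j s - Gi j t) \<le> M * \<bar>s - t\<bar>"
        using lipG[of j] by blast
      have Nd: "N0 \<xi> - Gi j (\<xi>$j) = d" by (simp add: N0_def jkl d_def)
      have "partial_frac_deriv a (1 - \<alpha>) \<sigma> \<phi> \<zeta> j H \<xi> = FD j (\<lambda>t. H (upd \<xi> j t))"
        by (simp add: partial_frac_deriv_def FD_def)
      also have "\<dots> = FD j (\<lambda>t. Gi j t + d)"
        unfolding FD_def by (rule frac_deriv_cong[OF \<xi>j]) (use H upd_in_box[OF \<xi>] line Nd in auto)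
      also have "\<dots> = u j (\<xi>$j) + FD j (\<lambda>_. d)"
        unfolding FD_def Gi by (rule frac_integral_slice.frac_deriv_G[OF slice M[unfolded Gi] \<xi>j])
      also have "FD j (\<lambda>_. d) = FD j (\<lambda>_. Gi k (\<xi>$k)) + FD j (\<lambda>_. Gi l (\<xi>$l))"
        unfolding FD_def d_def by (rule frac_integral_slice.frac_deriv_const_add[OF slice \<xi>j])
      finally show ?thesis .
    qed
    have off: "partial_frac_deriv a (1 - \<alpha>) \<sigma> \<phi> \<zeta> j (\<lambda>\<xi>. partial_frac_integral a (1 - \<alpha>) \<sigma> \<phi> \<zeta> i g (\<xi>$i)) \<xi>
        = FD j (\<lambda>_. Gi i (\<xi>$i))" if "i \<noteq> j" for i j
      using that by (simp add: partial_frac_deriv_def FD_def partial)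
    have sums: "sum f (UNIV - {0::3}) = f 1 + f 2" "sum f (UNIV - {1::3}) = f 0 + f 2" "sum f (UNIV - {2::3}) = f 0 + f 1"
      for f :: "3 \<Rightarrow> cquat"
    proof -
      have "UNIV - {0::3} = {1, 2}" "UNIV - {1::3} = {0, 2}" "UNIV - {2::3} = {0, 1}"
        unfolding UNIV_3_zero by auto
      then show "sum f (UNIV - {0::3}) = f 1 + f 2" "sum f (UNIV - {1::3}) = f 0 + f 2" "sum f (UNIV - {2::3}) = f 0 + f 1"
        by simp_all
    qed
    have "total_frac_deriv a (1 - \<alpha>) \<sigma> \<phi> \<zeta> H \<xi> =
        (u 0 (\<xi>$0) + (FD 0 (\<lambda>_. Gi 1 (\<xi>$1)) + FD 0 (\<lambda>_. Gi 2 (\<xi>$2)))) +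
        (u 1 (\<xi>$1) + (FD 1 (\<lambda>_. Gi 0 (\<xi>$0)) + FD 1 (\<lambda>_. Gi 2 (\<xi>$2)))) +
        (u 2 (\<xi>$2) + (FD 2 (\<lambda>_. Gi 0 (\<xi>$0)) + FD 2 (\<lambda>_. Gi 1 (\<xi>$1))))"
      unfolding total_frac_deriv_def sum_3_zero
      using diag[of 0 1 2] diag[of 1 0 2] diag[of 2 0 1] by (simp add: sum_3_zero ac_simps)
    then show ?thesis
      unfolding sum_3_zero sums by (simp add: off u_def)
  qed

  show ?thesis
  proof (intro conjI ballI allI impI)
    fix x assume x: "x \<in> \<Xi>"
    then have Tx: "T x \<in> box a b" using Xi(2) by blast
    show "boundary_integrable \<psi> a b T'
        (\<lambda>\<tau> \<eta>. exp (\<Lambda> (T \<tau>) - \<Lambda> (T x)) *\<^sub>R (cquat_of (cauchy_kernel \<psi> (\<tau> - x) \<odot> \<eta>) \<odot> F \<tau>))"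
      using interior(1)[OF Tx] by (simp only: T'T[OF x])
    show "total_frac_deriv a (1 - \<alpha>) \<sigma> \<phi> (T y)
          (\<lambda>\<xi>. boundary_integral \<psi> a b T'
             (\<lambda>\<tau> \<eta>. exp (\<Lambda> (T \<tau>) - \<Lambda> \<xi>) *\<^sub>R
                      (cquat_of (cauchy_kernel \<psi> (\<tau> - T' \<xi>) \<odot> \<eta>) \<odot> F \<tau>))) (T x)
        = (\<Sum>i\<in>UNIV. cquat_of ((h \<circ> T') (upd (T y) i (T x $ i)))) +
          (\<Sum>i\<in>UNIV. \<Sum>j\<in>UNIV - {i}.
             partial_frac_deriv a (1 - \<alpha>) \<sigma> \<phi> (T y) j
               (\<lambda>\<xi>. partial_frac_integral a (1 - \<alpha>) \<sigma> \<phi> (T y) i (h \<circ> T') (\<xi>$i)) (T x))"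
      by (rule derivative[unfolded \<zeta>_def g_def, OF interior(2) Tx])
  qed (use part1 exterior in auto)
qed

end
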